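(* Let $\mathcal{G}$ and $\mathcal{H}$ be two hypergraphs on the vertex set $V$ satisfying the intersection property, and let $n=\|\mathcal{G}\|+\|\mathcal{H}\|$. Then computing a new (not necessarily minimal) transversal of $\mathcal{G}$ with respect to $\mathcal{H}$ is feasible in $\mathrm{FDSPACE}[\log^2 n]$; that is, there is a deterministic algorithm using $O(\log^2 n)$ work space that outputs a new transversal of $\mathcal{G}$ w.r.t. $\mathcal{H}$ if one exists, and outputs a null value otherwise.
   Context: A hypergraph $\mathcal{G}=\langle V,E\rangle$ has finite vertex set $V$ and edge set $E\subseteq 2^V$; it is identified with its edge set. Both hypergraphs are on the common vertex set $V$, every vertex belongs to some edge, and hypergraphs are non-empty and do not contain the empty edge. A transversal of $\mathcal{G}$ is a set $T\subseteq V$ meeting every edge of $\mathcal{G}$. A set $S\subseteq V$ is an independent set of $\mathcal{H}$ if no edge of $\mathcal{H}$ is contained in $S$. A new transversal of $\mathcal{G}$ w.r.t. $\mathcal{H}$ is a transversal of $\mathcal{G}$ that is an independent set of $\mathcal{H}$. $\mathcal{G}$ and $\mathcal{H}$ satisfy the intersection property if $G\cap H\neq\emptyset$ for all $G\in\mathcal{G}$, $H\in\mathcal{H}$. $\|\mathcal{G}\|$ is the number of bits needed to represent $\mathcal{G}$ by adjacency lists of its edges. $\mathrm{FDSPACE}[f(n)]$ denotes functions computable by deterministic transducers with $O(f(n))$ work space. *)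

theory Defs
  imports Complex_Main "HOL-Library.Landau_Symbols"
begin

section \<open>Hypergraphs and new transversals\<close>

definition hypergraph :: "'v set \<Rightarrow> 'v set set \<Rightarrow> bool" where
  "hypergraph V E \<longleftrightarrow> finite V \<and> E \<subseteq> Pow V \<and> \<Union>E = V \<and> E \<noteq> {} \<and> {} \<notin> E"

definition transversal :: "'v set \<Rightarrow> 'v set set \<Rightarrow> 'v set \<Rightarrow> bool" where
  "transversal V G T \<longleftrightarrow> T \<subseteq> V \<and> (\<forall>E\<in>G. T \<inter> E \<noteq> {})"

definition independent_set :: "'v set \<Rightarrow> 'v set set \<Rightarrow> 'v set \<Rightarrow> bool" where
  "independent_set V H S \<longleftrightarrow> S \<subseteq> V \<and> (\<forall>E\<in>H. \<not> E \<subseteq> S)"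

definition new_transversal :: "'v set \<Rightarrow> 'v set set \<Rightarrow> 'v set set \<Rightarrow> 'v set \<Rightarrow> bool" where
  "new_transversal V G H T \<longleftrightarrow> transversal V G T \<and> independent_set V H T"

definition intersection_property :: "'v set set \<Rightarrow> 'v set set \<Rightarrow> bool" where
  "intersection_property G H \<longleftrightarrow> (\<forall>E\<in>G. \<forall>F\<in>H. E \<inter> F \<noteq> {})"


section \<open>Adjacency lists as bit strings\<close>

text \<open>
  Vertices are named by natural numbers written in binary.  Lists are made self-delimiting:
  each element is preceded by \<open>True\<close> and \<open>False\<close> closes the list.  With this code
  the length of a representation is literally its number of bits.
\<close>

definition enc_list :: "('a \<Rightarrow> bool list) \<Rightarrow> 'a list \<Rightarrow> bool list" where
  "enc_list e xs = concat (map (\<lambda>x. True # e x) xs) @ [False]"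

text \<open>Least significant bit first, no leading zeros; zero is the empty list.\<close>

fun binary :: "nat \<Rightarrow> bool list" where
  "binary n = (if n = 0 then [] else odd n # binary (n div 2))"

declare binary.simps [simp del]

definition enc_vertex :: "nat \<Rightarrow> bool list" where
  "enc_vertex v = enc_list (\<lambda>b. [b]) (binary v)"

definition enc_edge :: "nat list \<Rightarrow> bool list" where
  "enc_edge vs = enc_list enc_vertex vs"

definition enc_hypergraph :: "nat list list \<Rightarrow> bool list" where
  "enc_hypergraph es = enc_list enc_edge es"

text \<open>A list enumerating a vertex set without repetition, in any order.\<close>

definition lists_set :: "nat list \<Rightarrow> nat set \<Rightarrow> bool" where
  "lists_set vs E \<longleftrightarrow> distinct vs \<and> set vs = E"

text \<open>Adjacency lists of a hypergraph: every edge is listed exactly once, edges in any order.\<close>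

definition adjacency_lists :: "nat list list \<Rightarrow> nat set set \<Rightarrow> bool" where
  "adjacency_lists es G \<longleftrightarrow> (\<forall>vs\<in>set es. distinct vs) \<and> distinct (map set es) \<and> set ` set es = G"

text \<open>
  The number of bits of the adjacency lists of a hypergraph, which does not depend on the order
  of listing (see \<open>length_enc_hypergraph\<close>).
\<close>

definition hsize :: "nat set set \<Rightarrow> nat" where
  "hsize G = (\<Sum>E\<in>G. 1 + ((\<Sum>v\<in>E. 1 + length (enc_vertex v)) + 1)) + 1"

lemma length_enc_list: "length (enc_list e xs) = (\<Sum>x\<leftarrow>xs. 1 + length (e x)) + 1"
  by (induction xs) (auto simp: enc_list_def)

lemma length_enc_hypergraph:
  assumes "adjacency_lists es G"
  shows "length (enc_hypergraph es) = hsize G"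
proof -
  have d: "distinct es" "inj_on set (set es)" "set ` set es = G"
    and dv: "\<And>vs. vs \<in> set es \<Longrightarrow> distinct vs"
    using assms by (auto simp: adjacency_lists_def distinct_map)
  have edge: "length (enc_edge vs) = (\<Sum>v\<in>set vs. 1 + length (enc_vertex v)) + 1"
    if "vs \<in> set es" for vs
    unfolding enc_edge_def length_enc_list
    using dv[OF that] by (simp only: sum_list_distinct_conv_sum_set)
  have "length (enc_hypergraph es) = (\<Sum>vs\<in>set es. 1 + length (enc_edge vs)) + 1"
    unfolding enc_hypergraph_def length_enc_list
    using d(1) by (simp only: sum_list_distinct_conv_sum_set)
  also have "(\<Sum>vs\<in>set es. 1 + length (enc_edge vs))
      = (\<Sum>vs\<in>set es. 1 + ((\<Sum>v\<in>set vs. 1 + length (enc_vertex v)) + 1))"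
    using edge by (intro sum.cong) auto
  also have "\<dots> = (\<Sum>E\<in>G. 1 + ((\<Sum>v\<in>E. 1 + length (enc_vertex v)) + 1))"
    unfolding d(3)[symmetric] sum.reindex[OF d(2)] by (simp add: o_def)
  finally show ?thesis by (simp add: hsize_def)
qed

definition enc_instance :: "nat list list \<Rightarrow> nat list list \<Rightarrow> bool list" where
  "enc_instance gs hs = enc_hypergraph gs @ enc_hypergraph hs"

text \<open>The length of an input word is the parameter \<open>n\<close> of the complexity bound.\<close>

lemma length_enc_instance:
  assumes "adjacency_lists gs G" "adjacency_lists hs H"
  shows "length (enc_instance gs hs) = hsize G + hsize H"
  using assms by (simp add: enc_instance_def length_enc_hypergraph)

text \<open>The code is uniquely decodable.\<close>

lemma enc_list_prefix_free:
  assumes e: "\<And>x y r s. e x @ r = e y @ s \<Longrightarrow> x = y \<and> r = s"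
  shows "enc_list e xs @ r = enc_list e ys @ s \<Longrightarrow> xs = ys \<and> r = s"
proof (induction xs arbitrary: ys)
  case Nil
  then show ?case by (cases ys) (auto simp: enc_list_def)
next
  case (Cons x xs)
  then obtain y ys' where ys: "ys = y # ys'"
    by (cases ys) (auto simp: enc_list_def)
  have "e x @ (enc_list e xs @ r) = e y @ (enc_list e ys' @ s)"
    using Cons.prems by (simp add: ys enc_list_def)
  then show ?case using e Cons.IH ys by blast
qed

lemma binary_inject: "binary m = binary n \<Longrightarrow> m = n"
proof (induction m arbitrary: n rule: less_induct)
  case (less m)
  show ?case
  proof (cases "m = 0 \<or> n = 0")
    case True
    then show ?thesis using less.prems binary.simps[of m] binary.simps[of n]
      by (auto split: if_splits)
  next
    case False
    then have o: "odd m = odd n" and b: "binary (m div 2) = binary (n div 2)"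
      using less.prems binary.simps[of m] binary.simps[of n] by auto
    have "m div 2 = n div 2" using less.IH[OF _ b] False by simp
    then show ?thesis using o by (metis dvd_mult_div_cancel odd_two_times_div_two_succ)
  qed
qed

lemma enc_vertex_prefix_free:
  assumes "enc_vertex v @ r = enc_vertex w @ s" shows "v = w \<and> r = s"
proof -
  have "binary v = binary w \<and> r = s"
    by (rule enc_list_prefix_free[of "\<lambda>b. [b]"]) (use assms in \<open>auto simp: enc_vertex_def\<close>)
  then show ?thesis using binary_inject by blast
qed

lemma enc_edge_prefix_free: "enc_edge vs @ r = enc_edge ws @ s \<Longrightarrow> vs = ws \<and> r = s"
  unfolding enc_edge_def by (rule enc_list_prefix_free[OF enc_vertex_prefix_free])

lemma enc_instance_inject:
  assumes "enc_instance gs hs = enc_instance gs' hs'" shows "gs = gs' \<and> hs = hs'"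
proof -
  note pf = enc_list_prefix_free[OF enc_edge_prefix_free]
  have "gs = gs' \<and> enc_hypergraph hs = enc_hypergraph hs'"
    using assms pf unfolding enc_instance_def enc_hypergraph_def by blast
  then show ?thesis using pf[where xs = hs and ys = hs' and r = "[]" and s = "[]"]
    by (simp add: enc_hypergraph_def)
qed

text \<open>The null value is not the encoding of any vertex set, not even of the empty one.\<close>

definition null_output :: "bool list" where
  "null_output = []"

lemma null_output_not_edge: "enc_edge vs \<noteq> null_output"
  by (simp add: null_output_def enc_edge_def enc_list_def)


section \<open>Deterministic transducers\<close>

text \<open>
  A Turing machine with a two-way read-only input tape holding the input between two end markers,
  a fixed number of one-sided infinite work tapes, and a write-only output tape.
\<close>

datatype input_symbol = LeftEnd | Bit bool | RightEnd

datatype dir = Left | Stay | Right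

text \<open>
  A move gives the new state, the direction of the input head, for each work tape the symbol
  written and the direction of its head, and optionally a bit appended to the output.
  States and work symbols are \<open>{..<states M}\<close> and \<open>{..<symbols M}\<close>; state 0 is initial and
  symbol 0 is the blank.  The machine halts when \<open>delta\<close> returns \<open>None\<close>.
\<close>

type_synonym move = "nat \<times> dir \<times> (nat \<times> dir) list \<times> bool option"

record transducer =
  states :: nat
  symbols :: nat
  tapes :: nat
  delta :: "nat \<Rightarrow> input_symbol \<Rightarrow> nat list \<Rightarrow> move option"

definition wf_transducer :: "transducer \<Rightarrow> bool" where
  "wf_transducer M \<longleftrightarrow> 0 < states M \<and> 0 < symbols M \<and>
     (\<forall>q a ss q' d ws b.
        q < states M \<longrightarrow> length ss = tapes M \<longrightarrow> set ss \<subseteq> {..<symbols M} \<longrightarrow>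
        delta M q a ss = Some (q', d, ws, b) \<longrightarrow>
        q' < states M \<and> length ws = tapes M \<and> fst ` set ws \<subseteq> {..<symbols M})"

record config =
  state :: nat
  input_head :: nat
  work :: "nat \<Rightarrow> nat \<Rightarrow> nat"  \<comment> \<open>tape, cell\<close>
  work_head :: "nat \<Rightarrow> nat"
  written :: "bool list"

definition init_config :: config where
  "init_config = \<lparr>state = 0, input_head = 0, work = (\<lambda>_ _. 0), work_head = (\<lambda>_. 0), written = []\<rparr>"

definition input_at :: "bool list \<Rightarrow> nat \<Rightarrow> input_symbol" where
  "input_at w i =
     (if i = 0 then LeftEnd else if i \<le> length w then Bit (w ! (i - 1)) else RightEnd)"

text \<open>A head told to leave its tape on the left stays on the leftmost cell.\<close>

fun move_head :: "dir \<Rightarrow> nat \<Rightarrow> nat" where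
  "move_head Left i = i - 1"
| "move_head Stay i = i"
| "move_head Right i = i + 1"

definition next_move :: "transducer \<Rightarrow> bool list \<Rightarrow> config \<Rightarrow> move option" where
  "next_move M w c = delta M (state c) (input_at w (input_head c))
     (map (\<lambda>j. work c j (work_head c j)) [0..<tapes M])"

definition step :: "transducer \<Rightarrow> bool list \<Rightarrow> config \<Rightarrow> config" where
  "step M w c = (case next_move M w c of
      None \<Rightarrow> c
    | Some (q, d, ws, b) \<Rightarrow>
        \<lparr>state = q,
         input_head = min (length w + 1) (move_head d (input_head c)),
         work = (\<lambda>j. if j < tapes M then (work c j)(work_head c j := fst (ws ! j)) else work c j),
         work_head = (\<lambda>j. if j < tapes M then move_head (snd (ws ! j)) (work_head c j)
                          else work_head c j),
         written = written c @ (case b of None \<Rightarrow> [] | Some x \<Rightarrow> [x])\<rparr>)"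

definition config_at :: "transducer \<Rightarrow> bool list \<Rightarrow> nat \<Rightarrow> config" where
  "config_at M w t = (step M w ^^ t) init_config"

definition computes :: "transducer \<Rightarrow> (bool list \<Rightarrow> bool list) \<Rightarrow> bool" where
  "computes M f \<longleftrightarrow>
     (\<forall>w. \<exists>t. next_move M w (config_at M w t) = None \<and> written (config_at M w t) = f w)"

text \<open>
  On inputs of length \<open>n\<close> no work head leaves the first \<open>S n\<close> cells of its tape.  As the number
  of tapes is fixed, this is the number of work cells used up to a constant factor.
\<close>

definition runs_in_space :: "transducer \<Rightarrow> (nat \<Rightarrow> nat) \<Rightarrow> bool" where
  "runs_in_space M S \<longleftrightarrow>
     (\<forall>w t. \<forall>j<tapes M. work_head (config_at M w t) j < S (length w))"

definition FDSPACE :: "(nat \<Rightarrow> real) \<Rightarrow> (bool list \<Rightarrow> bool list) set" where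
  "FDSPACE s = {f. \<exists>M S. wf_transducer M \<and> computes M f \<and> runs_in_space M S \<and>
                         (\<lambda>n. real (S n)) \<in> O(s)}"

end

theory Submission
  imports Defs "HOL-Computational_Algebra.Primes" "HOL-Library.Discrete_Functions"
begin

text \<open>
  For a set \<open>X\<close> of excluded vertices consider the edges of \<open>H\<close> disjoint from \<open>X\<close> and the set
  \<open>T\<^sub>X\<close> of the vertices outside \<open>X\<close> that lie in at least half of them.  If there is a new transversal,
  then some \<open>T\<^sub>X\<close> is one where \<open>X\<close> is a union of \<open>O(log n)\<close> sets of the form \<open>{v}\<close> or \<open>E - {v}\<close>
  with \<open>v \<in> E \<in> G\<close>: as long as \<open>T\<^sub>X\<close> fails, a suitable such set halves the number of edges left.
  Each of these sets is named by a position of the input, so \<open>X\<close> takes \<open>O(log\<^sup>2 n)\<close> bits.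

  All of this is expressed by formulas with counting whose variables range over the numbers of
  \<open>W = O(log\<^sup>2 n)\<close> bits.  A machine evaluates such a formula by exhaustive search with one register
  of \<open>W\<close> bits per variable, and it always stays within its space bound since registers are never
  longer than \<open>W\<close>, whether or not the input is well-formed.
\<close>

section \<open>A structured language for transducers\<close>

text \<open>Neither the excluded set nor the transversal fits into the work space. Only the number
  that names the excluded set is kept, and every membership question is answered by rereading the
  input; time is of no concern. This works because a set \<open>T_X\<close> is recognized by
  counting, without a recursion along the halving steps, so one fixed formula with a fixed number of
  variables serves all inputs.

  Halving has two sources. A vertex outside a minimal new transversal that lies in at least half of
  the remaining edges removes these edges when it is excluded. A vertex \<open>v\<close> of the
  transversal that lies in fewer than half of them is the only vertex of the transversal in some
  edge \<open>E\<close> of \<open>G\<close>; by the intersection property the edges of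
  \<open>H\<close> that miss \<open>E - {v}\<close> all contain \<open>v\<close>.

  The obstacle for the coding is that formulas have sums and products but no exponentiation. The
  digits of the name cannot be addressed by an index, and are addressed by divisors of a power of
  two instead.\<close>

text \<open>
  All tapes hold bits.  The heads of the first six tapes never move, so these tapes serve as a
  finite memory; the heads of all other tapes move in lockstep.
\<close>

type_synonym local_view = "nat \<Rightarrow> bool"

datatype com =
    Act dir dir "input_symbol \<Rightarrow> local_view \<Rightarrow> local_view" "bool option"
  | Seq com com  (infixr ";;" 60)
  | Cond "input_symbol \<Rightarrow> local_view \<Rightarrow> bool" com com
  | While "input_symbol \<Rightarrow> local_view \<Rightarrow> bool" com

record st =
  ipos :: nat
  hpos :: nat
  cells :: "nat \<Rightarrow> nat \<Rightarrow> bool"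
  outp :: "bool list"

definition head_at :: "nat \<Rightarrow> nat \<Rightarrow> nat" where
  "head_at h j = (if j < 6 then 0 else h)"

definition view :: "nat \<Rightarrow> st \<Rightarrow> local_view" where
  "view k s = (\<lambda>j. j < k \<and> cells s j (head_at (hpos s) j))"

definition act :: "nat \<Rightarrow> bool list \<Rightarrow> dir \<Rightarrow> dir \<Rightarrow> (input_symbol \<Rightarrow> local_view \<Rightarrow> local_view) \<Rightarrow>
    bool option \<Rightarrow> st \<Rightarrow> st" where
  "act k w d D g b s =
    \<lparr>ipos = min (length w + 1) (move_head d (ipos s)),
     hpos = move_head D (hpos s),
     cells = (\<lambda>j. if j < k
        then (cells s j)(head_at (hpos s) j := g (input_at w (ipos s)) (view k s) j)
        else cells s j),
     outp = outp s @ (case b of None \<Rightarrow> [] | Some x \<Rightarrow> [x])\<rparr>"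

text \<open>Every action has to leave the heads within \<open>B\<close>, so one derivation certifies
  termination and the space bound together.\<close>

inductive big :: "nat \<Rightarrow> bool list \<Rightarrow> nat \<Rightarrow> com \<Rightarrow> st \<Rightarrow> st \<Rightarrow> bool"
  for k :: nat and w :: "bool list" and B :: nat where
  big_Act: "hpos (act k w d D g b s) \<le> B \<Longrightarrow> big k w B (Act d D g b) s (act k w d D g b s)"
| big_Seq: "big k w B c s s' \<Longrightarrow> big k w B d s' s'' \<Longrightarrow> big k w B (c ;; d) s s''"
| big_CondT: "t (input_at w (ipos s)) (view k s) \<Longrightarrow> big k w B c s s' \<Longrightarrow> big k w B (Cond t c d) s s'"
| big_CondF: "\<not> t (input_at w (ipos s)) (view k s) \<Longrightarrow> big k w B d s s' \<Longrightarrow> big k w B (Cond t c d) s s'"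
| big_WhileF: "\<not> t (input_at w (ipos s)) (view k s) \<Longrightarrow> big k w B (While t c) s s"
| big_WhileT: "t (input_at w (ipos s)) (view k s) \<Longrightarrow> big k w B c s s' \<Longrightarrow>
     big k w B (While t c) s' s'' \<Longrightarrow> big k w B (While t c) s s''"

subsection \<open>Compilation\<close>

datatype instr =
    IAct dir dir "input_symbol \<Rightarrow> local_view \<Rightarrow> local_view" "bool option"
  | IBranch "input_symbol \<Rightarrow> local_view \<Rightarrow> bool" nat nat

fun csize :: "com \<Rightarrow> nat" where
  "csize (Act d D g b) = 1"
| "csize (c ;; d) = csize c + csize d"
| "csize (Cond t c d) = csize c + csize d + 2"
| "csize (While t c) = csize c + 2"

text \<open>\<open>a\<close> is the absolute address of the first instruction, and control leaves a
  fragment at \<open>a + csize c\<close>. A branch with a constant test is a jump; its second target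
  0 is never taken.\<close>

fun code :: "nat \<Rightarrow> com \<Rightarrow> instr list" where
  "code a (Act d D g b) = [IAct d D g b]"
| "code a (c ;; d) = code a c @ code (a + csize c) d"
| "code a (Cond t c d) = IBranch t (a + 1) (a + csize c + 2) # code (a + 1) c @
     IBranch (\<lambda>_ _. True) (a + csize c + csize d + 2) 0 # code (a + csize c + 2) d"
| "code a (While t c) = IBranch t (a + 1) (a + csize c + 2) # code (a + 1) c @
     [IBranch (\<lambda>_ _. True) a 0]"

lemma length_code [simp]: "length (code a c) = csize c"
  by (induction c arbitrary: a) auto

text \<open>A target may be the address just past the code: this extra state has no move, and the
  machine halts there.\<close>

lemma code_targets: "IBranch t x y \<in> set (code a c) \<Longrightarrow> x \<le> a + csize c \<and> y \<le> a + csize c"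
  by (induction c arbitrary: a) fastforce+

definition read_view :: "nat \<Rightarrow> nat list \<Rightarrow> local_view" where
  "read_view k ss = (\<lambda>j. j < k \<and> ss ! j = 1)"

fun exec_instr :: "nat \<Rightarrow> nat \<Rightarrow> input_symbol \<Rightarrow> nat list \<Rightarrow> instr \<Rightarrow> move" where
  "exec_instr k q a ss (IAct d D g b) =
     (q + 1, d, map (\<lambda>j. (of_bool (g a (read_view k ss) j), if j < 6 then Stay else D)) [0..<k], b)"
| "exec_instr k q a ss (IBranch t x y) =
     (if t a (read_view k ss) then x else y, Stay, map (\<lambda>j. (ss ! j, Stay)) [0..<k], None)"

definition machine :: "nat \<Rightarrow> instr list \<Rightarrow> transducer" where
  "machine k p = \<lparr>states = length p + 1, symbols = 2, tapes = k,
     delta = (\<lambda>q a ss. if q < length p then Some (exec_instr k q a ss (p ! q)) else None)\<rparr>"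

lemma wf_machine: "wf_transducer (machine k (code 0 c))"
proof -
  have "q' < csize c + 1 \<and> length ws = k \<and> fst ` set ws \<subseteq> {..<2}"
    if q: "q < csize c" and ss: "length ss = k" "set ss \<subseteq> {..<2}"
      and e: "exec_instr k q a ss (code 0 c ! q) = (q', d, ws, b)" for q a ss q' d ws b
  proof (cases "code 0 c ! q")
    case (IAct d D g b)
    then show ?thesis using e q by auto
  next
    case (IBranch t x y)
    then have "IBranch t x y \<in> set (code 0 c)" using q by (metis length_code nth_mem)
    then have "x \<le> csize c \<and> y \<le> csize c" using code_targets[of t x y 0 c] by simp
    moreover have "ss ! j < 2" if "j < k" for j
      using ss that nth_mem[of j ss] by (auto simp: subset_iff simp del: nth_mem)
    ultimately show ?thesis using e ss IBranch by (auto split: if_splits)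
  qed
  then show ?thesis unfolding wf_transducer_def machine_def
    by (simp split: if_splits) blast
qed

text \<open>Heads with index \<open>k\<close> or more belong to no tape and \<open>step\<close>
  never moves them, hence the value 0 there.\<close>

definition conf :: "nat \<Rightarrow> nat \<Rightarrow> st \<Rightarrow> config" where
  "conf k q s = \<lparr>state = q, input_head = ipos s,
     work = (\<lambda>j i. of_bool (cells s j i)),
     work_head = (\<lambda>j. if j < k then head_at (hpos s) j else 0),
     written = outp s\<rparr>"

lemma read_view_conf:
  "read_view k (map (\<lambda>j. work (conf k q s) j (work_head (conf k q s) j)) [0..<k]) = view k s"
  by (auto simp: read_view_def view_def conf_def fun_eq_iff of_bool_def split: if_splits)

lemma next_move_conf:
  "next_move (machine k p) w (conf k q s) =
    (if q < length p then Some (exec_instr k q (input_at w (ipos s))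
       (map (\<lambda>j. work (conf k q s) j (work_head (conf k q s) j)) [0..<k]) (p ! q)) else None)"
  by (simp add: next_move_def machine_def conf_def)

lemma step_IAct:
  assumes "q < length p" "p ! q = IAct d D g b"
  shows "step (machine k p) w (conf k q s) = conf k (q + 1) (act k w d D g b s)"
  unfolding step_def next_move_conf
  using assms
  apply (simp add: read_view_conf)
  apply (simp add: act_def conf_def fun_eq_iff machine_def head_at_def)
  done

text \<open>\<open>step\<close> clamps the input head even for \<open>Stay\<close>, so a branch
  leaves the store alone only if the head already is on the tape between the end markers, these
  included.\<close>

lemma step_IBranch:
  assumes "q < length p" "p ! q = IBranch t x y" "ipos s \<le> length w + 1"
  shows "step (machine k p) w (conf k q s) =
    conf k (if t (input_at w (ipos s)) (view k s) then x else y) s"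
  unfolding step_def next_move_conf
  using assms
  by (simp add: read_view_conf)
     (auto simp: conf_def fun_eq_iff machine_def head_at_def)

definition reach :: "transducer \<Rightarrow> bool list \<Rightarrow> nat \<Rightarrow> config \<Rightarrow> config \<Rightarrow> bool" where
  "reach M w B c c' \<longleftrightarrow> (\<exists>t. (step M w ^^ t) c = c' \<and>
     (\<forall>u\<le>t. \<forall>j. work_head ((step M w ^^ u) c) j \<le> B))"

lemma reach_step: "step M w c = c' \<Longrightarrow> \<forall>j. work_head c j \<le> B \<Longrightarrow> \<forall>j. work_head c' j \<le> B \<Longrightarrow>
    reach M w B c c'"
  unfolding reach_def by (rule exI[of _ 1]) (auto simp: le_Suc_eq)

lemma reach_trans:
  assumes "reach M w B c d" "reach M w B d e" shows "reach M w B c e"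
proof -
  obtain t where t: "(step M w ^^ t) c = d" "\<And>u j. u \<le> t \<Longrightarrow> work_head ((step M w ^^ u) c) j \<le> B"
    using assms(1) unfolding reach_def by blast
  obtain t' where t': "(step M w ^^ t') d = e"
      "\<And>u j. u \<le> t' \<Longrightarrow> work_head ((step M w ^^ u) d) j \<le> B"
    using assms(2) unfolding reach_def by blast
  have "work_head ((step M w ^^ u) c) j \<le> B" if "u \<le> t' + t" for u j
  proof (cases "u \<le> t")
    case False
    then have "(step M w ^^ u) c = (step M w ^^ (u - t)) d"
      using t(1) funpow_add[of "u - t" t "step M w"] by simp
    then show ?thesis using t'(2)[of "u - t"] that by simp
  qed (use t in auto)
  moreover have "(step M w ^^ (t' + t)) c = e" using t t' by (simp add: funpow_add)
  ultimately show ?thesis unfolding reach_def by blast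
qed

lemma conf_heads: "hpos s \<le> B \<Longrightarrow> work_head (conf k q s) j \<le> B"
  by (simp add: conf_def head_at_def)

lemma reach_IAct:
  assumes "q < length p" "p ! q = IAct d D g b" "hpos s \<le> B" "hpos (act k w d D g b s) \<le> B"
  shows "reach (machine k p) w B (conf k q s) (conf k (q + 1) (act k w d D g b s))"
  using step_IAct assms conf_heads by (intro reach_step) auto

lemma reach_IBranch:
  assumes "q < length p" "p ! q = IBranch t x y" "hpos s \<le> B" "ipos s \<le> length w + 1"
  shows "reach (machine k p) w B (conf k q s)
    (conf k (if t (input_at w (ipos s)) (view k s) then x else y) s)"
  using step_IBranch assms conf_heads by (intro reach_step) auto

lemma big_invariants:
  "big k w B c s s' \<Longrightarrow> hpos s \<le> B \<and> ipos s \<le> length w + 1 \<Longrightarrow> hpos s' \<le> B \<and> ipos s' \<le> length w + 1"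
  by (induction rule: big.induct) (auto simp: act_def)

text \<open>Jump targets are absolute, so the code is considered in place, at address
  \<open>length P\<close>. When the induction hypothesis for a fragment is used, the siblings of the
  fragment move into \<open>P\<close> and \<open>Q\<close>.\<close>

lemma big_reach:
  assumes "big k w B c s s'" "hpos s \<le> B" "ipos s \<le> length w + 1"
  shows "reach (machine k (P @ code (length P) c @ Q)) w B (conf k (length P) s)
           (conf k (length P + csize c) s')"
  using assms
proof (induction arbitrary: P Q rule: big.induct)
  case (big_Act d D g b s)
  then show ?case
    using reach_IAct[of "length P" "P @ code (length P) (Act d D g b) @ Q" d D g b s B k w] by simp
next
  case (big_Seq c s s' d s'')
  note i = big_invariants[OF big_Seq.hyps(1)]
  show ?case
    using big_Seq.IH(1)[of P "code (length P + csize c) d @ Q"]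
      big_Seq.IH(2)[of "P @ code (length P) c" Q] big_Seq.prems i
    by (auto intro: reach_trans simp: add.assoc)
next
  case (big_CondT t s c s' d)
  note i = big_invariants[OF big_CondT.hyps(2)]
  let ?p = "P @ code (length P) (Cond t c d) @ Q"
  have "reach (machine k ?p) w B (conf k (length P) s) (conf k (length P + 1) s)"
    using reach_IBranch[of "length P" ?p t "length P + 1" "length P + csize c + 2" s B w k]
      big_CondT by simp
  moreover have "reach (machine k ?p) w B (conf k (length P + 1) s) (conf k (length P + csize c + 1) s')"
    using big_CondT.IH[of "P @ [IBranch t (length P + 1) (length P + csize c + 2)]"
       "IBranch (\<lambda>_ _. True) (length P + csize c + csize d + 2) 0 # code (length P + csize c + 2) d @ Q"]
      big_CondT.prems by (simp add: ac_simps)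
  moreover have "reach (machine k ?p) w B (conf k (length P + csize c + 1) s')
      (conf k (length P + csize c + csize d + 2) s')"
    using reach_IBranch[of "length P + csize c + 1" ?p "\<lambda>_ _. True" "length P + csize c + csize d + 2" 0 s' B w k]
      big_CondT i by (simp add: nth_append)
  ultimately show ?case by (simp add: add.assoc) (meson reach_trans)
next
  case (big_CondF t s d s' c)
  let ?p = "P @ code (length P) (Cond t c d) @ Q"
  have "reach (machine k ?p) w B (conf k (length P) s) (conf k (length P + csize c + 2) s)"
    using reach_IBranch[of "length P" ?p t "length P + 1" "length P + csize c + 2" s B w k]
      big_CondF by simp
  moreover have "reach (machine k ?p) w B (conf k (length P + csize c + 2) s)
      (conf k (length P + csize c + csize d + 2) s')"
    using big_CondF.IH[of "P @ IBranch t (length P + 1) (length P + csize c + 2) # code (length P + 1) c @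
     [IBranch (\<lambda>_ _. True) (length P + csize c + csize d + 2) 0]" Q] big_CondF.prems
    by (simp add: ac_simps)
  ultimately show ?case by (simp add: add.assoc) (meson reach_trans)
next
  case (big_WhileF t s c)
  let ?p = "P @ code (length P) (While t c) @ Q"
  show ?case
    using reach_IBranch[of "length P" ?p t "length P + 1" "length P + csize c + 2" s B w k]
      big_WhileF by (simp add: add.assoc)
next
  case (big_WhileT t s c s' s'')
  note i = big_invariants[OF big_WhileT.hyps(2)]
  let ?p = "P @ code (length P) (While t c) @ Q"
  have "reach (machine k ?p) w B (conf k (length P) s) (conf k (length P + 1) s)"
    using reach_IBranch[of "length P" ?p t "length P + 1" "length P + csize c + 2" s B w k]
      big_WhileT by simp
  moreover have "reach (machine k ?p) w B (conf k (length P + 1) s) (conf k (length P + csize c + 1) s')"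
    using big_WhileT.IH(1)[of "P @ [IBranch t (length P + 1) (length P + csize c + 2)]"
       "IBranch (\<lambda>_ _. True) (length P) 0 # Q"]
      big_WhileT.prems by (simp add: ac_simps)
  moreover have "reach (machine k ?p) w B (conf k (length P + csize c + 1) s') (conf k (length P) s')"
    using reach_IBranch[of "length P + csize c + 1" ?p "\<lambda>_ _. True" "length P" 0 s' B w k]
      big_WhileT i by (simp add: nth_append)
  moreover have "reach (machine k ?p) w B (conf k (length P) s') (conf k (length P + csize (While t c)) s'')"
    using big_WhileT.IH(2)[of P Q] big_WhileT.prems i by simp
  ultimately show ?case by (meson reach_trans)
qed

definition init_st :: st where
  "init_st = \<lparr>ipos = 0, hpos = 0, cells = (\<lambda>_ _. False), outp = []\<rparr>"

lemma conf_init: "conf k 0 init_st = init_config"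
  by (simp add: conf_def init_st_def init_config_def head_at_def fun_eq_iff)

text \<open>The halting configuration repeats forever, which carries the bound from the finite run
  over to all times. Head positions up to \<open>S\<close> mean \<open>S + 1\<close> cells.\<close>

lemma FDSPACE_com:
  assumes big: "\<And>w. \<exists>s. big k w (S (length w)) c init_st s \<and> outp s = f w"
    and S: "(\<lambda>n. real (S n + 1)) \<in> O(b)"
  shows "f \<in> FDSPACE b"
proof -
  let ?M = "machine k (code 0 c)"
  have r: "\<exists>s. reach ?M w (S (length w)) init_config (conf k (csize c) s) \<and> outp s = f w" for w
    using big[of w] big_reach[of k w "S (length w)" c init_st _ "[]" "[]"] conf_init
    by (fastforce simp: init_st_def)
  have halt: "next_move ?M w (conf k (csize c) s) = None" for w s
    by (simp add: next_move_conf)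
  have stay: "(step ?M w ^^ u) (conf k (csize c) s) = conf k (csize c) s" for u w s
    by (induction u) (simp_all add: step_def halt)
  have "computes ?M f"
    unfolding computes_def config_at_def
  proof
    fix w
    obtain s t where "(step ?M w ^^ t) init_config = conf k (csize c) s" "outp s = f w"
      using r[of w] unfolding reach_def by blast
    then show "\<exists>t. next_move ?M w ((step ?M w ^^ t) init_config) = None \<and>
        written ((step ?M w ^^ t) init_config) = f w"
      using halt[of w s] by (intro exI[of _ t]) (simp add: conf_def)
  qed
  moreover have "runs_in_space ?M (\<lambda>n. S n + 1)"
    unfolding runs_in_space_def
  proof (intro allI impI)
    fix w u j assume "j < tapes ?M"
    obtain s t where t: "(step ?M w ^^ t) init_config = conf k (csize c) s"
        "\<And>u j. u \<le> t \<Longrightarrow> work_head ((step ?M w ^^ u) init_config) j \<le> S (length w)"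
      using r[of w] unfolding reach_def by blast
    have "config_at ?M w u = config_at ?M w (min u t)"
    proof (cases "u \<le> t")
      case False
      then have "config_at ?M w u = (step ?M w ^^ (u - t)) (config_at ?M w t)"
        using funpow_add[of "u - t" t "step ?M w"] by (simp add: config_at_def)
      then show ?thesis using False t(1) stay by (simp add: config_at_def min_def)
    qed (simp add: min_def)
    then show "work_head (config_at ?M w u) j < S (length w) + 1"
      using t(2)[of "min u t" j] by (simp add: config_at_def)
  qed
  ultimately show ?thesis using wf_machine S unfolding FDSPACE_def by blast
qed

subsection \<open>Total correctness\<close>

definition tot :: "nat \<Rightarrow> bool list \<Rightarrow> nat \<Rightarrow> (st \<Rightarrow> bool) \<Rightarrow> com \<Rightarrow> (st \<Rightarrow> bool) \<Rightarrow> bool" where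
  "tot k w B P c Q \<longleftrightarrow> (\<forall>s. P s \<longrightarrow> (\<exists>s'. big k w B c s s' \<and> Q s'))"

lemma tot_Act:
  "(\<And>s. P s \<Longrightarrow> hpos (act k w d D g b s) \<le> B \<and> Q (act k w d D g b s)) \<Longrightarrow> tot k w B P (Act d D g b) Q"
  unfolding tot_def using big_Act by blast

lemma tot_Seq: "tot k w B P c Q \<Longrightarrow> tot k w B Q d R \<Longrightarrow> tot k w B P (c ;; d) R"
  unfolding tot_def using big_Seq by blast

lemma tot_Cond:
  assumes "tot k w B (\<lambda>s. P s \<and> t (input_at w (ipos s)) (view k s)) c Q"
    and "tot k w B (\<lambda>s. P s \<and> \<not> t (input_at w (ipos s)) (view k s)) d Q"
  shows "tot k w B P (Cond t c d) Q"
  using assms unfolding tot_def by (metis big_CondT big_CondF)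

lemma tot_conseq:
  "tot k w B P c Q \<Longrightarrow> (\<And>s. P' s \<Longrightarrow> P s) \<Longrightarrow> (\<And>s. Q s \<Longrightarrow> Q' s) \<Longrightarrow> tot k w B P' c Q'"
  unfolding tot_def by blast

lemma tot_fix: "(\<And>s0. P s0 \<Longrightarrow> tot k w B (\<lambda>s. s = s0) c Q) \<Longrightarrow> tot k w B P c Q"
  unfolding tot_def by blast

text \<open>The number \<open>m\<close> of rounds is known beforehand, so the index of the invariant
  also proves termination.\<close>

lemma tot_While:
  assumes body: "\<And>i. i < m \<Longrightarrow> tot k w B (I i) c (I (Suc i))"
    and true: "\<And>i s. i < m \<Longrightarrow> I i s \<Longrightarrow> t (input_at w (ipos s)) (view k s)"
    and false: "\<And>s. I m s \<Longrightarrow> \<not> t (input_at w (ipos s)) (view k s)"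
  shows "tot k w B (I 0) (While t c) (I m)"
proof -
  have "tot k w B (I i) (While t c) (I m)" if "i \<le> m" for i
    using that
  proof (induction rule: inc_induct)
    case base
    then show ?case unfolding tot_def using false big_WhileF by blast
  next
    case (step i)
    then show ?case using body[of i] true[of i] big_WhileT unfolding tot_def by (metis (no_types))
  qed
  then show ?thesis by simp
qed

section \<open>Sweeps of the heads over the marked working area\<close>

definition put :: "nat \<Rightarrow> (local_view \<Rightarrow> local_view) \<Rightarrow> nat \<Rightarrow> (nat \<Rightarrow> nat \<Rightarrow> bool) \<Rightarrow> nat \<Rightarrow> nat \<Rightarrow> bool" where
  "put k g h f = (\<lambda>j. if j < k
     then (f j)(head_at h j := g (\<lambda>j. j < k \<and> f j (head_at h j)) j) else f j)"

lemma put_id [simp]: "put k (\<lambda>v. v) h f = f"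
  by (auto simp: put_def fun_eq_iff)

lemma act_put:
  "act k w d D (\<lambda>_. g) b s = \<lparr>ipos = min (length w + 1) (move_head d (ipos s)),
     hpos = move_head D (hpos s), cells = put k g (hpos s) (cells s),
     outp = outp s @ (case b of None \<Rightarrow> [] | Some x \<Rightarrow> [x])\<rparr>"
  by (simp add: act_def put_def view_def fun_eq_iff)

text \<open>
  Tape 6 marks the cells of the working area, tape 7 its first cell.  The last action \<open>e\<close> takes
  place on the first column to the right of the area and may thus extend it.
\<close>

definition sweep :: "(local_view \<Rightarrow> local_view) \<Rightarrow> (local_view \<Rightarrow> local_view) \<Rightarrow> com" where
  "sweep g e = While (\<lambda>_ v. v 6) (Act Stay Right (\<lambda>_. g) None) ;; Act Stay Stay (\<lambda>_. e) None ;;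
     While (\<lambda>_ v. \<not> v 7) (Act Stay Left (\<lambda>_ v. v) None)"

definition ruled :: "nat \<Rightarrow> (nat \<Rightarrow> nat \<Rightarrow> bool) \<Rightarrow> bool" where
  "ruled W f \<longleftrightarrow> f 6 = (\<lambda>l. l < W) \<and> f 7 = (\<lambda>l. l = 0)"

text \<open>\<open>J i\<close> describes the tapes after the first \<open>i\<close> columns have
  been treated. The marks on tapes 6 and 7 are how the heads find the end of the area and the way
  back, so \<open>g\<close> has to preserve both and \<open>e\<close> the second one. The heads get
  as far as column \<open>W\<close>, just behind the area.\<close>

lemma tot_sweep:
  assumes k: "7 < k" and W: "W \<le> B" and a: "a \<le> length w + 1"
    and g: "\<And>v. g v 6 = v 6" "\<And>v. g v 7 = v 7" and e: "\<And>v. e v 7 = v 7"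
    and J: "\<And>i f. i < W \<Longrightarrow> J i f \<Longrightarrow> ruled W f \<Longrightarrow> J (Suc i) (put k g i f)"
  shows "tot k w B
    (\<lambda>s. hpos s = 0 \<and> ruled W (cells s) \<and> J 0 (cells s) \<and> ipos s = a \<and> outp s = X)
    (sweep g e)
    (\<lambda>s. hpos s = 0 \<and> (\<exists>f. ruled W f \<and> J W f \<and> cells s = put k e W f) \<and> ipos s = a \<and> outp s = X)"
proof -
  let ?I = "\<lambda>i (s :: st). hpos s = i \<and> ruled W (cells s) \<and> J i (cells s) \<and> ipos s = a \<and> outp s = X"
  have 1: "tot k w B (?I 0) (While (\<lambda>_ v. v 6) (Act Stay Right (\<lambda>_. g) None)) (?I W)"
  proof (rule tot_While[where I = ?I])
    fix i assume i: "i < W"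
    have "ruled W (put k g i f)" if "ruled W f" for f
      using that k g by (auto simp: ruled_def put_def fun_eq_iff head_at_def)
    then show "tot k w B (?I i) (Act Stay Right (\<lambda>_. g) None) (?I (Suc i))"
      using J[OF i] i W a by (intro tot_Act) (auto simp: act_put)
  qed (use k in \<open>auto simp: view_def ruled_def head_at_def\<close>)
  let ?F = "\<lambda>s :: st. (\<exists>f. ruled W f \<and> J W f \<and> cells s = put k e W f) \<and> ipos s = a \<and> outp s = X"
  have 2: "tot k w B (?I W) (Act Stay Stay (\<lambda>_. e) None) (\<lambda>s. hpos s = W \<and> ?F s)"
    using W a by (intro tot_Act) (auto simp: act_put)
  have mark: "put k e W f 7 = (\<lambda>l. l = 0)" if "ruled W f" for f
    using that k e by (auto simp: ruled_def put_def fun_eq_iff head_at_def)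
  have 3: "tot k w B (\<lambda>s. hpos s = W - 0 \<and> ?F s)
      (While (\<lambda>_ v. \<not> v 7) (Act Stay Left (\<lambda>_ v. v) None)) (\<lambda>s. hpos s = W - W \<and> ?F s)"
  proof (rule tot_While[where I = "\<lambda>i s. hpos s = W - i \<and> ?F s"])
    fix i assume i: "i < W"
    show "tot k w B (\<lambda>s. hpos s = W - i \<and> ?F s) (Act Stay Left (\<lambda>_ v. v) None) (\<lambda>s. hpos s = W - Suc i \<and> ?F s)"
      using i W a by (intro tot_Act) (auto simp: act_put)
  next
    fix i and s :: st assume "i < W" "hpos s = W - i \<and> ?F s"
    then show "\<not> view k s 7" using k mark by (auto simp: view_def head_at_def)
  next
    fix s :: st assume "hpos s = W - W \<and> ?F s"
    then show "\<not> \<not> view k s 7" using k mark by (auto simp: view_def head_at_def)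
  qed
  show ?thesis unfolding sweep_def
    using tot_Seq[OF 1 tot_Seq[OF 2]] 3 by simp
qed

section \<open>Register programs\<close>

fun val :: "nat \<Rightarrow> (nat \<Rightarrow> bool) \<Rightarrow> nat" where
  "val 0 x = 0"
| "val (Suc i) x = val i x + of_bool (x i) * 2 ^ i"

lemma val_less: "val i x < 2 ^ i"
  by (induction i) (auto simp: less_imp_le_nat trans_less_add1)

lemma val_cong: "(\<And>l. l < i \<Longrightarrow> x l = y l) \<Longrightarrow> val i x = val i y"
  by (induction i) auto

text \<open>Register \<open>r\<close> lives on tape \<open>11 + r\<close>, least significant bit first.\<close>

record ast =
  reg :: "nat \<Rightarrow> nat"
  flag :: "nat \<Rightarrow> bool"
  ip :: nat
  outs :: "bool list"

text \<open>Tapes 8 to 10 only serve to mark out the area and are left unconstrained, as are all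
  cells of a register beyond the first \<open>W\<close>.\<close>

definition rep :: "bool list \<Rightarrow> nat \<Rightarrow> ast \<Rightarrow> st \<Rightarrow> bool" where
  "rep w W a s \<longleftrightarrow> hpos s = 0 \<and> ruled W (cells s) \<and> (\<forall>r. val W (cells s (11 + r)) = reg a r) \<and>
     flag a = (\<lambda>j. j < 6 \<and> cells s j 0) \<and> ipos s = ip a \<and> ip a \<le> length w + 1 \<and> outp s = outs a"

locale bounded_registers =
  fixes k :: nat and w :: "bool list" and W :: nat
  assumes k: "11 < k" and W: "0 < W"
begin

definition ht :: "(ast \<Rightarrow> bool) \<Rightarrow> com \<Rightarrow> (ast \<Rightarrow> bool) \<Rightarrow> bool" where
  "ht P c Q \<longleftrightarrow> tot k w W (\<lambda>s. \<exists>a. rep w W a s \<and> P a) c (\<lambda>s. \<exists>a. rep w W a s \<and> Q a)"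

lemma ht_Seq: "ht P c Q \<Longrightarrow> ht Q d R \<Longrightarrow> ht P (c ;; d) R"
  unfolding ht_def by (rule tot_Seq)

lemma ht_conseq: "ht P c Q \<Longrightarrow> (\<And>a. P' a \<Longrightarrow> P a) \<Longrightarrow> (\<And>a. Q a \<Longrightarrow> Q' a) \<Longrightarrow> ht P' c Q'"
  unfolding ht_def tot_def by meson

lemma ht_fix: "(\<And>a0. P a0 \<Longrightarrow> ht (\<lambda>a. a = a0) c Q) \<Longrightarrow> ht P c Q"
  unfolding ht_def tot_def by meson

text \<open>Restricting a test to the flags makes its outcome a function of the abstract
  state.\<close>

definition ftest :: "(input_symbol \<Rightarrow> local_view \<Rightarrow> bool) \<Rightarrow> input_symbol \<Rightarrow> local_view \<Rightarrow> bool" where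
  "ftest t = (\<lambda>a v. t a (\<lambda>j. j < 6 \<and> v j))"

lemma ftest_rep:
  assumes "rep w W a s"
  shows "ftest t (input_at w (ipos s)) (view k s) = t (input_at w (ip a)) (flag a)"
proof -
  have "(\<lambda>j. j < 6 \<and> view k s j) = flag a"
    using assms k by (auto simp: rep_def view_def head_at_def fun_eq_iff)
  then show ?thesis using assms by (simp add: ftest_def rep_def)
qed

lemma ht_Cond:
  assumes "ht (\<lambda>a. P a \<and> t (input_at w (ip a)) (flag a)) c Q"
    and "ht (\<lambda>a. P a \<and> \<not> t (input_at w (ip a)) (flag a)) d Q"
  shows "ht P (Cond (ftest t) c d) Q"
  using assms unfolding ht_def
  by (intro tot_Cond) (auto simp: ftest_rep elim!: tot_conseq)

lemma ht_While:
  assumes body: "\<And>i. i < m \<Longrightarrow> ht (I i) c (I (Suc i))"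
    and true: "\<And>i a. i < m \<Longrightarrow> I i a \<Longrightarrow> t (input_at w (ip a)) (flag a)"
    and false: "\<And>a. I m a \<Longrightarrow> \<not> t (input_at w (ip a)) (flag a)"
  shows "ht (I 0) (While (ftest t) c) (I m)"
  unfolding ht_def
  by (rule tot_While[where I = "\<lambda>i s. \<exists>a. rep w W a s \<and> I i a"])
     (use assms in \<open>auto simp: ht_def ftest_rep\<close>)

definition fact :: "dir \<Rightarrow> (input_symbol \<Rightarrow> local_view \<Rightarrow> local_view) \<Rightarrow> bool option \<Rightarrow> com" where
  "fact d g b = Act d Stay (\<lambda>a v j. if j < 6 then g a (\<lambda>j. j < 6 \<and> v j) j else v j) b"

lemma ht_fact:
  assumes "\<And>a. P a \<Longrightarrow> Q (a\<lparr>flag := (\<lambda>j. j < 6 \<and> g (input_at w (ip a)) (flag a) j),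
     ip := min (length w + 1) (move_head d (ip a)),
     outs := outs a @ (case b of None \<Rightarrow> [] | Some x \<Rightarrow> [x])\<rparr>)"
  shows "ht P (fact d g b) Q"
proof -
  define G where "G = (\<lambda>a v j. if j < 6 then g a (\<lambda>j. j < 6 \<and> v j) j else v j)"
  have "tot k w W (\<lambda>s. \<exists>a. rep w W a s \<and> P a) (Act d Stay G b) (\<lambda>s. \<exists>a. rep w W a s \<and> Q a)"
  proof (rule tot_Act, elim exE conjE)
    fix s a assume r: "rep w W a s" and p: "P a"
    let ?s = "act k w d Stay G b s"
    let ?a = "a\<lparr>flag := (\<lambda>j. j < 6 \<and> g (input_at w (ip a)) (flag a) j),
       ip := min (length w + 1) (move_head d (ip a)),
       outs := outs a @ (case b of None \<Rightarrow> [] | Some x \<Rightarrow> [x])\<rparr>"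
    have v: "(\<lambda>j. j < 6 \<and> view k s j) = flag a"
      using r k by (auto simp: rep_def view_def head_at_def fun_eq_iff)
    have i: "ipos s = ip a" using r by (simp add: rep_def)
    have c: "cells ?s j = cells s j" if "6 \<le> j" for j
      using that by (auto simp: G_def act_def view_def fun_eq_iff)
    have f: "cells ?s j 0 = g (input_at w (ip a)) (flag a) j" if "j < 6" for j
      using that k by (simp add: G_def act_def head_at_def v i)
    have "rep w W ?a ?s"
      unfolding rep_def
    proof (intro conjI)
      show "ruled W (cells ?s)" "\<forall>q. val W (cells ?s (11 + q)) = reg ?a q"
        using r c by (auto simp: rep_def ruled_def)
      show "flag ?a = (\<lambda>j. j < 6 \<and> cells ?s j 0)"
        using f by auto
    qed (use r in \<open>auto simp: rep_def act_def\<close>)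
    moreover have "hpos ?s \<le> W" using r by (simp add: rep_def act_def)
    ultimately show "hpos ?s \<le> W \<and> (\<exists>a. rep w W a ?s \<and> Q a)" using assms[OF p] by blast
  qed
  then show ?thesis unfolding ht_def fact_def G_def .
qed

definition update :: "((nat \<Rightarrow> bool) \<Rightarrow> bool) \<Rightarrow> bool option \<Rightarrow> com" where
  "update g b = fact Stay (\<lambda>_ v. v(0 := g v)) b"

lemma flag_rep: "rep w W a s \<Longrightarrow> (\<lambda>j. j < 6 \<and> flag a j) = flag a"
  by (auto simp: rep_def)

lemma ht_update:
  assumes "\<And>a. P a \<Longrightarrow> Q (a\<lparr>flag := (flag a)(0 := g (flag a)),
    outs := outs a @ (case b of None \<Rightarrow> [] | Some x \<Rightarrow> [x])\<rparr>)"
  shows "ht P (update g b) Q"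
proof -
  have "ht (\<lambda>a. P a \<and> (\<exists>s. rep w W a s)) (update g b) Q"
    unfolding update_def
  proof (rule ht_fact, elim conjE exE)
    fix a s assume a: "P a" "rep w W a s"
    have "(\<lambda>j. j < 6 \<and> ((flag a)(0 := g (flag a))) j) = (flag a)(0 := g (flag a))"
      using fun_cong[OF flag_rep[OF a(2)]] by (auto simp: fun_eq_iff)
    moreover have "ip a \<le> length w + 1" using a(2) by (simp add: rep_def)
    ultimately show "Q (a\<lparr>flag := \<lambda>j. j < 6 \<and> ((flag a)(0 := g (flag a))) j,
        ip := min (length w + 1) (move_head Stay (ip a)),
        outs := outs a @ (case b of None \<Rightarrow> [] | Some x \<Rightarrow> [x])\<rparr>)"
      using assms[OF a(1)] by simp
  qed
  then show ?thesis unfolding ht_def by (rule tot_conseq) auto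
qed

definition set_flag :: "bool \<Rightarrow> com" where "set_flag c = update (\<lambda>_. c) None"
definition flip :: com where "flip = update (\<lambda>v. \<not> v 0) None"
definition skip :: com where "skip = update (\<lambda>v. v 0) None"
definition emit :: "bool \<Rightarrow> com" where "emit b = update (\<lambda>v. v 0) (Some b)"

lemma ht_set_flag: "(\<And>a. P a \<Longrightarrow> Q (a\<lparr>flag := (flag a)(0 := c)\<rparr>)) \<Longrightarrow> ht P (set_flag c) Q"
  unfolding set_flag_def by (rule ht_update) simp

lemma ht_flip: "(\<And>a. P a \<Longrightarrow> Q (a\<lparr>flag := (flag a)(0 := \<not> flag a 0)\<rparr>)) \<Longrightarrow> ht P flip Q"
  unfolding flip_def by (rule ht_update) simp

lemma ht_skip: "(\<And>a. P a \<Longrightarrow> Q a) \<Longrightarrow> ht P skip Q"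
  unfolding skip_def by (rule ht_update) simp

lemma ht_emit: "(\<And>a. P a \<Longrightarrow> Q (a\<lparr>outs := outs a @ [b]\<rparr>)) \<Longrightarrow> ht P (emit b) Q"
  unfolding emit_def by (rule ht_update) simp

fun state_at :: "(bool \<Rightarrow> bool \<Rightarrow> bool \<Rightarrow> bool) \<Rightarrow> bool \<Rightarrow> (nat \<Rightarrow> bool) \<Rightarrow> (nat \<Rightarrow> bool) \<Rightarrow> nat \<Rightarrow> bool" where
  "state_at h c x y 0 = c"
| "state_at h c x y (Suc i) = h (state_at h c x y i) (x i) (y i)"

text \<open>
  Flag 0 is the state of a Mealy machine: \<open>h1\<close> gives the new bit of \<open>r\<close> and \<open>h2\<close> the next state.
\<close>

definition regop :: "nat \<Rightarrow> nat \<Rightarrow> bool \<Rightarrow> (bool \<Rightarrow> bool \<Rightarrow> bool \<Rightarrow> bool) \<Rightarrow> (bool \<Rightarrow> bool \<Rightarrow> bool \<Rightarrow> bool) \<Rightarrow> com" where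
  "regop r t c h1 h2 = set_flag c ;;
     sweep (\<lambda>v. v(11 + r := h1 (v 0) (v (11 + r)) (v (11 + t)), 0 := h2 (v 0) (v (11 + r)) (v (11 + t))))
       (\<lambda>v. v)"

text \<open>Reduces a register operation to two facts about numbers: \<open>V\<close> is what the
  written bits amount to, \<open>F\<close> is what the final state of the Mealy machine
  says.\<close>

lemma ht_regop:
  assumes r: "11 + r < k" and t: "11 + t < k"
    and V: "\<And>x y. val W (\<lambda>l. h1 (state_at h2 c x y l) (x l) (y l)) = V (val W x) (val W y)"
    and F: "\<And>x y. state_at h2 c x y W = F (val W x) (val W y)"
    and Q: "\<And>a. P a \<Longrightarrow> Q (a\<lparr>reg := (reg a)(r := V (reg a r) (reg a t)),
        flag := (flag a)(0 := F (reg a r) (reg a t))\<rparr>)"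
  shows "ht P (regop r t c h1 h2) Q"
proof (rule ht_fix)
  fix a0 assume a0: "P a0"
  let ?g = "\<lambda>v. v(11 + r := h1 (v 0) (v (11 + r)) (v (11 + t)), 0 := h2 (v 0) (v (11 + r)) (v (11 + t)))"
  let ?a1 = "a0\<lparr>flag := (flag a0)(0 := c)\<rparr>"
  let ?a2 = "a0\<lparr>reg := (reg a0)(r := V (reg a0 r) (reg a0 t)),
        flag := (flag a0)(0 := F (reg a0 r) (reg a0 t))\<rparr>"
  have "ht (\<lambda>a. a = a0) (set_flag c) (\<lambda>a. a = ?a1)" by (rule ht_set_flag) simp
  then have 1: "tot k w W (\<lambda>s. rep w W a0 s) (set_flag c) (\<lambda>s. rep w W ?a1 s)"
    unfolding ht_def by (rule tot_conseq) auto
  have 2: "tot k w W (\<lambda>s. rep w W ?a1 s) (sweep ?g (\<lambda>v. v)) (\<lambda>s. rep w W ?a2 s)"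
  proof (rule tot_fix)
    fix s assume s: "rep w W ?a1 s"
    let ?x = "cells s (11 + r)" and ?y = "cells s (11 + t)"
    let ?z = "\<lambda>l. h1 (state_at h2 c ?x ?y l) (?x l) (?y l)"
    define J where "J i f \<longleftrightarrow> f 0 = (cells s 0)(0 := state_at h2 c ?x ?y i) \<and>
        f (11 + r) = (\<lambda>l. if l < i then ?z l else ?x l) \<and>
        (\<forall>j. j \<noteq> 0 \<longrightarrow> j \<noteq> 11 + r \<longrightarrow> f j = cells s j)" for i f
    have step: "J (Suc i) (put k ?g i f)" if "i < W" "J i f" for i f
    proof -
      \<comment> \<open>Column \<open>i\<close> still holds its old bits when it is read, so the two
        registers may coincide.\<close>
      have "f (11 + t) i = ?y i" using that(2) by (cases "t = r") (auto simp: J_def)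
      then show ?thesis using that(2) k r t
        by (auto simp: J_def put_def head_at_def fun_eq_iff less_Suc_eq)
    qed
    have "cells s 0 0 = c"
    proof -
      have "flag ?a1 = (\<lambda>j. j < 6 \<and> cells s j 0)" using s by (simp add: rep_def)
      from fun_cong[OF this, of 0] show ?thesis by simp
    qed
    then have "J 0 (cells s)" by (simp add: J_def fun_eq_iff)
    have fin: "rep w W ?a2 s'"
      if "hpos s' = 0" "ruled W (cells s')" "J W (cells s')" "ipos s' = ipos s" "outp s' = outp s" for s'
    proof -
      have "val W (cells s' (11 + r)) = val W ?z"
        using that(3) by (intro val_cong) (simp add: J_def)
      then have "val W (cells s' (11 + q)) = reg ?a2 q" for q
        using that(3) s V by (cases "q = r") (auto simp: J_def rep_def)
      moreover have "flag ?a2 j = (j < 6 \<and> cells s' j 0)" for j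
      proof (cases "j = 0")
        case True
        have "val W ?x = reg a0 r" "val W ?y = reg a0 t" using s by (simp_all add: rep_def)
        then show ?thesis using that(3) True F[of ?x ?y] by (simp add: J_def)
      next
        case False
        have "flag ?a1 = (\<lambda>j. j < 6 \<and> cells s j 0)" using s by (simp add: rep_def)
        from fun_cong[OF this, of j] show ?thesis using False that(3) by (auto simp: J_def)
      qed
      moreover have "ip a0 \<le> length w + 1" "ipos s = ip a0" "outp s = outs a0"
        using s by (simp_all add: rep_def)
      ultimately show ?thesis unfolding rep_def using that by (simp add: fun_eq_iff)
    qed
    show "tot k w W (\<lambda>s'. s' = s) (sweep ?g (\<lambda>v. v)) (\<lambda>s. rep w W ?a2 s)"
    proof (rule tot_conseq[OF tot_sweep[where J = J and X = "outp s" and a = "ipos s"]])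
      fix s' :: st assume "hpos s' = 0 \<and> (\<exists>f. ruled W f \<and> J W f \<and> cells s' = put k (\<lambda>v. v) W f) \<and>
        ipos s' = ipos s \<and> outp s' = outp s"
      then show "rep w W ?a2 s'" using fin by auto
    next
      fix s' :: st assume "s' = s"
      then show "hpos s' = 0 \<and> ruled W (cells s') \<and> J 0 (cells s') \<and> ipos s' = ipos s \<and> outp s' = outp s"
        using \<open>J 0 (cells s)\<close> s by (simp add: rep_def)
    next
      show "ipos s \<le> length w + 1" using s by (simp add: rep_def)
    qed (use k step in auto)
  qed
  show "ht (\<lambda>a. a = a0) (regop r t c h1 h2) Q"
    unfolding ht_def regop_def using tot_Seq[OF 1 2] Q[OF a0] by (auto elim!: tot_conseq)
qed

section \<open>Arithmetic on registers modulo \<open>2 ^ W\<close>\<close>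

definition zero :: "nat \<Rightarrow> com" where
  "zero r = regop r r False (\<lambda>_ _ _. False) (\<lambda>_ _ _. False)"

definition add :: "nat \<Rightarrow> nat \<Rightarrow> com" where
  "add r t = regop r t False (\<lambda>c x y. (x \<noteq> y) \<noteq> c) (\<lambda>c x y. x \<and> y \<or> x \<and> c \<or> y \<and> c)"

definition inc :: "nat \<Rightarrow> com" where
  "inc r = regop r r True (\<lambda>c x _. x \<noteq> c) (\<lambda>c x _. x \<and> c)"

text \<open>The scan starts at the least significant bit, so the last position at which the
  registers differ decides; equal bits keep the verdict so far.\<close>

definition less :: "nat \<Rightarrow> nat \<Rightarrow> com" where
  "less r t = regop r t False (\<lambda>_ x _. x) (\<lambda>c x y. if x = y then c else y)"

lemma ht_zero:
  assumes "11 + r < k" "\<And>a. P a \<Longrightarrow> Q (a\<lparr>reg := (reg a)(r := 0), flag := (flag a)(0 := False)\<rparr>)"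
  shows "ht P (zero r) Q"
proof -
  have "val i (\<lambda>l. False) = 0" for i by (induction i) auto
  moreover have "\<not> state_at (\<lambda>_ _ _. False) False x y i" for x y i by (cases i) auto
  ultimately show ?thesis unfolding zero_def
    by (intro ht_regop[where V = "\<lambda>_ _. 0" and F = "\<lambda>_ _. False"]) (use assms in auto)
qed

lemma ht_add:
  assumes "11 + r < k" "11 + t < k"
    "\<And>a. P a \<Longrightarrow> Q (a\<lparr>reg := (reg a)(r := (reg a r + reg a t) mod 2 ^ W),
       flag := (flag a)(0 := 2 ^ W \<le> reg a r + reg a t)\<rparr>)"
  shows "ht P (add r t) Q"
proof -
  let ?h1 = "\<lambda>c x y. (x \<noteq> y) \<noteq> c" and ?h2 = "\<lambda>c x y. x \<and> y \<or> x \<and> c \<or> y \<and> c"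
  have s: "val i (\<lambda>l. ?h1 (state_at ?h2 False x y l) (x l) (y l)) + of_bool (state_at ?h2 False x y i) * 2 ^ i
      = val i x + val i y" for x y i
    by (induction i) (auto split: if_splits simp: of_bool_def)
  have v: "val W (\<lambda>l. ?h1 (state_at ?h2 False x y l) (x l) (y l)) < 2 ^ W" for x y
    by (rule val_less)
  have "val W (\<lambda>l. ?h1 (state_at ?h2 False x y l) (x l) (y l)) = (val W x + val W y) mod 2 ^ W"
      and "state_at ?h2 False x y W = (2 ^ W \<le> val W x + val W y)" for x y
    using v[of x y] s[of W x y, symmetric] by (auto simp: of_bool_def)
  then show ?thesis unfolding add_def
    by (intro ht_regop[where V = "\<lambda>a b. (a + b) mod 2 ^ W" and F = "\<lambda>a b. 2 ^ W \<le> a + b"]) (use assms in auto)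
qed

lemma ht_inc:
  assumes "11 + r < k"
    "\<And>a. P a \<Longrightarrow> Q (a\<lparr>reg := (reg a)(r := (reg a r + 1) mod 2 ^ W),
       flag := (flag a)(0 := 2 ^ W \<le> reg a r + 1)\<rparr>)"
  shows "ht P (inc r) Q"
proof -
  let ?h1 = "\<lambda>c x y. x \<noteq> c" and ?h2 = "\<lambda>c x y. x \<and> c"
  have s: "val i (\<lambda>l. ?h1 (state_at ?h2 True x y l) (x l) (y l)) + of_bool (state_at ?h2 True x y i) * 2 ^ i
      = val i x + 1" for x y i
    by (induction i) (auto split: if_splits simp: of_bool_def)
  have v: "val W (\<lambda>l. ?h1 (state_at ?h2 True x y l) (x l) (y l)) < 2 ^ W" for x y
    by (rule val_less)
  have "val W (\<lambda>l. ?h1 (state_at ?h2 True x y l) (x l) (y l)) = (val W x + 1) mod 2 ^ W"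
      and "state_at ?h2 True x y W = (2 ^ W \<le> val W x + 1)" for x y
    using v[of x y] s[of W x y, symmetric] by (auto simp: of_bool_def)
  then show ?thesis unfolding inc_def
    by (intro ht_regop[where V = "\<lambda>a b. (a + 1) mod 2 ^ W" and F = "\<lambda>a b. 2 ^ W \<le> a + 1"]) (use assms in auto)
qed

lemma ht_less:
  assumes "11 + r < k" "11 + t < k"
    "\<And>a. P a \<Longrightarrow> Q (a\<lparr>flag := (flag a)(0 := reg a r < reg a t)\<rparr>)"
  shows "ht P (less r t) Q"
proof -
  let ?h2 = "\<lambda>c x y. if x = y then c else y"
  have s: "state_at ?h2 False x y i = (val i x < val i y)" for x y i
  proof (induction i)
    case (Suc i)
    then show ?case using val_less[of i x] val_less[of i y] by auto
  qed simp
  show ?thesis unfolding less_def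
    by (intro ht_regop[where V = "\<lambda>a b. a" and F = "\<lambda>a b. a < b"]) (use assms s in auto)
qed

end

section \<open>Formulas with counting\<close>

text \<open>\<open>Dfa\<close> is the only access to the input and \<open>Count\<close> the only
  binder; quantifiers are derived from counting. The registers needed depend on the formula alone,
  not on the input.\<close>

datatype form =
    Less nat nat
  | MulAdd nat nat nat nat
  | Dfa "nat \<Rightarrow> input_symbol \<Rightarrow> nat" "nat set" nat
  | Neg form
  | Conj form form
  | Count nat form form

text \<open>The left end marker is skipped, so \<open>run\<close> at \<open>i\<close> is the state
  after the first \<open>i\<close> bits. Beyond the input the right end marker is read over and
  over.\<close>

fun run :: "(nat \<Rightarrow> input_symbol \<Rightarrow> nat) \<Rightarrow> bool list \<Rightarrow> nat \<Rightarrow> nat" where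
  "run \<delta> w 0 = 0"
| "run \<delta> w (Suc i) = \<delta> (run \<delta> w i) (input_at w (Suc i))"

fun eval :: "bool list \<Rightarrow> nat \<Rightarrow> (nat \<Rightarrow> nat) \<Rightarrow> form \<Rightarrow> bool" where
  "eval w W e (Less x y) \<longleftrightarrow> e x < e y"
| "eval w W e (MulAdd x y u z) \<longleftrightarrow> e x * e y + e u = e z"
| "eval w W e (Dfa \<delta> Q x) \<longleftrightarrow> run \<delta> w (e x) \<in> Q"
| "eval w W e (Neg \<phi>) \<longleftrightarrow> \<not> eval w W e \<phi>"
| "eval w W e (Conj \<phi> \<psi>) \<longleftrightarrow> eval w W e \<phi> \<and> eval w W e \<psi>"
| "eval w W e (Count x \<phi> \<psi>) \<longleftrightarrow>
     card {a. a < 2 ^ W \<and> eval w W (e(x := a)) \<phi>} mod 2 ^ W \<le>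
     card {a. a < 2 ^ W \<and> eval w W (e(x := a)) \<psi>} mod 2 ^ W"

text \<open>
  A variable owns its register, so a binder must not shadow a variable in scope.  The 32 states of
  an automaton fit into flags 1 to 5.
\<close>

fun wff :: "nat \<Rightarrow> nat set \<Rightarrow> form \<Rightarrow> bool" where
  "wff b S (Less x y) \<longleftrightarrow> x \<in> S \<and> y \<in> S"
| "wff b S (MulAdd x y u z) \<longleftrightarrow> x \<in> S \<and> y \<in> S \<and> u \<in> S \<and> z \<in> S"
| "wff b S (Dfa \<delta> Q x) \<longleftrightarrow> x \<in> S \<and> (\<forall>q a. \<delta> q a < 32)"
| "wff b S (Neg \<phi>) \<longleftrightarrow> wff b S \<phi>"
| "wff b S (Conj \<phi> \<psi>) \<longleftrightarrow> wff b S \<phi> \<and> wff b S \<psi>"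
| "wff b S (Count x \<phi> \<psi>) \<longleftrightarrow> x \<notin> S \<and> x < b \<and> wff b (insert x S) \<phi> \<and> wff b (insert x S) \<psi>"

lemma eval_cong:
  "wff b S \<phi> \<Longrightarrow> (\<And>x. x \<in> S \<Longrightarrow> e x = e' x) \<Longrightarrow> eval w W e \<phi> = eval w W e' \<phi>"
proof (induction \<phi> arbitrary: S e e')
  case (Count x \<phi> \<psi>)
  have "eval w W (e(x := a)) \<phi> = eval w W (e'(x := a)) \<phi>"
    "eval w W (e(x := a)) \<psi> = eval w W (e'(x := a)) \<psi>" for a
    using Count.prems by (auto intro!: Count.IH[where S = "insert x S"])
  then show ?case by simp
next
  case (Neg \<phi>)
  show ?case using Neg.IH[of S e e'] Neg.prems by simp
next
  case (Conj \<phi> \<psi>)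
  show ?case using Conj.IH(1)[of S e e'] Conj.IH(2)[of S e e'] Conj.prems by simp
qed simp_all

text \<open>Registers 0 and 1 are scratch space for the atomic formulas. Each variable has one
  register for its value and two for the counters of a \<open>Count\<close> that binds it.\<close>

definition var :: "nat \<Rightarrow> nat" where "var x = 3 * x + 2"
definition count1 :: "nat \<Rightarrow> nat" where "count1 x = 3 * x + 3"
definition count2 :: "nat \<Rightarrow> nat" where "count2 x = 3 * x + 4"

lemma reg_distinct [simp]:
  "var x = var y \<longleftrightarrow> x = y" "count1 x = count1 y \<longleftrightarrow> x = y" "count2 x = count2 y \<longleftrightarrow> x = y"
  "var x \<noteq> count1 y" "var x \<noteq> count2 y" "count1 x \<noteq> var y" "count1 x \<noteq> count2 y"
  "count2 x \<noteq> var y" "count2 x \<noteq> count1 y"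
  "var x \<noteq> 0" "var x \<noteq> 1" "count1 x \<noteq> 0" "count1 x \<noteq> 1" "count2 x \<noteq> 0" "count2 x \<noteq> 1"
  "0 < var x" "0 < count1 x" "0 < count2 x" "var x \<noteq> Suc 0" "count1 x \<noteq> Suc 0" "count2 x \<noteq> Suc 0"
  unfolding var_def count1_def count2_def by presburger+

context bounded_registers
begin

definition env :: "ast \<Rightarrow> nat \<Rightarrow> nat" where
  "env a x = reg a (var x)"

text \<open>The frame condition of an evaluation: flags, input head, scratch registers and the
  registers of variables outside \<open>S\<close> may change.\<close>

definition same :: "nat set \<Rightarrow> ast \<Rightarrow> ast \<Rightarrow> bool" where
  "same S a a' \<longleftrightarrow> outs a' = outs a \<and> (\<forall>x\<in>S. reg a' (var x) = reg a (var x) \<and>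
     reg a' (count1 x) = reg a (count1 x) \<and> reg a' (count2 x) = reg a (count2 x))"

lemma same_refl [simp]: "same S a a" by (simp add: same_def)

lemma same_trans: "same S a b \<Longrightarrow> same S b c \<Longrightarrow> same S a c"
  by (simp add: same_def)

lemma rep_bounded: "rep w W a s \<Longrightarrow> reg a r < 2 ^ W"
  using val_less[of W "cells s (11 + r)"] by (simp add: rep_def)

lemma ht_fix_rep:
  assumes "\<And>a0. P a0 \<Longrightarrow> (\<And>r. reg a0 r < 2 ^ W) \<Longrightarrow> ip a0 \<le> length w + 1 \<Longrightarrow>
    (\<lambda>j. j < 6 \<and> flag a0 j) = flag a0 \<Longrightarrow> ht (\<lambda>a. a = a0) c Q"
  shows "ht P c Q"
  unfolding ht_def
proof (rule tot_fix, elim exE conjE)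
  fix s a0 assume r: "rep w W a0 s" and "P a0"
  then have "ht (\<lambda>a. a = a0) c Q"
    using assms[of a0] rep_bounded[OF r] flag_rep[OF r] by (simp add: rep_def)
  then show "tot k w W (\<lambda>s'. s' = s) c (\<lambda>s. \<exists>a. rep w W a s \<and> Q a)"
    unfolding ht_def using r by (auto elim!: tot_conseq)
qed

abbreviation F :: "input_symbol \<Rightarrow> local_view \<Rightarrow> bool" where
  "F \<equiv> ftest (\<lambda>_ v. v 0)"

abbreviation nF :: "input_symbol \<Rightarrow> local_view \<Rightarrow> bool" where
  "nF \<equiv> ftest (\<lambda>_ v. \<not> v 0)"

subsection \<open>Loops over all numbers of \<open>W\<close> bits\<close>

definition for_all :: "nat \<Rightarrow> com \<Rightarrow> com" where
  "for_all r c = zero r ;; set_flag False ;; While nF (c ;; inc r)"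

text \<open>The loop register runs through all values until it wraps around to 0, which the overflow
  flag of \<open>inc\<close> reports, so no bound needs to be stored. \<open>stable\<close> says
  that the invariant ignores the loop register and the flags.\<close>

lemma ht_for_all:
  assumes r: "11 + r < k"
    and body: "\<And>i. i < 2 ^ W \<Longrightarrow> ht (\<lambda>a. I i a \<and> reg a r = i) c (\<lambda>a. I (Suc i) a \<and> reg a r = i)"
    and stable: "\<And>i a f v. I i a \<Longrightarrow> I i (a\<lparr>reg := (reg a)(r := v), flag := f\<rparr>)"
  shows "ht (I 0) (for_all r c) (I (2 ^ W))"
proof -
  let ?I = "\<lambda>i a. I i a \<and> reg a r = i mod 2 ^ W \<and> flag a 0 = (i = 2 ^ W)"
  have "ht (?I i) (c ;; inc r) (?I (Suc i))" if i: "i < 2 ^ W" for i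
  proof (rule ht_Seq)
    show "ht (?I i) c (\<lambda>a. I (Suc i) a \<and> reg a r = i)"
      using body[OF i] by (rule ht_conseq) (use i in auto)
    show "ht (\<lambda>a. I (Suc i) a \<and> reg a r = i) (inc r) (?I (Suc i))"
      using r i by (intro ht_inc) (auto intro: stable)
  qed
  then have loop: "ht (?I 0) (While nF (c ;; inc r)) (?I (2 ^ W))"
    by (rule ht_While[where I = ?I]) auto
  show ?thesis unfolding for_all_def
  proof (rule ht_Seq[OF ht_zero[where Q = "\<lambda>a. I 0 a \<and> reg a r = 0"]])
    show "ht (\<lambda>a. I 0 a \<and> reg a r = 0) (set_flag False ;; While nF (c ;; inc r)) (I (2 ^ W))"
    proof (rule ht_Seq[OF ht_set_flag])
      fix a assume a: "I 0 a \<and> reg a r = 0"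
      have "I 0 (a\<lparr>reg := (reg a)(r := reg a r), flag := (flag a)(0 := False)\<rparr>)"
        using a by (intro stable) simp
      moreover have "(reg a)(r := reg a r) = reg a" by simp
      ultimately have "I 0 (a\<lparr>flag := (flag a)(0 := False)\<rparr>)" by (cases a) simp 
      then show "?I 0 (a\<lparr>flag := (flag a)(0 := False)\<rparr>)" using a by simp
    qed (use loop in \<open>auto elim!: ht_conseq\<close>)
  qed (use r stable in auto)
qed

text \<open>A product is formed by repeated addition. The equation is meant exactly although
  registers are modulo \<open>2 ^ W\<close>, so flag 1 remembers whether any addition has
  overflowed. An automaton rewinds the input head and keeps its state in flags 1 to 5, with register
  1 counting its steps.\<close>

fun compile :: "form \<Rightarrow> com" where
  "compile (Less x y) = less (var x) (var y)"
| "compile (MulAdd x y u z) =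
     zero 0 ;; zero 1 ;; add 0 (var u) ;; fact Stay (\<lambda>_ v. v(1 := False)) None ;; less 1 (var x) ;;
     While F (add 0 (var y) ;; fact Stay (\<lambda>_ v. v(1 := v 0 \<or> v 1)) None ;; inc 1 ;; less 1 (var x)) ;;
     less 0 (var z) ;;
     Cond F (set_flag False) (less (var z) 0 ;; fact Stay (\<lambda>_ v. v(0 := \<not> v 0 \<and> \<not> v 1)) None)"
| "compile (Dfa \<delta> Q x) =
     While (ftest (\<lambda>a _. a \<noteq> LeftEnd)) (fact Left (\<lambda>_ v. v) None) ;; fact Right (\<lambda>_ _ _. False) None ;;
     zero 1 ;; less 1 (var x) ;;
     While F (fact Right (\<lambda>a v j. case j of 0 \<Rightarrow> False | Suc i \<Rightarrow> bit (\<delta> (val 5 (\<lambda>i. v (Suc i))) a) i) None ;;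
       inc 1 ;; less 1 (var x)) ;;
     fact Stay (\<lambda>_ v. v(0 := val 5 (\<lambda>i. v (Suc i)) \<in> Q)) None"
| "compile (Neg \<phi>) = compile \<phi> ;; flip"
| "compile (Conj \<phi> \<psi>) = compile \<phi> ;; Cond F (compile \<psi>) (set_flag False)"
| "compile (Count x \<phi> \<psi>) = zero (count1 x) ;; zero (count2 x) ;;
     for_all (var x) (compile \<phi> ;; Cond F (inc (count1 x)) skip ;; compile \<psi> ;; Cond F (inc (count2 x)) skip) ;;
     less (count2 x) (count1 x) ;; flip"

definition computes_form :: "nat set \<Rightarrow> com \<Rightarrow> form \<Rightarrow> bool" where
  "computes_form S c \<phi> \<longleftrightarrow> (\<forall>a0. ht (\<lambda>a. a = a0) c
     (\<lambda>a. flag a 0 = eval w W (env a0) \<phi> \<and> same S a0 a))"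

lemma compile_Less:
  assumes "11 + var x < k" "11 + var y < k"
  shows "computes_form S (less (var x) (var y)) (Less x y)"
  unfolding computes_form_def
  by (intro allI ht_less) (use assms in \<open>auto simp: same_def env_def\<close>)

lemma compile_Neg:
  assumes "computes_form S c \<phi>"
  shows "computes_form S (c ;; flip) (Neg \<phi>)"
  unfolding computes_form_def
  by (intro allI ht_Seq[OF assms[unfolded computes_form_def, rule_format]] ht_flip) (auto simp: same_def)

lemma compile_MulAdd:
  assumes "11 + var x < k" "11 + var y < k" "11 + var u < k" "11 + var z < k"
  shows "computes_form S (compile (MulAdd x y u z)) (MulAdd x y u z)"
  unfolding computes_form_def
proof (intro allI, rule ht_fix_rep)
  fix a0 a :: ast assume "a = a0" and bounded: "\<And>r. reg a r < 2 ^ W"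
  then have a0: "\<And>r. reg a0 r < 2 ^ W" by simp
  let ?X = "reg a0 (var x)" and ?Y = "reg a0 (var y)" and ?U = "reg a0 (var u)" and ?Z = "reg a0 (var z)"
  define keep where "keep a \<longleftrightarrow> (\<forall>r. r \<noteq> 0 \<longrightarrow> r \<noteq> 1 \<longrightarrow> reg a r = reg a0 r) \<and> outs a = outs a0" for a :: ast
  have k': "12 < k" using assms(1) by (simp add: var_def)
  let ?I = "\<lambda>i a. keep a \<and> reg a 0 = (?U + i * ?Y) mod 2 ^ W \<and> (flag a 1 \<longleftrightarrow> 2 ^ W \<le> ?U + i * ?Y) \<and>
    reg a 1 = i \<and> (flag a 0 \<longleftrightarrow> i < ?X)"
  have "ht (?I i) (add 0 (var y) ;; fact Stay (\<lambda>_ v. v(1 := v 0 \<or> v 1)) None ;; inc 1 ;; less 1 (var x)) (?I (Suc i))"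
    if i: "i < ?X" for i
  proof -
    let ?I1 = "\<lambda>a. keep a \<and> reg a 0 = (?U + Suc i * ?Y) mod 2 ^ W \<and> reg a 1 = i \<and>
        (flag a 0 \<or> flag a 1 \<longleftrightarrow> 2 ^ W \<le> ?U + Suc i * ?Y)"
    let ?I2 = "\<lambda>a. keep a \<and> reg a 0 = (?U + Suc i * ?Y) mod 2 ^ W \<and> reg a 1 = i \<and>
        (flag a 1 \<longleftrightarrow> 2 ^ W \<le> ?U + Suc i * ?Y)"
    let ?I3 = "\<lambda>a. keep a \<and> reg a 0 = (?U + Suc i * ?Y) mod 2 ^ W \<and> reg a 1 = Suc i \<and>
        (flag a 1 \<longleftrightarrow> 2 ^ W \<le> ?U + Suc i * ?Y)"
    have lt: "Suc i < 2 ^ W" using i a0[of "var x"] by simp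
    \<comment> \<open>If the sum was already too large it remains so; otherwise its reduced value is
      exact and the new overflow bit tells the truth.\<close>
    have carry: "(2 ^ W \<le> (?U + i * ?Y) mod 2 ^ W + ?Y \<or> 2 ^ W \<le> ?U + i * ?Y) \<longleftrightarrow> 2 ^ W \<le> ?U + Suc i * ?Y"
      by (cases "2 ^ W \<le> ?U + i * ?Y") auto
    have "ht (?I i) (add 0 (var y)) ?I1"
    proof (rule ht_add)
      fix a assume a: "?I i a"
      then have y: "reg a (var y) = ?Y" by (simp add: keep_def)
      show "?I1 (a\<lparr>reg := (reg a)(0 := (reg a 0 + reg a (var y)) mod 2 ^ W),
          flag := (flag a)(0 := 2 ^ W \<le> reg a 0 + reg a (var y))\<rparr>)"
        using a carry by (simp add: y keep_def mod_simps ac_simps)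
    qed (use assms k' in auto)
    moreover have "ht ?I1 (fact Stay (\<lambda>_ v. v(1 := v 0 \<or> v 1)) None) ?I2"
      by (rule ht_fact) (auto simp: keep_def)
    moreover have "ht ?I2 (inc 1) ?I3"
      by (rule ht_inc) (use k' lt in \<open>auto simp: keep_def\<close>)
    moreover have "ht ?I3 (less 1 (var x)) (?I (Suc i))"
      by (rule ht_less) (use k' assms in \<open>auto simp: keep_def\<close>)
    ultimately show ?thesis by (intro ht_Seq)
  qed
  then have loop: "ht (?I 0) (While F (add 0 (var y) ;; fact Stay (\<lambda>_ v. v(1 := v 0 \<or> v 1)) None ;;
      inc 1 ;; less 1 (var x))) (?I ?X)"
    by (rule ht_While[where I = ?I]) auto
  have 1: "ht (\<lambda>a. a = a0) (zero 0) (\<lambda>a. keep a \<and> reg a 0 = 0)"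
    by (rule ht_zero) (use k' in \<open>auto simp: keep_def\<close>)
  have 2: "ht (\<lambda>a. keep a \<and> reg a 0 = 0) (zero 1) (\<lambda>a. keep a \<and> reg a 0 = 0 \<and> reg a 1 = 0)"
    by (rule ht_zero) (use k' in \<open>auto simp: keep_def\<close>)
  have 3: "ht (\<lambda>a. keep a \<and> reg a 0 = 0 \<and> reg a 1 = 0) (add 0 (var u)) (\<lambda>a. keep a \<and> reg a 0 = ?U \<and> reg a 1 = 0)"
    by (rule ht_add) (use k' assms a0 in \<open>auto simp: keep_def\<close>)
  have 4: "ht (\<lambda>a. keep a \<and> reg a 0 = ?U \<and> reg a 1 = 0) (fact Stay (\<lambda>_ v. v(1 := False)) None)
      (\<lambda>a. keep a \<and> reg a 0 = ?U \<and> reg a 1 = 0 \<and> \<not> flag a 1)"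
    by (rule ht_fact) (auto simp: keep_def)
  have 5: "ht (\<lambda>a. keep a \<and> reg a 0 = ?U \<and> reg a 1 = 0 \<and> \<not> flag a 1) (less 1 (var x)) (?I 0)"
    by (rule ht_less) (use k' assms a0 in \<open>auto simp: keep_def not_le\<close>)
  let ?R = "?X * ?Y + ?U"
  let ?A = "\<lambda>a. keep a \<and> reg a 0 = ?R mod 2 ^ W \<and> (flag a 1 \<longleftrightarrow> 2 ^ W \<le> ?R) \<and> (flag a 0 \<longleftrightarrow> ?R mod 2 ^ W < ?Z)"
  have 6: "ht (?I ?X) (less 0 (var z))
      (\<lambda>a. ?A a)"
    by (rule ht_less) (use k' assms in \<open>auto simp: keep_def ac_simps\<close>)
  let ?Q = "\<lambda>a. (flag a 0 \<longleftrightarrow> ?R = ?Z) \<and> keep a"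
  have 7: "ht (\<lambda>a. ?A a)
     (Cond F (set_flag False) (less (var z) 0 ;; fact Stay (\<lambda>_ v. v(0 := \<not> v 0 \<and> \<not> v 1)) None)) ?Q"
  proof (rule ht_Cond)
    show "ht (\<lambda>a. (?A a) \<and> flag a 0)
       (set_flag False) ?Q"
      using a0[of "var z"] by (intro ht_set_flag) (auto simp: keep_def)
    have "ht (\<lambda>a. (?A a) \<and> \<not> flag a 0)
       (less (var z) 0)
       (\<lambda>a. keep a \<and> (flag a 1 \<longleftrightarrow> 2 ^ W \<le> ?R) \<and> ?Z \<le> ?R mod 2 ^ W \<and> (flag a 0 \<longleftrightarrow> ?Z < ?R mod 2 ^ W))"
      by (rule ht_less) (use k' assms in \<open>auto simp: keep_def\<close>)
    moreover have "ht (\<lambda>a. keep a \<and> (flag a 1 \<longleftrightarrow> 2 ^ W \<le> ?R) \<and> ?Z \<le> ?R mod 2 ^ W \<and> (flag a 0 \<longleftrightarrow> ?Z < ?R mod 2 ^ W))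
       (fact Stay (\<lambda>_ v. v(0 := \<not> v 0 \<and> \<not> v 1)) None) ?Q"
      by (rule ht_fact) (use a0[of "var z"] in \<open>auto simp: keep_def\<close>)
    ultimately show "ht (\<lambda>a. (?A a) \<and> \<not> flag a 0)
       (less (var z) 0 ;; fact Stay (\<lambda>_ v. v(0 := \<not> v 0 \<and> \<not> v 1)) None) ?Q"
      by (rule ht_Seq)
  qed
  have "ht (\<lambda>a. a = a0) (compile (MulAdd x y u z)) ?Q"
    unfolding compile.simps by (intro ht_Seq[OF 1] ht_Seq[OF 2] ht_Seq[OF 3] ht_Seq[OF 4] ht_Seq[OF 5]
      ht_Seq[OF loop] ht_Seq[OF 6] 7)
  then show "ht (\<lambda>a'. a' = a) (compile (MulAdd x y u z))
      (\<lambda>a. flag a 0 = eval w W (env a0) (MulAdd x y u z) \<and> same S a0 a)"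
    unfolding \<open>a = a0\<close> by (rule ht_conseq) (auto simp: env_def same_def keep_def)
qed

lemma val_bit: "val i (bit q) = take_bit i q"
  by (induction i) (simp_all add: take_bit_Suc_from_most)

lemma compile_Dfa:
  assumes "11 + var x < k" and \<delta>: "\<And>q a. \<delta> q a < 32"
  shows "computes_form S (compile (Dfa \<delta> Q x)) (Dfa \<delta> Q x)"
  unfolding computes_form_def
proof (intro allI, rule ht_fix_rep)
  fix a0 a :: ast assume "a = a0" and bounded: "\<And>r. reg a r < 2 ^ W" and "ip a \<le> length w + 1"
  then have a0: "\<And>r. reg a0 r < 2 ^ W" and ip: "ip a0 \<le> length w + 1" by simp_all
  let ?X = "reg a0 (var x)"
  define keep where "keep a \<longleftrightarrow> (\<forall>r. r \<noteq> 1 \<longrightarrow> reg a r = reg a0 r) \<and> outs a = outs a0" for a :: ast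
  have k': "12 < k" using assms(1) by (simp add: var_def)
  have run_less: "run \<delta> w i < 32" for i using \<delta> by (cases i) auto
  let ?I0 = "\<lambda>i a. keep a \<and> ip a = ip a0 - i"
  have 1: "ht (?I0 0) (While (ftest (\<lambda>a _. a \<noteq> LeftEnd)) (fact Left (\<lambda>_ v. v) None)) (?I0 (ip a0))"
  proof (rule ht_While[where I = ?I0])
    fix i assume "i < ip a0"
    then show "ht (?I0 i) (fact Left (\<lambda>_ v. v) None) (?I0 (Suc i))"
      using ip by (intro ht_fact) (auto simp: keep_def)
  qed (use ip in \<open>auto simp: input_at_def\<close>)
  let ?dec = "\<lambda>f. val 5 (\<lambda>i. f (Suc i))"
  have z: "?dec (\<lambda>_. False) = 0" by (simp add: eval_nat_numeral)
  have 2: "ht (?I0 (ip a0)) (fact Right (\<lambda>_ _ _. False) None) (\<lambda>a. keep a \<and> ip a = 1 \<and> ?dec (flag a) = 0)"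
    by (rule ht_fact) (use z in \<open>auto simp: keep_def\<close>)
  have dec: "?dec f = ?dec f'" if "\<And>i. i \<noteq> 0 \<Longrightarrow> i < 6 \<Longrightarrow> f i = f' i" for f f'
    using that by (intro val_cong) auto
  have dec0: "?dec (f(0 := b)) = ?dec f" for f b by simp
  have 3: "ht (\<lambda>a. keep a \<and> ip a = 1 \<and> ?dec (flag a) = 0) (zero 1)
      (\<lambda>a. keep a \<and> ip a = 1 \<and> ?dec (flag a) = 0 \<and> reg a 1 = 0)"
    by (rule ht_zero) (use k' in \<open>auto simp: keep_def\<close>)
  let ?I = "\<lambda>i a. keep a \<and> ip a = min (length w + 1) (Suc i) \<and> ?dec (flag a) = run \<delta> w i \<and> reg a 1 = i \<and>
    (flag a 0 \<longleftrightarrow> i < ?X)"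
  have 4: "ht (\<lambda>a. keep a \<and> ip a = 1 \<and> ?dec (flag a) = 0 \<and> reg a 1 = 0) (less 1 (var x)) (?I 0)"
    by (rule ht_less) (use k' assms in \<open>auto simp: keep_def\<close>)
  let ?next = "fact Right (\<lambda>a v j. case j of 0 \<Rightarrow> False | Suc i \<Rightarrow> bit (\<delta> (?dec v) a) i) None"
  have "ht (?I i) (?next ;; inc 1 ;; less 1 (var x)) (?I (Suc i))" if i: "i < ?X" for i
  proof -
    let ?I1 = "\<lambda>a. keep a \<and> ip a = min (length w + 1) (Suc (Suc i)) \<and> ?dec (flag a) = run \<delta> w (Suc i) \<and> reg a 1 = i"
    let ?I2 = "\<lambda>a. keep a \<and> ip a = min (length w + 1) (Suc (Suc i)) \<and> ?dec (flag a) = run \<delta> w (Suc i) \<and> reg a 1 = Suc i"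
    have lt: "Suc i < 2 ^ W" using i a0[of "var x"] by simp
    \<comment> \<open>The head stops at the right end marker, but all positions further right show
      the same symbol.\<close>
    have inp: "input_at w (min (length w + 1) (Suc i)) = input_at w (Suc i)" by (auto simp: input_at_def min_def)
    have "ht (?I i) ?next ?I1"
    proof (rule ht_fact)
      fix a assume a: "?I i a"
      let ?q = "\<delta> (run \<delta> w i) (input_at w (Suc i))"
      have "val 5 (\<lambda>i. i < 5 \<and> bit ?q i) = val 5 (bit ?q)" by (rule val_cong) simp
      also have "\<dots> = ?q"
        unfolding val_bit using \<delta>[of "run \<delta> w i" "input_at w (Suc i)"] by (intro take_bit_nat_eq_self) simp
      finally show "?I1 (a\<lparr>flag := \<lambda>j. j < 6 \<and> (case j of 0 \<Rightarrow> False | Suc i \<Rightarrow> bit (\<delta> (?dec (flag a)) (input_at w (ip a))) i),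
          ip := min (length w + 1) (move_head Right (ip a)),
          outs := outs a @ (case None of None \<Rightarrow> [] | Some x \<Rightarrow> [x])\<rparr>)"
        using a inp by (auto simp: keep_def)
    qed
    moreover have "ht ?I1 (inc 1) ?I2"
      by (rule ht_inc) (use k' lt in \<open>auto simp: keep_def\<close>)
    moreover have "ht ?I2 (less 1 (var x)) (?I (Suc i))"
      by (rule ht_less) (use k' assms in \<open>auto simp: keep_def\<close>)
    ultimately show ?thesis by (intro ht_Seq)
  qed
  then have 5: "ht (?I 0) (While F (?next ;; inc 1 ;; less 1 (var x))) (?I ?X)"
    by (rule ht_While[where I = ?I]) auto
  let ?Q = "\<lambda>a. (flag a 0 \<longleftrightarrow> run \<delta> w ?X \<in> Q) \<and> keep a"
  have 6: "ht (?I ?X) (fact Stay (\<lambda>_ v. v(0 := ?dec v \<in> Q)) None) ?Q"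
    by (rule ht_fact) (auto simp: keep_def)
  have "ht (\<lambda>a. a = a0) (compile (Dfa \<delta> Q x)) ?Q"
    unfolding compile.simps
    by (rule ht_conseq[OF ht_Seq[OF 1 ht_Seq[OF 2 ht_Seq[OF 3 ht_Seq[OF 4 ht_Seq[OF 5 6]]]]]])
       (auto simp: keep_def)
  then show "ht (\<lambda>a'. a' = a) (compile (Dfa \<delta> Q x))
      (\<lambda>a. flag a 0 = eval w W (env a0) (Dfa \<delta> Q x) \<and> same S a0 a)"
    unfolding \<open>a = a0\<close> by (rule ht_conseq) (auto simp: env_def same_def keep_def)
qed

lemma compile_Conj:
  assumes \<phi>: "computes_form S c \<phi>" and \<psi>: "computes_form S d \<psi>" and wff: "wff b S \<psi>"
  shows "computes_form S (c ;; Cond F d (set_flag False)) (Conj \<phi> \<psi>)"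
  unfolding computes_form_def
proof (intro allI ht_Seq[OF \<phi>[unfolded computes_form_def, rule_format]] ht_Cond)
  fix a0
  show "ht (\<lambda>a. (flag a 0 = eval w W (env a0) \<phi> \<and> same S a0 a) \<and> flag a 0) d
      (\<lambda>a. flag a 0 = eval w W (env a0) (Conj \<phi> \<psi>) \<and> same S a0 a)"
  proof (rule ht_fix)
    fix a1 assume a1: "(flag a1 0 = eval w W (env a0) \<phi> \<and> same S a0 a1) \<and> flag a1 0"
    then have "eval w W (env a1) \<psi> = eval w W (env a0) \<psi>"
      by (intro eval_cong[OF wff]) (auto simp: same_def env_def)
    then show "ht (\<lambda>a. a = a1) d (\<lambda>a. flag a 0 = eval w W (env a0) (Conj \<phi> \<psi>) \<and> same S a0 a)"
      using \<psi>[unfolded computes_form_def, rule_format, of a1] a1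
      by (auto elim!: ht_conseq intro: same_trans)
  qed
qed (auto intro!: ht_set_flag simp: same_def)

lemma card_Suc: "card {b. b < Suc i \<and> P b} = card {b. b < i \<and> P b} + of_bool (P i)"
proof -
  have "{b. b < Suc i \<and> P b} = {b. b < i \<and> P b} \<union> (if P i then {i} else {})" by (auto simp: less_Suc_eq)
  then show ?thesis by auto
qed

text \<open>The counters are free because \<open>x\<close> is not in \<open>S\<close>, and they
  survive the evaluation of the subformulas because these are treated with \<open>x\<close> in
  scope.\<close>

lemma compile_Count:
  assumes x: "x \<notin> S" "11 + count2 x < k" and wff: "wff b (insert x S) \<phi>" "wff b (insert x S) \<psi>"
    and \<phi>: "computes_form (insert x S) (compile \<phi>) \<phi>" and \<psi>: "computes_form (insert x S) (compile \<psi>) \<psi>"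
  shows "computes_form S (compile (Count x \<phi> \<psi>)) (Count x \<phi> \<psi>)"
  unfolding computes_form_def
proof
  fix a0
  let ?body = "compile \<phi> ;; Cond F (inc (count1 x)) skip ;; compile \<psi> ;; Cond F (inc (count2 x)) skip"
  have k': "11 + var x < k" "11 + count1 x < k" using x(2) by (simp_all add: var_def count1_def count2_def)
  let ?n = "\<lambda>\<phi> i. card {b. b < i \<and> eval w W ((env a0)(x := b)) \<phi>} mod 2 ^ W"
  let ?I = "\<lambda>i a. same S a0 a \<and> reg a (count1 x) = ?n \<phi> i \<and> reg a (count2 x) = ?n \<psi> i"
  have step: "?n \<phi> (Suc i) = (if eval w W ((env a0)(x := i)) \<phi> then (?n \<phi> i + 1) mod 2 ^ W else ?n \<phi> i)" for \<phi> i
    by (simp add: card_Suc mod_simps)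
  let ?P = "\<lambda>i m n a. same S a0 a \<and> reg a (var x) = i \<and> reg a (count1 x) = m \<and> reg a (count2 x) = n"
  have sub: "ht (\<lambda>a. ?P i m n a)
      (compile \<phi>)
      (\<lambda>a. ?P i m n a \<and>
        flag a 0 = eval w W ((env a0)(x := i)) \<phi>)"
    if \<phi>: "computes_form (insert x S) (compile \<phi>) \<phi>" and wff: "wff b (insert x S) \<phi>" for \<phi> i m n
  proof (rule ht_fix)
    fix a1 assume a1: "same S a0 a1 \<and> reg a1 (var x) = i \<and> reg a1 (count1 x) = m \<and> reg a1 (count2 x) = n"
    then have "eval w W (env a1) \<phi> = eval w W ((env a0)(x := i)) \<phi>"
      by (intro eval_cong[OF wff]) (auto simp: same_def env_def)
    then show "ht (\<lambda>a. a = a1) (compile \<phi>)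
      (\<lambda>a. ?P i m n a \<and>
        flag a 0 = eval w W ((env a0)(x := i)) \<phi>)"
      using \<phi>[unfolded computes_form_def, rule_format, of a1] a1
      by (auto elim!: ht_conseq simp: same_def)
  qed
  have body: "ht (\<lambda>a. ?I i a \<and> reg a (var x) = i)
      (?body)
      (\<lambda>a. ?I (Suc i) a \<and> reg a (var x) = i)" for i
  proof -
    let ?P = "\<lambda>m n a. same S a0 a \<and> reg a (var x) = i \<and> reg a (count1 x) = m \<and> reg a (count2 x) = n"
    let ?E = "\<lambda>\<phi>. eval w W ((env a0)(x := i)) \<phi>"
    have "ht (?P (?n \<phi> i) (?n \<psi> i)) (compile \<phi>) (\<lambda>a. ?P (?n \<phi> i) (?n \<psi> i) a \<and> flag a 0 = ?E \<phi>)"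
      using sub[OF \<phi> wff(1), of i "?n \<phi> i" "?n \<psi> i"] by (simp only: conj_assoc)
    moreover have "ht (\<lambda>a. ?P (?n \<phi> i) (?n \<psi> i) a \<and> flag a 0 = ?E \<phi>) (Cond F (inc (count1 x)) skip)
        (?P (?n \<phi> (Suc i)) (?n \<psi> i))"
      using k' x by (intro ht_Cond ht_inc ht_skip) (auto simp: step same_def)
    moreover have "ht (?P (?n \<phi> (Suc i)) (?n \<psi> i)) (compile \<psi>) (\<lambda>a. ?P (?n \<phi> (Suc i)) (?n \<psi> i) a \<and> flag a 0 = ?E \<psi>)"
      using sub[OF \<psi> wff(2), of i "?n \<phi> (Suc i)" "?n \<psi> i"] by (simp only: conj_assoc)
    moreover have "ht (\<lambda>a. ?P (?n \<phi> (Suc i)) (?n \<psi> i) a \<and> flag a 0 = ?E \<psi>) (Cond F (inc (count2 x)) skip)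
        (?P (?n \<phi> (Suc i)) (?n \<psi> (Suc i)))"
      using k' x by (intro ht_Cond ht_inc ht_skip) (auto simp: step same_def)
    ultimately have "ht (?P (?n \<phi> i) (?n \<psi> i))
        (?body)
        (?P (?n \<phi> (Suc i)) (?n \<psi> (Suc i)))"
      by (intro ht_Seq)
    then show ?thesis by (rule ht_conseq) auto
  qed
  have loop: "ht (?I 0) (for_all (var x)
      (?body)) (?I (2 ^ W))"
    by (rule ht_for_all[where I = ?I]) (use k' body x in \<open>auto simp: same_def\<close>)
  have 1: "ht (\<lambda>a. a = a0) (zero (count1 x)) (\<lambda>a. same S a0 a \<and> reg a (count1 x) = 0)"
    by (rule ht_zero) (use k' x in \<open>auto simp: same_def\<close>)
  have 2: "ht (\<lambda>a. same S a0 a \<and> reg a (count1 x) = 0) (zero (count2 x)) (?I 0)"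
    by (rule ht_zero) (use k' x in \<open>auto simp: same_def\<close>)
  have 3: "ht (?I (2 ^ W)) (less (count2 x) (count1 x)) (\<lambda>a. same S a0 a \<and> flag a 0 = (\<not> eval w W (env a0) (Count x \<phi> \<psi>)))"
    by (rule ht_less) (use k' x in \<open>auto simp: same_def\<close>)
  have 4: "ht (\<lambda>a. same S a0 a \<and> flag a 0 = (\<not> eval w W (env a0) (Count x \<phi> \<psi>))) flip
      (\<lambda>a. flag a 0 = eval w W (env a0) (Count x \<phi> \<psi>) \<and> same S a0 a)"
    by (rule ht_flip) (auto simp: same_def simp del: eval.simps)
  show "ht (\<lambda>a. a = a0) (compile (Count x \<phi> \<psi>)) (\<lambda>a. flag a 0 = eval w W (env a0) (Count x \<phi> \<psi>) \<and> same S a0 a)"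
    unfolding compile.simps by (intro ht_Seq[OF 1] ht_Seq[OF 2] ht_Seq[OF loop] ht_Seq[OF 3] 4)
qed

theorem compile_correct:
  assumes "11 + count2 b < k"
  shows "wff b S \<phi> \<Longrightarrow> \<forall>x\<in>S. x \<le> b \<Longrightarrow> computes_form S (compile \<phi>) \<phi>"
proof -
  have v: "x \<le> b \<Longrightarrow> 11 + var x < k \<and> 11 + count2 x < k" for x
    using assms by (simp add: var_def count2_def)
  show "wff b S \<phi> \<Longrightarrow> \<forall>x\<in>S. x \<le> b \<Longrightarrow> computes_form S (compile \<phi>) \<phi>"
  proof (induction \<phi> arbitrary: S)
    case (Less x y) then show ?case using v by (auto intro!: compile_Less)
  next
    case (MulAdd x y u z)
    then have "x \<le> b" "y \<le> b" "u \<le> b" "z \<le> b" by auto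
    then show ?case using v by (intro compile_MulAdd) auto
  next
    case (Dfa \<delta> Q x)
    then have "x \<le> b" by auto
    then show ?case using v Dfa by (intro compile_Dfa) auto
  next
    case (Neg \<phi>) then show ?case by (auto intro!: compile_Neg)
  next
    case (Conj \<phi> \<psi>) then show ?case by (auto intro!: compile_Conj)
  next
    case (Count x \<phi> \<psi>)
    have "\<forall>y\<in>insert x S. y \<le> b" using Count.prems by auto
    then show ?case using v[of x] Count.prems Count.IH[of "insert x S"] by (intro compile_Count[where b = b]) auto
  qed
qed

end

section \<open>Setting up the working area\<close>

text \<open>The number of binary digits of \<open>n + 1\<close>, the position of the right end
  marker. This is the length of the counter once it has followed the input head to that
  marker.\<close>

definition bitlen :: "nat \<Rightarrow> nat" where "bitlen n = floor_log (n + 1) + 1"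

text \<open>The product is the room for \<open>bitlen n\<close> digits of \<open>bitlen n\<close>
  bits each. With the additional summand even the power of the base just above all such numbers is
  below \<open>2 ^ width n\<close>.\<close>

definition width :: "nat \<Rightarrow> nat" where "width n = bitlen n + bitlen n * bitlen n"

lemma less_bitlen: "n + 1 < 2 ^ bitlen n"
  using floor_log_exp2_gt[of "n + 1"] by (simp add: bitlen_def)

lemma bitlen_pos: "0 < bitlen n" by (simp add: bitlen_def)

definition raise_flag :: com where
  "raise_flag = Act Stay Stay (\<lambda>_ v. v(0 := True)) None"

text \<open>Tape 8 is a binary counter that follows the input head. A carry that leaves the area
  turns into a new leading digit, and the area grows by its cell.\<close>

definition count_input :: com where
  "count_input = While (\<lambda>a _. a \<noteq> RightEnd)
     (raise_flag ;;
      sweep (\<lambda>v. v(8 := v 8 \<noteq> v 0, 0 := v 8 \<and> v 0)) (\<lambda>v. if v 0 then v(8 := True, 6 := True) else v) ;;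
      Act Right Stay (\<lambda>_ v. v) None)"

text \<open>
  Tape 9 marks the first \<open>bitlen n\<close> cells.  Tapes 8 and 10 are unary counters up to that length;
  the flag tells that the counter was already full.
\<close>

definition unary_inc :: "nat \<Rightarrow> com" where
  "unary_inc t = raise_flag ;;
     sweep (\<lambda>v. if v 9 \<and> v 0 \<and> \<not> v t then v(t := True, 0 := False) else v) (\<lambda>v. v)"

definition unary_clear :: "nat \<Rightarrow> com" where
  "unary_clear t = sweep (\<lambda>v. v(t := False)) (\<lambda>v. v)"

definition extend :: com where
  "extend = sweep (\<lambda>v. v) (\<lambda>v. v(6 := True))"

definition set_up :: com where
  "set_up = Act Stay Stay (\<lambda>_ v. v(6 := True, 7 := True)) None ;; count_input ;;
     sweep (\<lambda>v. v(8 := False, 9 := True)) (\<lambda>v. v) ;;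
     unary_inc 8 ;;
     While (\<lambda>_ v. \<not> v 0)
       (unary_clear 10 ;; unary_inc 10 ;; While (\<lambda>_ v. \<not> v 0) (extend ;; unary_inc 10) ;; unary_inc 8)"

definition marks :: "nat \<Rightarrow> (nat \<Rightarrow> nat) \<Rightarrow> (nat \<Rightarrow> nat \<Rightarrow> bool) \<Rightarrow> bool" where
  "marks K c f \<longleftrightarrow> f 8 = (\<lambda>l. l < c 8) \<and> f 9 = (\<lambda>l. l < K) \<and> f 10 = (\<lambda>l. l < c 10) \<and>
     (\<forall>j\<ge>11. f j = (\<lambda>_. False))"

definition area :: "bool list \<Rightarrow> nat \<Rightarrow> nat \<Rightarrow> (nat \<Rightarrow> nat) \<Rightarrow> st \<Rightarrow> bool" where
  "area w W K c s \<longleftrightarrow> hpos s = 0 \<and> ruled W (cells s) \<and> marks K c (cells s) \<and>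
     ipos s = length w + 1 \<and> outp s = []"

lemma tot_raise_flag:
  assumes "0 < k" "\<And>s. P s \<Longrightarrow> hpos s = 0 \<and> ipos s \<le> length w + 1 \<and>
     Q (s\<lparr>cells := (cells s)(0 := (cells s 0)(0 := True))\<rparr>)"
  shows "tot k w B P raise_flag Q"
  unfolding raise_flag_def
proof (rule tot_Act)
  fix s :: st assume "P s"
  note s = assms(2)[OF this]
  have "act k w Stay Stay (\<lambda>_ v. v(0 := True)) None s = s\<lparr>cells := (cells s)(0 := (cells s 0)(0 := True))\<rparr>"
    using s assms(1) by (auto simp: act_def view_def head_at_def fun_eq_iff)
  then show "hpos (act k w Stay Stay (\<lambda>_ v. v(0 := True)) None s) \<le> B \<and> Q (act k w Stay Stay (\<lambda>_ v. v(0 := True)) None s)"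
    using s by simp
qed

lemma tot_sweep_area:
  assumes "7 < k" "W \<le> B"
    and "\<And>v. g v 6 = v 6" "\<And>v. g v 7 = v 7" "\<And>v. e v 7 = v 7"
    and "\<And>i f. i < W \<Longrightarrow> J i f \<Longrightarrow> ruled W f \<Longrightarrow> J (Suc i) (put k g i f)"
    and "\<And>s. P s \<Longrightarrow> hpos s = 0 \<and> ruled W (cells s) \<and> J 0 (cells s) \<and> ipos s = length w + 1 \<and> outp s = []"
    and "\<And>s f. ruled W f \<Longrightarrow> J W f \<Longrightarrow> hpos s = 0 \<Longrightarrow> cells s = put k e W f \<Longrightarrow> ipos s = length w + 1 \<Longrightarrow>
       outp s = [] \<Longrightarrow> Q s"
  shows "tot k w B P (sweep g e) Q"
  by (rule tot_conseq[OF tot_sweep[where J = J and X = "[]" and a = "length w + 1" and W = W]])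
     (use assms in auto)

lemma tot_unary_inc:
  assumes k: "11 < k" and W: "W \<le> B" "K \<le> W" and t: "t = 8 \<or> t = 10" and c: "c t \<le> K"
  shows "tot k w B (area w W K c) (unary_inc t)
     (\<lambda>s. area w W K (c(t := min (Suc (c t)) K)) s \<and> cells s 0 0 = (c t = K))"
proof -
  let ?g = "\<lambda>v. if v 9 \<and> v 0 \<and> \<not> v t then v(t := True, 0 := False) else v"
  define J where "J i f \<longleftrightarrow> (\<exists>h. marks K c h \<and> (\<forall>j. j \<noteq> 0 \<longrightarrow> j \<noteq> t \<longrightarrow> f j = h j)) \<and>
     f t = (\<lambda>l. l < c t \<or> l = c t \<and> c t < i \<and> c t < K) \<and> f 0 0 = (\<not> (c t < i \<and> c t < K))" for i f
  have 1: "tot k w B (area w W K c) raise_flag (\<lambda>s. area w W K c s \<and> cells s 0 0)"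
    by (rule tot_raise_flag) (use k in \<open>auto simp: area_def marks_def ruled_def\<close>)
  have 2: "tot k w B (\<lambda>s. area w W K c s \<and> cells s 0 0) (sweep ?g (\<lambda>v. v))
      (\<lambda>s. area w W K (c(t := min (Suc (c t)) K)) s \<and> cells s 0 0 = (c t = K))"
  proof (rule tot_sweep_area[where W = W and J = J])
    fix i f assume i: "i < W" and J: "J i f"
    then obtain h where h: "marks K c h" "\<forall>j. j \<noteq> 0 \<longrightarrow> j \<noteq> t \<longrightarrow> f j = h j" unfolding J_def by blast
    have f9: "f 9 = (\<lambda>l. l < K)" using h t by (auto simp: marks_def)
    have "\<forall>j. j \<noteq> 0 \<longrightarrow> j \<noteq> t \<longrightarrow> put k ?g i f j = h j"
      using h by (auto simp: put_def fun_eq_iff)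
    moreover have "put k ?g i f t = (\<lambda>l. l < c t \<or> l = c t \<and> c t < Suc i \<and> c t < K)"
      using J t k f9 by (auto simp: put_def head_at_def J_def fun_eq_iff less_Suc_eq)
    moreover have "put k ?g i f 0 0 = (\<not> (c t < Suc i \<and> c t < K))"
      using J t k f9 by (auto simp: put_def head_at_def J_def fun_eq_iff less_Suc_eq)
    ultimately show "J (Suc i) (put k ?g i f)" using h unfolding J_def by blast
  next
    fix s assume "area w W K c s \<and> cells s 0 0"
    then show "hpos s = 0 \<and> ruled W (cells s) \<and> J 0 (cells s) \<and> ipos s = length w + 1 \<and> outp s = []"
      using t unfolding J_def by (auto simp: area_def marks_def intro!: exI[of _ "cells s"])
  next
    fix s :: st and f assume s: "ruled W f" "J W f" "hpos s = 0" "cells s = put k (\<lambda>v. v) W f" "ipos s = length w + 1"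
       "outp s = []"
    then have f: "f t = (\<lambda>l. l < min (Suc (c t)) K)" "f 0 0 = (c t = K)"
      using c W by (auto simp: J_def fun_eq_iff less_Suc_eq)
    have "marks K (c(t := min (Suc (c t)) K)) f" using s(2) f t by (auto simp: J_def marks_def)
    then show "area w W K (c(t := min (Suc (c t)) K)) s \<and> cells s 0 0 = (c t = K)"
      using s f by (simp add: area_def)
  qed (use k W t in auto)
  show ?thesis unfolding unary_inc_def by (rule tot_Seq[OF 1 2])
qed

lemma tot_unary_clear:
  assumes k: "11 < k" and W: "W \<le> B" "K \<le> W" and c: "c 10 \<le> K"
  shows "tot k w B (area w W K c) (unary_clear 10) (area w W K (c(10 := 0)))"
  unfolding unary_clear_def
proof (rule tot_sweep_area[where W = W and J = "\<lambda>i f. (\<exists>h. marks K c h \<and> (\<forall>j. j \<noteq> 0 \<longrightarrow> j \<noteq> 10 \<longrightarrow> f j = h j)) \<and>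
     f 10 = (\<lambda>l. l < c 10 \<and> i \<le> l)"])
  fix s assume "area w W K c s"
  then show "hpos s = 0 \<and> ruled W (cells s) \<and> ((\<exists>h. marks K c h \<and> (\<forall>j. j \<noteq> 0 \<longrightarrow> j \<noteq> 10 \<longrightarrow> cells s j = h j)) \<and>
     cells s 10 = (\<lambda>l. l < c 10 \<and> 0 \<le> l)) \<and> ipos s = length w + 1 \<and> outp s = []"
    by (auto simp: area_def marks_def intro!: exI[of _ "cells s"])
next
  let ?g = "\<lambda>v :: local_view. v(10 := False)"
  fix i f assume i: "i < W"
    and J: "(\<exists>h. marks K c h \<and> (\<forall>j. j \<noteq> 0 \<longrightarrow> j \<noteq> 10 \<longrightarrow> f j = h j)) \<and> f 10 = (\<lambda>l. l < c 10 \<and> i \<le> l)"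
  then obtain h where h: "marks K c h" "\<forall>j. j \<noteq> 0 \<longrightarrow> j \<noteq> 10 \<longrightarrow> f j = h j" by blast
  have "\<forall>j. j \<noteq> 0 \<longrightarrow> j \<noteq> 10 \<longrightarrow> put k ?g i f j = h j"
    using h by (auto simp: put_def fun_eq_iff)
  moreover have "put k ?g i f 10 = (\<lambda>l. l < c 10 \<and> Suc i \<le> l)"
    using J k by (auto simp: put_def head_at_def fun_eq_iff)
  ultimately show "(\<exists>h. marks K c h \<and> (\<forall>j. j \<noteq> 0 \<longrightarrow> j \<noteq> 10 \<longrightarrow> put k ?g i f j = h j)) \<and>
      put k ?g i f 10 = (\<lambda>l. l < c 10 \<and> Suc i \<le> l)"
    using h by blast
next
  fix s :: st and f assume s: "ruled W f" "(\<exists>h. marks K c h \<and> (\<forall>j. j \<noteq> 0 \<longrightarrow> j \<noteq> 10 \<longrightarrow> f j = h j)) \<and> f 10 = (\<lambda>l. l < c 10 \<and> W \<le> l)"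
     "hpos s = 0" "cells s = put k (\<lambda>v. v) W f" "ipos s = length w + 1" "outp s = []"
  then have "f 10 = (\<lambda>l. l < 0)" using c W by (auto simp: fun_eq_iff)
  then have "marks K (c(10 := 0)) f" using s(2) by (auto simp: marks_def)
  then show "area w W K (c(10 := 0)) s" using s by (simp add: area_def)
qed (use k W in auto)

lemma tot_extend:
  assumes k: "11 < k" and W: "W \<le> B"
  shows "tot k w B (area w W K c) extend (area w (Suc W) K c)"
  unfolding extend_def
  by (rule tot_sweep_area[where W = W and J = "\<lambda>_. marks K c"])
     (use k W in \<open>auto simp: put_def head_at_def fun_eq_iff area_def marks_def ruled_def less_Suc_eq\<close>)

text \<open>The flag reports whether the counter was full before the increment. An empty counter is
  incremented once ahead of its loop, so each loop makes exactly \<open>K\<close> rounds, and the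
  area grows by \<open>K * K\<close> cells in all.\<close>

lemma tot_square:
  assumes k: "11 < k" and K: "0 < K" and B: "B = K + K * K"
  shows "tot k w B (area w K K (\<lambda>_. 0))
    (unary_inc 8 ;;
     While (\<lambda>_ v. \<not> v 0)
       (unary_clear 10 ;; unary_inc 10 ;; While (\<lambda>_ v. \<not> v 0) (extend ;; unary_inc 10) ;; unary_inc 8))
    (\<lambda>s. \<exists>c. area w (K + K * K) K c s)"
proof -
  let ?body = "unary_clear 10 ;; unary_inc 10 ;; While (\<lambda>_ v. \<not> v 0) (extend ;; unary_inc 10) ;; unary_inc 8"
  let ?I = "\<lambda>p s. \<exists>q\<le>K. area w (K + p * K) K ((\<lambda>_ :: nat. 0)(8 := min (Suc p) K, 10 := q)) s \<and> cells s 0 0 = (p = K)"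
  let ?J = "\<lambda>p j s. area w (K + p * K + j) K ((\<lambda>_ :: nat. 0)(8 := Suc p, 10 := min (Suc j) K)) s \<and> cells s 0 0 = (j = K)"
  have view0: "view k s 0 = cells s 0 0" for s using k by (simp add: view_def head_at_def)
  have bound: "K + p * K + j \<le> B" if "p < K" "j \<le> K" for p j
  proof -
    have "p * K + j \<le> Suc p * K" using that by simp
    also have "\<dots> \<le> K * K" using that by (intro mult_right_mono) auto
    finally show ?thesis using B by simp
  qed
  have upd0: "(\<lambda>_ :: nat. 0)(8 := m, 10 := 0) = (\<lambda>_. 0 :: nat)(8 := m)" for m :: nat
    by (auto simp: fun_eq_iff)
  have start: "tot k w B (area w K K (\<lambda>_. 0)) (unary_inc 8) (?I 0)"
    by (rule tot_conseq[OF tot_unary_inc[where W = K and K = K and c = "\<lambda>_. 0"]])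
       (use k K B upd0 in \<open>auto intro!: exI[of _ 0]\<close>)
  have inner: "tot k w B (?J p 0) (While (\<lambda>_ v. \<not> v 0) (extend ;; unary_inc 10)) (?J p K)" if p: "p < K" for p
  proof (rule tot_While[where I = "?J p"])
    fix j assume j: "j < K"
    have "tot k w B (?J p j) extend (area w (K + p * K + Suc j) K ((\<lambda>_ :: nat. 0)(8 := Suc p, 10 := min (Suc j) K)))"
      by (rule tot_conseq[OF tot_extend[OF k, of "K + p * K + j"]]) (use bound[OF p, of j] j in auto)
    moreover have "tot k w B (area w (K + p * K + Suc j) K ((\<lambda>_ :: nat. 0)(8 := Suc p, 10 := min (Suc j) K))) (unary_inc 10)
        (?J p (Suc j))"
      by (rule tot_conseq[OF tot_unary_inc[OF k, where W = "K + p * K + Suc j" and K = K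
          and c = "(\<lambda>_ :: nat. 0)(8 := Suc p, 10 := min (Suc j) K)"]])
         (use bound[OF p, of "Suc j"] j in auto)
    ultimately show "tot k w B (?J p j) (extend ;; unary_inc 10) (?J p (Suc j))" by (rule tot_Seq)
  qed (auto simp: view0)
  have "tot k w B (?I p) (?body)
      (?I (Suc p))" if p: "p < K" for p
  proof -
    let ?c = "(\<lambda>_ :: nat. 0)(8 := Suc p, 10 := 0)"
    have "tot k w B (area w (K + p * K) K ((\<lambda>_ :: nat. 0)(8 := min (Suc p) K, 10 := q))) (unary_clear 10)
        (area w (K + p * K) K ?c)" if "q \<le> K" for q
      by (rule tot_conseq[OF tot_unary_clear[OF k, where W = "K + p * K" and K = K and c = "(\<lambda>_ :: nat. 0)(8 := min (Suc p) K, 10 := q)"]])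
         (use bound[OF p, of 0] p that in auto)
    then have "tot k w B (?I p) (unary_clear 10) (area w (K + p * K) K ?c)" unfolding tot_def by blast
    moreover have "tot k w B (area w (K + p * K) K ?c) (unary_inc 10) (?J p 0)"
      by (rule tot_conseq[OF tot_unary_inc[OF k, where W = "K + p * K" and K = K and c = ?c]])
         (use bound[OF p, of 0] K in auto)
    moreover have "tot k w B (?J p K) (unary_inc 8) (?I (Suc p))"
    proof (rule tot_conseq[OF tot_unary_inc[OF k, where W = "K + p * K + K" and K = K and t = 8 and c = "(\<lambda>_ :: nat. 0)(8 := Suc p, 10 := K)"]])
      fix s assume "area w (K + p * K + K) K (((\<lambda>_ :: nat. 0)(8 := Suc p, 10 := K))(8 := min (Suc (((\<lambda>_ :: nat. 0)(8 := Suc p, 10 := K)) 8)) K)) s \<and>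
         cells s 0 0 = (((\<lambda>_ :: nat. 0)(8 := Suc p, 10 := K)) 8 = K)"
      then show "?I (Suc p) s" by (intro exI[of _ K]) (auto simp: ac_simps fun_upd_twist)
    qed (use bound[OF p, of K] p in auto)
    ultimately show ?thesis using inner[OF p] by (meson tot_Seq)
  qed
  then have "tot k w B (?I 0) (While (\<lambda>_ v. \<not> v 0)
       (?body)) (?I K)"
    by (intro tot_While[where I = ?I]) (auto simp: view0)
  from tot_Seq[OF start this] show ?thesis by (rule tot_conseq) auto
qed

section \<open>Counting the input positions in binary\<close>

definition counting :: "bool list \<Rightarrow> nat \<Rightarrow> st \<Rightarrow> bool" where
  "counting w i s \<longleftrightarrow> hpos s = 0 \<and> ruled (floor_log i + 1) (cells s) \<and>
     val (floor_log i + 1) (cells s 8) = i \<and> (\<forall>l>floor_log i. \<not> cells s 8 l) \<and>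
     (\<forall>j\<ge>9. cells s j = (\<lambda>_. False)) \<and> ipos s = i \<and> outp s = []"

lemma floor_log_Suc:
  assumes "Suc i < 2 ^ (floor_log i + 1)" shows "floor_log (Suc i) = floor_log i"
proof (cases "i = 0")
  case False
  then show ?thesis using assms floor_log_exp2_le[of i] by (intro floor_log_eqI) auto
qed simp

lemma floor_log_Suc_exp:
  assumes "Suc i = 2 ^ (floor_log i + 1)" shows "floor_log (Suc i) = floor_log i + 1"
  using floor_log_power[of "floor_log i + 1"] assms by simp

lemma tot_count_step:
  assumes k: "11 < k" and i: "i \<le> length w" and B: "floor_log i + 1 \<le> B"
  shows "tot k w B (counting w i)
     (raise_flag ;;
      sweep (\<lambda>v. v(8 := v 8 \<noteq> v 0, 0 := v 8 \<and> v 0)) (\<lambda>v. if v 0 then v(8 := True, 6 := True) else v) ;;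
      Act Right Stay (\<lambda>_ v. v) None) (counting w (Suc i))"
proof -
  let ?K = "floor_log i + 1"
  let ?g = "\<lambda>v :: local_view. v(8 := v 8 \<noteq> v 0, 0 := v 8 \<and> v 0)"
  let ?e = "\<lambda>v :: local_view. if v 0 then v(8 := True, 6 := True) else v"
  \<comment> \<open>\<open>x\<close> is the counter before the increment: from bit \<open>l\<close>
    on it is still unchanged, and the bits below together with the pending carry already amount to
    one more.\<close>
  define J where "J l f \<longleftrightarrow> (\<exists>x. val ?K x = i \<and> (\<forall>m>floor_log i. \<not> x m) \<and> (\<forall>m\<ge>l. f 8 m = x m) \<and>
      val l (f 8) + of_bool (f 0 0) * 2 ^ l = val l x + 1) \<and> (\<forall>j\<ge>9. f j = (\<lambda>_. False))" for l and f :: "nat \<Rightarrow> nat \<Rightarrow> bool"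
  have 1: "tot k w B (counting w i) raise_flag (\<lambda>s. counting w i s \<and> cells s 0 0)"
    by (rule tot_raise_flag) (use k i in \<open>auto simp: counting_def ruled_def\<close>)
  have step: "J (Suc l) (put k g l f)" if J: "J l f" and g: "g = ?g" for l f g
  proof -
    obtain x where x: "val ?K x = i" "\<forall>m>floor_log i. \<not> x m" "\<forall>m\<ge>l. f 8 m = x m"
      "val l (f 8) + of_bool (f 0 0) * 2 ^ l = val l x + 1" and f: "\<forall>j\<ge>9. f j = (\<lambda>_. False)"
      using J unfolding J_def by blast
    let ?f = "put k g l f"
    have f8: "?f 8 m = (if m = l then f 8 l \<noteq> f 0 0 else f 8 m)" and f0: "?f 0 0 = (f 8 l \<and> f 0 0)" for m
      using k by (auto simp: put_def head_at_def g)
    have "val l (?f 8) = val l (f 8)" by (rule val_cong) (simp add: f8)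
    then have "val (Suc l) (?f 8) + of_bool (?f 0 0) * 2 ^ Suc l = val (Suc l) x + 1"
      using x(3,4) by (auto simp: f8 f0 of_bool_def split: if_splits)
    moreover have "\<forall>m\<ge>Suc l. ?f 8 m = x m" using x(3) by (auto simp: f8)
    moreover have "\<forall>j\<ge>9. ?f j = (\<lambda>_. False)" using f by (auto simp: put_def fun_eq_iff g)
    ultimately show ?thesis using x(1,2) unfolding J_def by blast
  qed
  have 2: "tot k w B
    (\<lambda>s. hpos s = 0 \<and> ruled ?K (cells s) \<and> J 0 (cells s) \<and> ipos s = i \<and> outp s = [])
    (sweep ?g ?e)
    (\<lambda>s. hpos s = 0 \<and> (\<exists>f. ruled ?K f \<and> J ?K f \<and> cells s = put k ?e ?K f) \<and> ipos s = i \<and> outp s = [])"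
    by (intro tot_sweep step[OF _ refl]) (use k i B in auto)
  have 3: "tot k w B (\<lambda>s. hpos s = 0 \<and> (\<exists>f. ruled ?K f \<and> J ?K f \<and> cells s = put k ?e ?K f) \<and> ipos s = i \<and> outp s = [])
      (Act Right Stay (\<lambda>_ v. v) None) (counting w (Suc i))"
  proof (rule tot_Act)
    fix s :: st assume s: "hpos s = 0 \<and> (\<exists>f. ruled ?K f \<and> J ?K f \<and> cells s = put k ?e ?K f) \<and> ipos s = i \<and> outp s = []"
    then obtain f where f: "ruled ?K f" "cells s = put k ?e ?K f" and J: "J ?K f" by blast
    from J have f9: "\<forall>j\<ge>9. f j = (\<lambda>_. False)" unfolding J_def by simp
    from J obtain x where x: "val ?K x = i" "\<forall>m>floor_log i. \<not> x m" "\<forall>m\<ge>?K. f 8 m = x m"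
        "val ?K (f 8) + of_bool (f 0 0) * 2 ^ ?K = val ?K x + 1"
      unfolding J_def by (elim conjE exE)
    have c8: "cells s 8 m = (f 0 0 \<and> m = ?K \<or> f 8 m)" and c6: "cells s 6 m = (f 0 0 \<and> m = ?K \<or> f 6 m)" for m
      using k by (auto simp: f(2) put_def head_at_def)
    have c7: "cells s 7 = f 7" using k by (auto simp: f(2) put_def head_at_def fun_eq_iff)
    have c9: "\<forall>j\<ge>9. cells s j = (\<lambda>_. False)" using f9 by (auto simp: f(2) put_def fun_eq_iff)
    have z: "\<not> f 8 m" if "?K \<le> m" for m using x(2,3) that by auto
    have "val ?K x < 2 ^ ?K" by (rule val_less)
    then have lt: "i < 2 ^ ?K" using x(1) by simp
    have K: "ruled (floor_log (Suc i) + 1) (cells s) \<and> val (floor_log (Suc i) + 1) (cells s 8) = Suc i \<and>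
      (\<forall>l>floor_log (Suc i). \<not> cells s 8 l)"
    proof (cases "f 0 0")
      case True
      \<comment> \<open>A carry out of the last cell forces \<open>Suc i = 2 ^ ?K\<close>: all old
        cells are 0 and the new one holds the leading 1.\<close>
      have "val ?K (f 8) + 2 ^ ?K = i + 1" using x(4) unfolding x(1) by (simp only: True of_bool_eq mult_1)
      then have e: "Suc i = 2 ^ ?K" "val ?K (f 8) = 0" using lt by linarith+
      have "val ?K (cells s 8) = val ?K (f 8)" by (rule val_cong) (simp add: c8)
      then have "val (Suc ?K) (cells s 8) = Suc i" using e True by (simp add: c8 z)
      then show ?thesis using floor_log_Suc_exp[OF e(1)] True f(1) z
        by (auto simp: ruled_def fun_eq_iff c6 c7 c8 less_Suc_eq)
    next
      case False
      then have e: "val ?K (f 8) = Suc i" using x(1,4) by simp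
      have "val ?K (f 8) < 2 ^ ?K" by (rule val_less)
      then have l: "floor_log (Suc i) = floor_log i" using e by (intro floor_log_Suc) simp
      have "cells s 8 = f 8" "cells s 6 = f 6" using False c8 c6 by (auto simp: fun_eq_iff)
      then show ?thesis using l e f(1) z c7 by (simp add: ruled_def)
    qed
    have "cells (act k w Right Stay (\<lambda>_ v. v) None s) = cells s"
      by (auto simp: act_def view_def fun_eq_iff)
    then show "hpos (act k w Right Stay (\<lambda>_ v. v) None s) \<le> B \<and>
        counting w (Suc i) (act k w Right Stay (\<lambda>_ v. v) None s)"
      unfolding counting_def \<open>cells (act k w Right Stay (\<lambda>_ v. v) None s) = cells s\<close>
      using K c9 s i by (simp only: act_def st.simps move_head.simps option.simps append_Nil) simp
  qed
  have start: "J 0 (cells s)" if "counting w i s" "cells s 0 0" for s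
    using that unfolding counting_def J_def by (intro conjI exI[of _ "cells s 8"]) auto
  have "tot k w B (\<lambda>s. counting w i s \<and> cells s 0 0) (sweep ?g ?e)
    (\<lambda>s. hpos s = 0 \<and> (\<exists>f. ruled ?K f \<and> J ?K f \<and> cells s = put k ?e ?K f) \<and> ipos s = i \<and> outp s = [])"
    by (rule tot_conseq[OF 2]) (use start in \<open>auto simp: counting_def\<close>)
  then show ?thesis by (intro tot_Seq[OF 1] tot_Seq[OF _ 3])
qed

lemma tot_set_up:
  assumes k: "11 < k"
  shows "tot k w (width (length w)) (\<lambda>s. s = init_st) set_up
    (\<lambda>s. \<exists>f. rep w (width (length w)) \<lparr>reg = (\<lambda>_. 0), flag = f, ip = length w + 1, outs = []\<rparr> s)"
proof -
  let ?n = "length w" and ?B = "width (length w)"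
  let ?K = "bitlen ?n"
  have K: "?K \<le> ?B" "0 < ?K" by (simp_all add: width_def bitlen_def)
  have 1: "tot k w ?B (\<lambda>s. s = init_st) (Act Stay Stay (\<lambda>_ v. v(6 := True, 7 := True)) None) (counting w 0)"
    by (rule tot_Act) (use k in \<open>auto simp: init_st_def act_def counting_def ruled_def head_at_def fun_eq_iff view_def\<close>)
  have 2: "tot k w ?B (counting w 0) count_input (counting w (?n + 1))"
    unfolding count_input_def
  proof (rule tot_While)
    fix i assume i: "i < ?n + 1"
    have "floor_log i + 1 \<le> ?K" using floor_log_le_iff[of i "?n + 1"] i by (simp add: bitlen_def)
    then show "tot k w ?B (counting w i) (raise_flag ;;
      sweep (\<lambda>v. v(8 := v 8 \<noteq> v 0, 0 := v 8 \<and> v 0)) (\<lambda>v. if v 0 then v(8 := True, 6 := True) else v) ;;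
      Act Right Stay (\<lambda>_ v. v) None) (counting w (Suc i))"
      using i K by (intro tot_count_step[OF k]) auto
  qed (auto simp: counting_def input_at_def)
  have 3: "tot k w ?B (counting w (?n + 1)) (sweep (\<lambda>v. v(8 := False, 9 := True)) (\<lambda>v. v)) (area w ?K ?K (\<lambda>_. 0))"
  proof (rule tot_sweep_area[where W = ?K and J = "\<lambda>i f. (\<forall>l. f 8 l \<longrightarrow> i \<le> l \<and> l < ?K) \<and> f 9 = (\<lambda>l. l < i) \<and>
      (\<forall>j\<ge>10. f j = (\<lambda>_. False))"])
    let ?g = "\<lambda>v :: local_view. v(8 := False, 9 := True)"
    fix i and f :: "nat \<Rightarrow> nat \<Rightarrow> bool" assume "i < ?K" and f: "(\<forall>l. f 8 l \<longrightarrow> i \<le> l \<and> l < ?K) \<and> f 9 = (\<lambda>l. l < i) \<and> (\<forall>j\<ge>10. f j = (\<lambda>_. False))"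
    have "\<forall>l. put k ?g i f 8 l \<longrightarrow> Suc i \<le> l \<and> l < ?K"
      using f k by (auto simp: put_def head_at_def Suc_le_eq le_neq_implies_less split: if_splits)
    moreover have "put k ?g i f 9 = (\<lambda>l. l < Suc i)"
      using f k by (auto simp: put_def head_at_def fun_eq_iff)
    moreover have "put k ?g i f j = (\<lambda>_. False)" if "10 \<le> j" for j
      using f k that by (auto simp: put_def fun_eq_iff)
    ultimately show "(\<forall>l. put k ?g i f 8 l \<longrightarrow> Suc i \<le> l \<and> l < ?K) \<and> put k ?g i f 9 = (\<lambda>l. l < Suc i) \<and>
      (\<forall>j\<ge>10. put k ?g i f j = (\<lambda>_. False))" by blast
  next
    fix s assume "counting w (?n + 1) s"
    then show "hpos s = 0 \<and> ruled ?K (cells s) \<and> ((\<forall>l. cells s 8 l \<longrightarrow> 0 \<le> l \<and> l < ?K) \<and> cells s 9 = (\<lambda>l. l < 0) \<and>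
      (\<forall>j\<ge>10. cells s j = (\<lambda>_. False))) \<and> ipos s = ?n + 1 \<and> outp s = []"
      by (auto simp: counting_def bitlen_def less_Suc_eq_le not_le[symmetric])
  next
    fix s :: st and f assume s: "ruled ?K f" "(\<forall>l. f 8 l \<longrightarrow> ?K \<le> l \<and> l < ?K) \<and> f 9 = (\<lambda>l. l < ?K) \<and>
      (\<forall>j\<ge>10. f j = (\<lambda>_. False))" "hpos s = 0" "cells s = put k (\<lambda>v. v) ?K f" "ipos s = ?n + 1" "outp s = []"
    then have "marks ?K (\<lambda>_. 0) f" by (fastforce simp: marks_def fun_eq_iff)
    then show "area w ?K ?K (\<lambda>_. 0) s" using s by (simp add: area_def)
  qed (use k K in auto)
  have 4: "tot k w ?B (\<lambda>s. s = init_st) set_up (\<lambda>s. \<exists>c. area w ?B ?K c s)"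
    unfolding set_up_def
    using tot_square[OF k K(2), of ?B w]
    by (intro tot_Seq[OF 1] tot_Seq[OF 2] tot_Seq[OF 3]) (simp add: width_def)
  have "val i (\<lambda>_. False) = 0" for i by (induction i) auto
  then show ?thesis
    by (intro tot_conseq[OF 4]) (auto simp: rep_def area_def marks_def)
qed

section \<open>Functions defined by formulas\<close>

text \<open>Variables 0 and 1 hold the constants 0 and 1; the pair of variables 2 and 3 runs through all
  pairs of numbers, and for each of them the two formulas decide which bits are written.\<close>

definition env4 :: "nat \<Rightarrow> nat \<Rightarrow> nat \<Rightarrow> nat" where
  "env4 p q = (\<lambda>_. 0)(1 := 1, 2 := p, 3 := q)"

definition emitted :: "form \<Rightarrow> form \<Rightarrow> bool list \<Rightarrow> nat \<Rightarrow> nat \<Rightarrow> bool list" where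
  "emitted \<phi> \<psi> w p q = (if eval w (width (length w)) (env4 p q) \<phi> then [True] else []) @
     (if eval w (width (length w)) (env4 p q) \<psi> then [False] else [])"

definition form_output :: "form \<Rightarrow> form \<Rightarrow> bool list \<Rightarrow> bool list" where
  "form_output \<phi> \<psi> w = concat (map (\<lambda>p. concat (map (emitted \<phi> \<psi> w p) [0..<2 ^ width (length w)]))
     [0..<2 ^ width (length w)])"

context bounded_registers
begin

definition driver :: "form \<Rightarrow> form \<Rightarrow> com" where
  "driver \<phi> \<psi> = inc (var 1) ;;
     for_all (var 2) (for_all (var 3)
       (compile \<phi> ;; Cond F (emit True) skip ;; compile \<psi> ;; Cond F (emit False) skip))"

lemma ht_driver:
  assumes k: "11 + count2 b < k" and b: "3 \<le> b" and wff: "wff b {0,1,2,3} \<phi>" "wff b {0,1,2,3} \<psi>"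
    and W_def: "W = width (length w)"
  shows "ht (\<lambda>a. reg a = (\<lambda>_. 0) \<and> outs a = []) (driver \<phi> \<psi>) (\<lambda>a. outs a = form_output \<phi> \<psi> w)"
proof -
  let ?S = "{0, 1, 2, 3} :: nat set"
  let ?em = "emitted \<phi> \<psi> w"
  let ?body = "compile \<phi> ;; Cond F (emit True) skip ;; compile \<psi> ;; Cond F (emit False) skip"
  have k': "11 + var 1 < k" "11 + var 2 < k" "11 + var 3 < k"
    using k b by (auto simp: var_def count2_def)
  have corr: "computes_form ?S (compile \<phi>) \<phi>" "computes_form ?S (compile \<psi>) \<psi>"
    using compile_correct[OF k] wff b by auto
  let ?C = "\<lambda>X (a :: ast). reg a (var 0) = 0 \<and> reg a (var 1) = 1 \<and> outs a = X"
  let ?D = "\<lambda>p q X a. ?C X a \<and> reg a (var 2) = p \<and> reg a (var 3) = q"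
  have sub: "ht (?D p q X) (compile \<phi>) (\<lambda>a. ?D p q X a \<and> flag a 0 = eval w W (env4 p q) \<phi>)"
    if \<phi>: "computes_form ?S (compile \<phi>) \<phi>" and wff: "wff b ?S \<phi>" for \<phi> p q X
  proof (rule ht_fix)
    fix a1 assume a1: "?D p q X a1"
    then have "eval w W (env a1) \<phi> = eval w W (env4 p q) \<phi>"
      by (intro eval_cong[OF wff]) (auto simp: env_def env4_def)
    then show "ht (\<lambda>a. a = a1) (compile \<phi>) (\<lambda>a. ?D p q X a \<and> flag a 0 = eval w W (env4 p q) \<phi>)"
      using \<phi>[unfolded computes_form_def, rule_format, of a1] a1
      by (auto elim!: ht_conseq simp: same_def)
  qed
  have cond: "ht (\<lambda>a. ?D p q X a \<and> flag a 0 = e) (Cond F (emit c) skip) (?D p q (X @ (if e then [c] else [])))"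
    for p q X e c
    by (intro ht_Cond ht_emit ht_skip) auto
  have body: "ht (?D p q X) (?body)
      (?D p q (X @ ?em p q))" for p q X
    using ht_Seq[OF sub[OF corr(1) wff(1)] ht_Seq[OF cond ht_Seq[OF sub[OF corr(2) wff(2)] cond]]]
    by (simp add: emitted_def W_def)
  let ?I = "\<lambda>p X q a. ?C (X @ concat (map (?em p) [0..<q])) a \<and> reg a (var 2) = p"
  have inner: "ht (?I p X 0) (for_all (var 3) (?body))
     (?I p X (2 ^ W))" for p X
  proof (rule ht_for_all[where I = "?I p X"])
    fix q
    show "ht (\<lambda>a. ?I p X q a \<and> reg a (var 3) = q)
       (?body)
       (\<lambda>a. ?I p X (Suc q) a \<and> reg a (var 3) = q)"
      by (rule ht_conseq[OF body[where p = p and q = q and X = "X @ concat (map (?em p) [0..<q])"]]) auto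
  qed (use k' in auto)
  let ?row = "\<lambda>p. concat (map (?em p) [0..<2 ^ W])"
  let ?O = "\<lambda>p a. ?C (concat (map ?row [0..<p])) a"
  have outer: "ht (?O 0) (for_all (var 2) (for_all (var 3)
       (?body))) (?O (2 ^ W))"
  proof (rule ht_for_all[where I = ?O])
    fix p
    show "ht (\<lambda>a. ?O p a \<and> reg a (var 2) = p)
       (for_all (var 3) (?body))
       (\<lambda>a. ?O (Suc p) a \<and> reg a (var 2) = p)"
      by (rule ht_conseq[OF inner[where p = p and X = "concat (map ?row [0..<p])"]]) auto
  qed (use k' in auto)
  have "1 < (2 :: nat) ^ W" using W by (intro one_less_power) auto
  then have "ht (\<lambda>a. reg a = (\<lambda>_. 0) \<and> outs a = []) (inc (var 1)) (?O 0)"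
    using k' W by (intro ht_inc) auto
  from ht_Seq[OF this outer] show ?thesis
    unfolding driver_def by (rule ht_conseq) (auto simp: form_output_def W_def)
qed

end

lemma width_bigo: "(\<lambda>n. real (width n + 1)) \<in> O(\<lambda>n. (log 2 (real n))\<^sup>2)"
\<comment> \<open>With \<open>L = log 2 n\<close>, which is at least 1, \<open>bitlen n\<close> is
  at most \<open>L + 2\<close> and thus at most \<open>3 * L\<close>; then
  \<open>9 * L^2 + 3 * L + 1\<close> is at most \<open>13 * L^2\<close>.\<close>
proof (rule bigoI[where c = 13], rule eventually_sequentiallyI[of 2])
  fix n :: nat assume n: "2 \<le> n"
  let ?L = "log 2 (real n)"
  have L: "1 \<le> ?L" using n by simp
  have "real (floor_log (n + 1)) \<le> log 2 (real (n + 1))"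
    using floor_log_altdef[of "n + 1"] by simp
  also have "\<dots> \<le> log 2 (real (2 * n))" using n by (intro log_mono) auto
  also have "\<dots> = 1 + ?L" using n by (simp add: log_mult)
  finally have b: "real (bitlen n) \<le> 3 * ?L" using L by (simp add: bitlen_def)
  then have "real (bitlen n) * real (bitlen n) \<le> (3 * ?L) * (3 * ?L)" using L by (intro mult_mono) auto
  moreover have "?L \<le> ?L * ?L" using mult_left_mono[of 1 ?L ?L] L by simp
  ultimately have "real (width n + 1) \<le> 13 * ?L\<^sup>2"
    unfolding width_def power2_eq_square of_nat_add of_nat_mult of_nat_1 using b L by linarith
  then show "norm (real (width n + 1)) \<le> 13 * norm (?L\<^sup>2)" by simp
qed

text \<open>The space bound concerns all words, not only encodings. It holds because the register
  length is computed from the length of the word and the number of tapes only depends on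
  \<open>b\<close>.\<close>

theorem form_output_FDSPACE:
  assumes b: "3 \<le> b" and wff: "wff b {0,1,2,3} \<phi>" "wff b {0,1,2,3} \<psi>"
  shows "form_output \<phi> \<psi> \<in> FDSPACE (\<lambda>n. (log 2 (real n))\<^sup>2)"
proof (rule FDSPACE_com)
  \<comment> \<open>Eleven tapes for flags, marks and set-up, then registers 0 to
    \<open>count2 b\<close>.\<close>
  let ?k = "12 + count2 b"
  fix w
  interpret bounded_registers ?k w "width (length w)"
    by unfold_locales (auto simp: width_def bitlen_def count2_def)
  have "tot ?k w (width (length w)) (\<lambda>s. s = init_st) (set_up ;; driver \<phi> \<psi>) (\<lambda>s. outp s = form_output \<phi> \<psi> w)"
  proof (rule tot_Seq[OF tot_set_up])
    show "tot ?k w (width (length w))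
      (\<lambda>s. \<exists>f. rep w (width (length w)) \<lparr>reg = \<lambda>_. 0, flag = f, ip = length w + 1, outs = []\<rparr> s)
      (driver \<phi> \<psi>) (\<lambda>s. outp s = form_output \<phi> \<psi> w)"
    proof (rule tot_conseq[OF ht_driver[OF _ b wff, unfolded ht_def]])
      fix s assume "\<exists>f. rep w (width (length w)) \<lparr>reg = \<lambda>_. 0, flag = f, ip = length w + 1, outs = []\<rparr> s"
      then show "\<exists>a. rep w (width (length w)) a s \<and> reg a = (\<lambda>_. 0) \<and> outs a = []" by force
    qed (auto simp: rep_def)
  qed (use k in simp)
  then show "\<exists>s. big ?k w (width (length w)) (set_up ;; driver \<phi> \<psi>) init_st s \<and> outp s = form_output \<phi> \<psi> w"
    unfolding tot_def by blast
qed (rule width_bigo)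

section \<open>Short certificates for new transversals\<close>

definition compatible :: "'v set set \<Rightarrow> 'v set \<Rightarrow> 'v set set" where
  "compatible H X = {E \<in> H. E \<inter> X = {}}"

definition frequent :: "'v set \<Rightarrow> 'v set set \<Rightarrow> 'v set \<Rightarrow> 'v set" where
  "frequent V H X = {v \<in> V. v \<notin> X \<and>
     card {E \<in> compatible H X. v \<notin> E} \<le> card {E \<in> compatible H X. v \<in> E}}"

definition exclusions :: "'v set \<Rightarrow> 'v set set \<Rightarrow> 'v set set" where
  "exclusions V G = {{v} |v. v \<in> V} \<union> {E - {v} |E v. E \<in> G \<and> v \<in> E}"

text \<open>
  Let \<open>T\<close> be a minimal new transversal disjoint from the excluded set \<open>X\<close>.  Either excluding a
  frequent vertex outside \<open>T\<close>, or excluding the rest of an edge in which a non-frequent vertex of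
  \<open>T\<close> is critical, halves the number of compatible edges of \<open>H\<close>; otherwise the frequent
  vertices already form a new transversal.
\<close>

lemma frequent_new_transversal:
  assumes fin: "finite H" and G: "\<And>E. E \<in> G \<Longrightarrow> E \<subseteq> V"
    and ip: "intersection_property G H"
    and T: "new_transversal V G H T"
    and minimal: "\<And>v. v \<in> T \<Longrightarrow> \<not> new_transversal V G H (T - {v})"
  shows "T \<inter> X = {} \<Longrightarrow> card (compatible H X) < 2 ^ j \<Longrightarrow>
    \<exists>ms. length ms \<le> j \<and> set ms \<subseteq> exclusions V G \<and> new_transversal V G H (frequent V H (X \<union> \<Union>(set ms)))"
proof (induction j arbitrary: X)
  case 0
  have f: "finite (compatible H X)" using fin by (simp add: compatible_def)
  then have "compatible H X = {}" using 0 by simp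
  \<comment> \<open>Without compatible edges every vertex outside \<open>X\<close> is frequent, both
    counts being 0. This set contains \<open>T\<close>, and every edge of \<open>H\<close> has a
    vertex in \<open>X\<close> that it lacks.\<close>
  then have "frequent V H X = V - X" by (auto simp: frequent_def)
  moreover have "E \<inter> X \<noteq> {}" if "E \<in> H" for E
    using \<open>compatible H X = {}\<close> that by (auto simp: compatible_def)
  moreover have "T \<subseteq> V - X" using T 0(1) by (auto simp: new_transversal_def transversal_def)
  moreover have "T \<inter> E \<noteq> {}" if "E \<in> G" for E
    using T that by (simp add: new_transversal_def transversal_def)
  ultimately have "new_transversal V G H (frequent V H X)"
    unfolding new_transversal_def transversal_def independent_set_def by blast
  then show ?case by (intro exI[of _ "[]"]) simp
next
  case (Suc j)
  let ?C = "compatible H X" and ?F = "frequent V H X"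
  have f: "finite ?C" using fin by (simp add: compatible_def)
  have split: "card ?C = card {E \<in> ?C. v \<in> E} + card {E \<in> ?C. v \<notin> E}" for v
    using f by (subst card_Un_disjoint[symmetric]) (auto intro: arg_cong[where f = card])
  have go: "\<exists>ms. length ms \<le> Suc j \<and> set ms \<subseteq> exclusions V G \<and>
      new_transversal V G H (frequent V H (X \<union> \<Union>(set ms)))"
    if "D \<in> exclusions V G" "T \<inter> D = {}" "card (compatible H (X \<union> D)) < 2 ^ j" for D
  proof -
    have "T \<inter> (X \<union> D) = {}" using that Suc.prems by blast
    from Suc.IH[OF this that(3)] obtain ms where "length ms \<le> j" "set ms \<subseteq> exclusions V G"
        "new_transversal V G H (frequent V H (X \<union> D \<union> \<Union>(set ms)))" by blast
    then show ?thesis using that(1) by (intro exI[of _ "D # ms"]) (auto simp: Un_assoc)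
  qed
  show ?case
  proof (cases "?F \<subseteq> T")
    case False
    then obtain v where v: "v \<in> V" "v \<notin> T" "card {E \<in> ?C. v \<notin> E} \<le> card {E \<in> ?C. v \<in> E}"
      by (auto simp: frequent_def)
    have "compatible H (X \<union> {v}) = {E \<in> ?C. v \<notin> E}" by (auto simp: compatible_def)
    then have "card (compatible H (X \<union> {v})) < 2 ^ j" using v(3) split[of v] Suc.prems(2) by simp
    then show ?thesis using v by (intro go[of "{v}"]) (auto simp: exclusions_def)
  next
    case True
    show ?thesis
    proof (cases "transversal V G ?F")
      case tr: True
      have "\<not> E \<subseteq> ?F" if "E \<in> H" for E
        using T True that unfolding new_transversal_def independent_set_def by (meson subset_trans)
      moreover have "?F \<subseteq> V" by (auto simp: frequent_def)
      ultimately have "new_transversal V G H ?F"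
        using tr unfolding new_transversal_def independent_set_def by blast
      then show ?thesis by (intro exI[of _ "[]"]) simp
    next
      case False
      then obtain v where v: "v \<in> T" "v \<notin> ?F"
        using T True by (metis new_transversal_def subsetI subset_antisym)
      then have "\<not> transversal V G (T - {v})"
        using minimal[of v] T by (auto simp: new_transversal_def independent_set_def)
      then obtain E where E: "E \<in> G" "(T - {v}) \<inter> E = {}"
        using T by (auto simp: new_transversal_def transversal_def)
      then have vE: "v \<in> E" using T by (auto simp: new_transversal_def transversal_def)
      have "v \<in> V" "v \<notin> X" using T v Suc.prems(1) by (auto simp: new_transversal_def transversal_def)
      then have less: "card {E \<in> ?C. v \<in> E} < card {E \<in> ?C. v \<notin> E}" using v(2) by (simp add: frequent_def)
      \<comment> \<open>An edge of \<open>H\<close> has to meet \<open>E\<close>, and once it misses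
        \<open>E - {v}\<close> it can do so only in \<open>v\<close>.\<close>
      have "compatible H (X \<union> (E - {v})) \<subseteq> {E \<in> ?C. v \<in> E}"
        using ip E(1) by (fastforce simp: compatible_def intersection_property_def)
      then have "card (compatible H (X \<union> (E - {v}))) \<le> card {E \<in> ?C. v \<in> E}"
        using f by (intro card_mono) auto
      then have "card (compatible H (X \<union> (E - {v}))) < 2 ^ j" using less split[of v] Suc.prems(2) by simp
      then show ?thesis using E vE by (intro go[of "E - {v}"]) (auto simp: exclusions_def)
    qed
  qed
qed

text \<open>A new transversal of least cardinality cannot lose a vertex, which is the minimality
  that the halving argument asks for. Only the argument uses this transversal; the certificate may
  lead to a different one, not necessarily minimal.\<close>

lemma short_certificate:
  assumes G: "hypergraph V G" and H: "hypergraph V H" and ip: "intersection_property G H"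
    and T: "new_transversal V G H T" and card: "card H < 2 ^ j"
  shows "\<exists>ms. length ms \<le> j \<and> set ms \<subseteq> exclusions V G \<and> new_transversal V G H (frequent V H (\<Union>(set ms)))"
proof -
  have fin: "finite V" "finite H" using G H finite_subset[of H "Pow V"] by (auto simp: hypergraph_def)
  define n where "n = (LEAST n. \<exists>T. new_transversal V G H T \<and> card T = n)"
  have "\<exists>n T. new_transversal V G H T \<and> card T = n" using T by blast
  then have "\<exists>T. new_transversal V G H T \<and> card T = n" unfolding n_def by (rule LeastI_ex)
  then obtain T where T: "new_transversal V G H T" "card T = n" by blast
  have "finite T" using T fin finite_subset by (auto simp: new_transversal_def transversal_def)
  then have "\<not> new_transversal V G H (T - {v})" if "v \<in> T" for v
  proof -
    have "card (T - {v}) < n" using that T(2) \<open>finite T\<close> card_Diff1_less by metis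
    then show ?thesis unfolding n_def using not_less_Least by blast
  qed
  moreover have "E \<subseteq> V" if "E \<in> G" for E using G that by (auto simp: hypergraph_def)
  ultimately show ?thesis
    using frequent_new_transversal[OF fin(2) _ ip T(1), of "{}" j] card
    by (simp add: compatible_def)
qed

section \<open>Coding short lists of numbers\<close>

lemma digits_exist:
  fixes x :: "nat \<Rightarrow> nat"
  assumes "0 < B" "\<And>i. i < n \<Longrightarrow> x i < B"
  shows "\<exists>\<sigma><B ^ n. \<forall>i<n. \<sigma> div B ^ i mod B = x i"
  using assms(2)
proof (induction n)
  case (Suc n)
  then obtain \<sigma> where \<sigma>: "\<sigma> < B ^ n" "\<forall>i<n. \<sigma> div B ^ i mod B = x i" by auto
  have "\<sigma> + x n * B ^ n < Suc (x n) * B ^ n" using \<sigma>(1) by simp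
  also have "\<dots> \<le> B * B ^ n" using Suc.prems[of n] by (intro mult_right_mono) auto
  finally have "\<sigma> + x n * B ^ n < B ^ Suc n" by simp
  moreover have "(\<sigma> + x n * B ^ n) div B ^ i mod B = x i" if "i < Suc n" for i
  proof (cases "i = n")
    case True
    then show ?thesis using \<sigma>(1) Suc.prems[of n] \<open>0 < B\<close> by simp
  next
    case False
    then have i: "i < n" using that by simp
    \<comment> \<open>The place value of the new top digit is a multiple of
      \<open>B ^ i * B\<close>, so digit \<open>i\<close> does not notice it.\<close>
    have "B ^ n = B ^ i * (B ^ (n - Suc i) * B)"
    proof -
      have "n = i + Suc (n - Suc i)" using i by simp
      then show ?thesis by (metis mult.commute power_Suc power_add)
    qed
    then have "\<sigma> + x n * B ^ n = \<sigma> + B ^ i * (x n * B ^ (n - Suc i) * B)" by (simp only: ac_simps)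
    then have "(\<sigma> + x n * B ^ n) div B ^ i = x n * B ^ (n - Suc i) * B + \<sigma> div B ^ i"
      using \<open>0 < B\<close> by (simp only: div_mult_self2 power_not_zero) simp
    then show ?thesis using \<sigma>(2) i by simp
  qed
  ultimately show ?case by blast
qed simp

text \<open>
  With \<open>B = 2 ^ K\<close> and \<open>M = B ^ (K - 1)\<close> the divisors of \<open>M\<close> that are congruent to 1
  modulo \<open>B - 1\<close> are the powers of \<open>B\<close>, so the items are the digits of \<open>\<sigma>\<close> in base \<open>B\<close>.
\<close>

definition items :: "nat \<Rightarrow> nat \<Rightarrow> nat \<Rightarrow> nat \<Rightarrow> nat set" where
  "items N \<sigma> M B = {x. x < B \<and> (\<exists>P<N. \<exists>P'<N. \<exists>t<N. \<exists>c<N. \<exists>q<N. \<exists>y<N. \<exists>r<N.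
     P * P' = M \<and> c + 1 = B \<and> t * c + 1 = P \<and> q * B + x = y \<and> y * P + r = \<sigma> \<and> r < P)}"

lemma itemsI:
  assumes "x < B" "P < N" "P' < N" "t < N" "c < N" "q < N" "y < N" "r < N"
    "P * P' = M" "c + 1 = B" "t * c + 1 = P" "q * B + x = y" "y * P + r = \<sigma>" "r < P"
  shows "x \<in> items N \<sigma> M B"
  unfolding items_def mem_Collect_eq
  by (rule conjI, fact, rule exI[of _ P], rule conjI, fact, rule exI[of _ P'], rule conjI, fact,
    rule exI[of _ t], rule conjI, fact, rule exI[of _ c], rule conjI, fact, rule exI[of _ q], rule conjI, fact,
    rule exI[of _ y], rule conjI, fact, rule exI[of _ r], intro conjI; fact)

text \<open>Modulo \<open>2 ^ K - 1\<close> the power \<open>2 ^ K\<close> is 1, so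
  \<open>2 ^ j\<close> may be replaced by \<open>2 ^ s\<close> with \<open>s = j mod K\<close>. For
  \<open>0 < s < K\<close> this lies strictly between 1 and the modulus and cannot be congruent to
  1.\<close>

lemma power_two_minus_one_mod:
  assumes "0 < K" "t * (2 ^ K - 1) + 1 = (2::nat) ^ j"
  shows "K dvd j"
proof -
  define m :: nat where "m = 2 ^ K - 1"
  have m: "2 ^ K = m + 1" by (simp add: m_def)
  define s where "s = j mod K"
  have j: "j = K * (j div K) + s" by (simp add: s_def)
  have "(2 ^ K) ^ (j div K) mod m = 1 mod m"
  proof -
    have "2 ^ K mod m = 1 mod m" using m by (metis mod_add_self1)
    then show ?thesis using power_mod[of "2 ^ K" m "j div K"] power_mod[of 1 m "j div K"] by simp
  qed
  then have "2 ^ j mod m = 2 ^ s mod m"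
    by (subst j) (metis mod_mult_left_eq mult_1 power_add power_mult)
  moreover have "2 ^ j mod m = 1 mod m" using assms(2) by (metis m_def mod_mult_self3)
  ultimately have e: "2 ^ s mod m = 1 mod m" by simp
  have "s < K" using assms(1) by (simp add: s_def)
  have "s = 0"
  proof (rule ccontr)
    assume "s \<noteq> 0"
    then have "2 \<le> K" using \<open>s < K\<close> by simp
    have "(2::nat) * 2 ^ s \<le> 2 ^ K" using \<open>s < K\<close> by (metis Suc_leI one_le_numeral power_Suc power_increasing)
    moreover have "(2::nat) ^ 1 \<le> 2 ^ s" using \<open>s \<noteq> 0\<close> by (intro power_increasing) auto
    ultimately have "2 ^ s < m" "1 < m" unfolding m by simp_all
    then show False using e \<open>(2::nat) ^ 1 \<le> 2 ^ s\<close> by simp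
  qed
  then show ?thesis by (simp add: s_def dvd_eq_mod_eq_0)
qed

text \<open>As \<open>M\<close> is a power of two, a divisor has the form \<open>2 ^ j\<close>, and
  the congruence turns \<open>j\<close> into a multiple of \<open>K\<close>. The exponent
  \<open>K - 1\<close> in \<open>M\<close> belongs to the place value of the top digit, so no
  divisor points beyond the \<open>K\<close> digits. All witnesses fit because \<open>?B ^ K\<close>
  is still below \<open>N\<close>.\<close>

lemma items_digits:
  assumes K: "0 < K" and x: "\<And>i. i < K \<Longrightarrow> x i < 2 ^ K" and N: "2 ^ (K + K * K) \<le> N"
  shows "\<exists>\<sigma><N. \<exists>M<N. \<exists>B<N. items N \<sigma> M B = x ` {..<K}"
proof -
  let ?B = "2 ^ K :: nat" let ?M = "?B ^ (K - 1)"
  obtain \<sigma> where \<sigma>: "\<sigma> < ?B ^ K" "\<And>i. i < K \<Longrightarrow> \<sigma> div ?B ^ i mod ?B = x i"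
    using digits_exist[of ?B K x] x by auto
  have N': "?B * ?B ^ K \<le> N" using N by (simp add: power_add power_mult)
  have B1: "2 \<le> ?B" using K by (metis One_nat_def Suc_leI one_le_numeral power_increasing power_one_right)
  have "?B ^ K < ?B * ?B ^ K" using B1 by simp
  then have BK: "?B ^ K < N" using N' by (rule less_le_trans)
  have "?B ^ i \<le> ?B ^ K" if "i \<le> K" for i using that by (intro power_increasing) auto
  then have Bi: "?B ^ i < N" if "i \<le> K" for i using that BK le_less_trans by blast
  have "?B < N" using Bi[of 1] K by simp
  have "x \<in> items N \<sigma> ?M ?B" if i: "i < K" and "x = x' i" "x' i = \<sigma> div ?B ^ i mod ?B" for i x x'
  proof -
    let ?P = "?B ^ i" and ?q = "\<sigma> div ?B ^ i div ?B"
    have y: "?q * ?B + x = \<sigma> div ?P" using that(2,3) by (metis div_mult_mod_eq)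
    have "?P * ?B ^ (K - 1 - i) = ?M" using i by (simp add: power_add[symmetric])
    moreover obtain t where t: "t * (?B - 1) + 1 = ?P"
    proof -
      \<comment> \<open>\<open>t\<close> is the geometric sum of the powers of the base below
        \<open>?B ^ i\<close>; its recursion multiplies by the base and adds 1.\<close>
      have "\<exists>t. t * (?B - 1) + 1 = ?B ^ i"
      proof (induction i)
        case (Suc i)
        then obtain t where t: "t * (?B - 1) + 1 = ?B ^ i" by blast
        have "(t * ?B + 1) * (?B - 1) + 1 = ?B * (t * (?B - 1) + 1)"
        proof -
          obtain c where c: "?B = c + 1" using B1 by (metis add.commute le_Suc_ex add_2_eq_Suc' plus_1_eq_Suc add_Suc_right)
          show ?thesis unfolding c by (simp add: algebra_simps)
        qed
        then have "(t * ?B + 1) * (?B - 1) + 1 = ?B ^ Suc i" unfolding t power_Suc .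
        then show ?case by blast
      qed auto
      then show ?thesis using that by blast
    qed
    moreover have "t < N"
    proof -
      have "t * 1 \<le> t * (?B - 1)" using B1 by (intro mult_left_mono) auto
      then have "t < t * (?B - 1) + 1" by linarith
      then show ?thesis unfolding t using Bi[OF less_imp_le[OF i]] by (rule less_trans)
    qed
    moreover have "\<sigma> div ?P * ?P + \<sigma> mod ?P = \<sigma>" by (rule div_mult_mod_eq)
    moreover have "\<sigma> < N" using \<sigma>(1) BK by simp
    moreover have "\<sigma> div ?P < N" "?q < N" "\<sigma> mod ?P < N"
      by (rule le_less_trans[OF _ \<open>\<sigma> < N\<close>], meson div_le_dividend mod_less_eq_dividend order_trans)+
    moreover have "x < ?B" using that by simp
    moreover have "?B - 1 < N" "?B - 1 + 1 = ?B" "x < N" using \<open>?B < N\<close> B1 \<open>x < ?B\<close> by auto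
    moreover have "\<sigma> mod ?P < ?P" by simp
    moreover have "?P < N" "?B ^ (K - 1 - i) < N" using i by (auto intro!: Bi)
    ultimately show ?thesis using y
      by - (rule itemsI[where P = ?P and P' = "?B ^ (K - 1 - i)" and t = t and c = "?B - 1" and q = ?q
            and y = "\<sigma> div ?P" and r = "\<sigma> mod ?P"]; assumption)
  qed
  then have 1: "x ` {..<K} \<subseteq> items N \<sigma> ?M ?B" using \<sigma>(2) by auto
  have 2: "items N \<sigma> ?M ?B \<subseteq> x ` {..<K}"
  proof
    fix y assume "y \<in> items N \<sigma> ?M ?B"
    then obtain P P' t c q z r where *: "P * P' = ?M" "c + 1 = ?B" "t * c + 1 = P" "q * ?B + y = z"
        "z * P + r = \<sigma>" "r < P" "y < ?B"
      unfolding items_def mem_Collect_eq by (elim conjE exE)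
    then have "c = ?B - 1" by linarith
    then have P: "P * P' = ?M" "t * (?B - 1) + 1 = P" "(q * ?B + y) * P + r = \<sigma>" "r < P" "y < ?B"
      using * by blast+
    have "P dvd 2 ^ (K * (K - 1))" using P(1) by (metis dvd_triv_left power_mult)
    then obtain j where j: "j \<le> K * (K - 1)" "P = 2 ^ j"
      using divides_primepow_nat[of 2 P "K * (K - 1)"] two_is_prime_nat by blast
    have "K dvd j" using power_two_minus_one_mod[of K t j] P(2) j K by simp
    then obtain i where i: "j = K * i" by blast
    then have "i \<le> K - 1" using j(1) K by simp
    then have "i < K" using K by simp
    have "P = ?B ^ i" using i j by (simp add: power_mult)
    then have "\<sigma> div ?B ^ i mod ?B = y"
    proof -
      have "\<sigma> div P = q * ?B + y" using P(4) unfolding P(3)[symmetric] by simp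
      then show ?thesis using P(5) \<open>P = ?B ^ i\<close> by simp
    qed
    then show "y \<in> x ` {..<K}" using \<sigma>(2) \<open>i < K\<close> by auto
  qed
  have "\<sigma> < N" using \<sigma>(1) BK by simp
  moreover have "?M < N" using Bi[of "K - 1"] by simp
  ultimately show ?thesis using 1 2 \<open>?B < N\<close> by blast
qed

section \<open>Reading the adjacency lists with a finite automaton\<close>

text \<open>
  The state records the role of the last position read: with \<open>h = 0\<close> in the first and
  \<open>h = 8\<close> in the second hypergraph, \<open>h + 2\<close> and \<open>h + 1\<close> are the start and the end of an edge,
  \<open>h + 4\<close> and \<open>h + 3\<close> those of a vertex, \<open>h + 7\<close> announces a bit, \<open>h + 5\<close> and \<open>h + 6\<close> are the
  bits; 8 and 16 are the ends of the hypergraphs and 17 lies beyond the input.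
\<close>

definition parse_bit :: "nat \<Rightarrow> bool \<Rightarrow> nat" where
  "parse_bit q b = (if 16 \<le> q then 17 else (let h = 8 * (q div 8); r = q mod 8 in
     if r \<le> 1 then (if b then h + 2 else h + 8)
     else if r \<le> 3 then (if b then h + 4 else h + 1)
     else if r \<le> 6 then (if b then h + 7 else h + 3)
     else (if b then h + 6 else h + 5)))"

definition parse :: "nat \<Rightarrow> input_symbol \<Rightarrow> nat" where
  "parse q a = (case a of Bit b \<Rightarrow> parse_bit q b | _ \<Rightarrow> 17)"

lemma parse_less: "parse q a < 32"
proof -
  have "8 * (q div 8) \<le> 15" if "q < 16" using that by (simp add: div_less_iff_less_mult less_mult_imp_div_less)
  then show ?thesis by (auto simp: parse_def parse_bit_def Let_def split: input_symbol.split)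
qed

abbreviation label :: "bool list \<Rightarrow> nat \<Rightarrow> nat" where "label \<equiv> run parse"

lemma label_take: "p \<le> length w \<Longrightarrow> label w p = foldl parse_bit 0 (take p w)"
proof (induction p)
  case (Suc p)
  then show ?case
    by (simp add: take_Suc_conv_app_nth input_at_def parse_def)
qed simp

lemma label_beyond: "length w < p \<Longrightarrow> label w p = 17"
  by (cases p) (auto simp: input_at_def parse_def)

lemma label_add:
  "p + i \<le> length w \<Longrightarrow> label w (p + i) = foldl parse_bit (label w p) (take i (drop p w))"
  by (simp add: label_take take_add)

text \<open>The place in a list code where the element after \<open>xs\<close> begins: behind the
  codes of \<open>xs\<close> and the \<open>True\<close> that announces it. As the closing
  \<open>False\<close> also takes one bit, this equals the length of the code of
  \<open>xs\<close>.\<close>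

definition offset :: "('a \<Rightarrow> bool list) \<Rightarrow> 'a list \<Rightarrow> nat" where
  "offset e xs = Suc (length (concat (map (\<lambda>x. True # e x) xs)))"

lemma enc_list_split:
  "enc_list e (as @ x # bs) = concat (map (\<lambda>x. True # e x) as) @ True # e x @ enc_list e bs"
  by (simp add: enc_list_def)

lemma offset_snoc: "offset e (as @ [x]) = offset e as + Suc (length (e x))"
  by (simp add: offset_def)

lemma drop_offset: "drop (offset e as) (enc_list e (as @ x # bs) @ r) = e x @ enc_list e bs @ r"
  by (simp add: offset_def enc_list_split)

lemma length_enc_list_offset: "length (enc_list e xs) = offset e xs"
  by (simp add: enc_list_def offset_def)

text \<open>Used on all three levels of nesting: bits in a vertex, vertices in an edge, edges in a
  hypergraph.\<close>

lemma enc_list_position: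
  assumes "0 < i" "i \<le> length (enc_list e xs)"
  shows "i = length (enc_list e xs) \<or>
    (\<exists>as x bs j. xs = as @ x # bs \<and> i = offset e as + j \<and> j \<le> length (e x))"
  using assms
proof (induction xs rule: rev_induct)
  case (snoc x xs)
  show ?case
  proof (cases "i < offset e xs")
    case True
    then obtain as y bs j where "xs = as @ y # bs" "i = offset e as + j" "j \<le> length (e y)"
      using snoc.IH snoc.prems by (auto simp: length_enc_list_offset)
    then show ?thesis by (intro disjI2 exI[of _ as] exI[of _ y] exI[of _ "bs @ [x]"] exI[of _ j]) simp
  next
    case False
    then have "i \<le> offset e xs + Suc (length (e x))"
      using snoc.prems by (simp add: length_enc_list_offset offset_snoc)
    then consider "i = length (enc_list e (xs @ [x]))" | "i - offset e xs \<le> length (e x)"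
      using False by (auto simp: length_enc_list_offset offset_snoc le_Suc_eq)
    then show ?thesis
    proof cases
      case 2
      then show ?thesis using False
        by (intro disjI2 exI[of _ xs] exI[of _ x] exI[of _ "[]"] exI[of _ "i - offset e xs"]) simp
    qed simp
  qed
qed (simp add: enc_list_def)

text \<open>\<open>R\<close> holds the states possible between two elements. From all of them
  \<open>True\<close> leads to the same state \<open>s\<close> and \<open>False\<close> to the same
  \<open>t\<close>, so the automaton needs no memory of the elements already read.\<close>

lemma fold_enc_list:
  assumes "\<And>q. q \<in> R \<Longrightarrow> f q True = s" "\<And>q. q \<in> R \<Longrightarrow> f q False = t" "\<And>x. foldl f s (e x) \<in> R" "q \<in> R"
  shows "foldl f q (concat (map (\<lambda>x. True # e x) xs)) \<in> R" "foldl f q (enc_list e xs) = t"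
    "foldl f q (take (offset e as) (enc_list e (as @ x # bs))) = s"
proof -
  show R: "foldl f q (concat (map (\<lambda>x. True # e x) xs)) \<in> R" for xs
    using assms(4) by (induction xs arbitrary: q) (auto simp: assms(1,3))
  show "foldl f q (enc_list e xs) = t"
    using R[of xs] assms(2) by (simp add: enc_list_def)
  show "foldl f q (take (offset e as) (enc_list e (as @ x # bs))) = s"
    using R[of as] assms(1) by (simp add: enc_list_split offset_def)
qed

subsection \<open>Vertices, edges and hypergraphs\<close>

context
  fixes h :: nat
  assumes h: "h = 0 \<or> h = 8"
begin

lemma parse_vertex_step:
  "q \<in> {h + 4, h + 5, h + 6} \<Longrightarrow> parse_bit q True = h + 7"
  "q \<in> {h + 4, h + 5, h + 6} \<Longrightarrow> parse_bit q False = h + 3"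
  "foldl parse_bit (h + 7) [b] \<in> {h + 4, h + 5, h + 6}"
  using h by (auto simp: parse_bit_def)

lemma parse_vertex: "foldl parse_bit (h + 4) (enc_vertex v) = h + 3"
  unfolding enc_vertex_def by (rule fold_enc_list[where R = "{h + 4, h + 5, h + 6}"]) (use parse_vertex_step in auto)

lemma parse_in_vertex:
  assumes "0 < i" "i < length (enc_vertex v)"
  shows "foldl parse_bit (h + 4) (take i (enc_vertex v)) \<in> {h + 5, h + 6, h + 7}"
proof -
  let ?e = "\<lambda>b :: bool. [b]"
  from assms obtain as x bs j where s: "binary v = as @ x # bs" "i = offset ?e as + j" "j \<le> 1"
    using enc_list_position[of i ?e "binary v"] unfolding enc_vertex_def by auto
  have "take i (enc_vertex v) = take (offset ?e as) (enc_vertex v) @ take j (drop (offset ?e as) (enc_vertex v))"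
    using s by (simp add: take_add)
  also have "take j (drop (offset ?e as) (enc_vertex v)) = take j [x]"
    using drop_offset[of ?e as x bs "[]"] s by (cases j) (auto simp: enc_vertex_def)
  finally have "foldl parse_bit (h + 4) (take i (enc_vertex v)) = foldl parse_bit (h + 7) (take j [x])"
    using fold_enc_list(3)[of "{h + 4, h + 5, h + 6}" parse_bit "h + 7" "h + 3" ?e "h + 4" as x bs]
      parse_vertex_step s(1) by (simp add: enc_vertex_def)
  then show ?thesis using s(3) h by (cases j) (auto simp: parse_bit_def split: if_splits)
qed

lemma parse_edge_step:
  "q \<in> {h + 2, h + 3} \<Longrightarrow> parse_bit q True = h + 4"
  "q \<in> {h + 2, h + 3} \<Longrightarrow> parse_bit q False = h + 1"
  "foldl parse_bit (h + 4) (enc_vertex v) \<in> {h + 2, h + 3}"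
  using h parse_vertex by (auto simp: parse_bit_def)

lemma parse_edge: "foldl parse_bit (h + 2) (enc_edge vs) = h + 1"
  unfolding enc_edge_def by (rule fold_enc_list[where R = "{h + 2, h + 3}"]) (use parse_edge_step in auto)

lemma parse_at_vertex:
  assumes "vs = as @ v # bs" "j \<le> length (enc_vertex v)"
  shows "foldl parse_bit (h + 2) (take (offset enc_vertex as + j) (enc_edge vs)) =
    foldl parse_bit (h + 4) (take j (enc_vertex v))"
proof -
  have "foldl parse_bit (h + 2) (take (offset enc_vertex as) (enc_edge vs)) = h + 4"
    using fold_enc_list(3)[of "{h + 2, h + 3}" parse_bit "h + 4" "h + 1" enc_vertex "h + 2" as v bs]
      parse_edge_step assms(1) by (simp add: enc_edge_def)
  moreover have "take j (drop (offset enc_vertex as) (enc_edge vs)) = take j (enc_vertex v)"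
    using drop_offset[of enc_vertex as v bs "[]"] assms by (simp add: enc_edge_def)
  ultimately show ?thesis by (simp add: take_add)
qed

lemma parse_in_edge:
  assumes "0 < i" "i < length (enc_edge vs)"
  shows "\<exists>as v bs j. vs = as @ v # bs \<and> i = offset enc_vertex as + j \<and> j \<le> length (enc_vertex v)"
  using enc_list_position[of i enc_vertex vs] assms by (auto simp: enc_edge_def)

lemma parse_hypergraph_step:
  "q \<in> {h, h + 1} \<Longrightarrow> parse_bit q True = h + 2"
  "q \<in> {h, h + 1} \<Longrightarrow> parse_bit q False = h + 8"
  "foldl parse_bit (h + 2) (enc_edge vs) \<in> {h, h + 1}"
  using h parse_edge by (auto simp: parse_bit_def)

lemma parse_hypergraph: "foldl parse_bit h (enc_hypergraph es) = h + 8"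
  unfolding enc_hypergraph_def
  by (rule fold_enc_list[where R = "{h, h + 1}"]) (use parse_hypergraph_step in auto)

lemma parse_at_edge:
  assumes "es = as @ x # bs" "j \<le> length (enc_edge x)"
  shows "foldl parse_bit h (take (offset enc_edge as + j) (enc_hypergraph es)) =
    foldl parse_bit (h + 2) (take j (enc_edge x))"
proof -
  have "foldl parse_bit h (take (offset enc_edge as) (enc_hypergraph es)) = h + 2"
    using fold_enc_list(3)[of "{h, h + 1}" parse_bit "h + 2" "h + 8" enc_edge h as x bs]
      parse_hypergraph_step assms(1) by (simp add: enc_hypergraph_def)
  moreover have "take j (drop (offset enc_edge as) (enc_hypergraph es)) = take j (enc_edge x)"
    using drop_offset[of enc_edge as x bs "[]"] assms by (simp add: enc_hypergraph_def)
  ultimately show ?thesis by (simp add: take_add)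
qed

end

text \<open>The states entered by reading \<open>True\<close>. The label of a position thus reveals
  the bit in front of it, and formulas can compare and copy bits of the input.\<close>

definition true_labels :: "nat set" where "true_labels = {2, 4, 6, 7, 10, 12, 14, 15}"

section \<open>Positions of edges and vertices in an encoded instance\<close>

locale parsed_instance =
  fixes gs hs :: "nat list list" and w :: "bool list"
  assumes w: "w = enc_instance gs hs"
begin

definition part :: "nat \<Rightarrow> nat list list" where
  "part h = (if h = 0 then gs else hs)"

definition base :: "nat \<Rightarrow> nat" where
  "base h = (if h = 0 then 0 else length (enc_hypergraph gs))"

text \<open>A position counts the bits already read, so \<open>p\<close> lies just behind the
  \<open>True\<close> that announces the edge. \<open>h\<close> is the label offset of the
  hypergraph.\<close>

definition edge_at :: "nat \<Rightarrow> nat \<Rightarrow> nat list \<Rightarrow> bool" where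
  "edge_at h p x \<longleftrightarrow> (h = 0 \<or> h = 8) \<and> (\<exists>as bs. part h = as @ x # bs \<and> p = base h + offset enc_edge as)"

definition vertex_at :: "nat \<Rightarrow> nat \<Rightarrow> nat \<Rightarrow> nat \<Rightarrow> bool" where
  "vertex_at h p u v \<longleftrightarrow> (\<exists>x as bs. edge_at h p x \<and> x = as @ v # bs \<and> u = p + offset enc_vertex as)"

lemma base_le: "base h + length (enc_hypergraph (part h)) \<le> length w"
  by (simp add: base_def part_def w enc_instance_def)

lemma drop_base: "\<exists>r. drop (base h) w = enc_hypergraph (part h) @ r"
  by (auto simp: base_def part_def w enc_instance_def)

lemma label_base:
  assumes "h = 0 \<or> h = 8" "i \<le> length (enc_hypergraph (part h))"
  shows "label w (base h + i) = foldl parse_bit h (take i (enc_hypergraph (part h)))"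
proof -
  have "label w (base h) = h"
    using assms(1) parse_hypergraph[of 0 gs]
    by (auto simp: base_def w enc_instance_def label_take)
  moreover obtain r where "drop (base h) w = enc_hypergraph (part h) @ r" using drop_base by blast
  moreover have "base h + i \<le> length w" using base_le[of h] assms(2) by simp
  ultimately show ?thesis using label_add[of "base h" i w] assms(2) by simp
qed

lemma edge_at_label:
  assumes e: "edge_at h p x" and j: "j \<le> length (enc_edge x)"
  shows "label w (p + j) = foldl parse_bit (h + 2) (take j (enc_edge x))" (is ?A)
    and "p + length (enc_edge x) < length w" (is ?B)
    and "0 < p" and "\<exists>r. drop p w = enc_edge x @ r" (is ?C)
proof -
  obtain as bs where ab: "part h = as @ x # bs" "p = base h + offset enc_edge as" and h: "h = 0 \<or> h = 8"
    using e unfolding edge_at_def by blast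
  have len: "offset enc_edge as + length (enc_edge x) < length (enc_hypergraph (part h))"
    by (simp add: ab(1) enc_hypergraph_def enc_list_split offset_def) (simp add: enc_list_def)
  then have "offset enc_edge as + j \<le> length (enc_hypergraph (part h))" using j by simp
  from label_base[OF h this] show ?A
    using parse_at_edge[OF h ab(1) j] by (simp add: ab(2) add.assoc)
  show ?B using len base_le[of h] ab(2) by simp
  show "0 < p" using ab(2) by (simp add: offset_def)
  obtain r where r: "drop (base h) w = enc_hypergraph (part h) @ r" using drop_base by blast
  have "drop p w = drop (offset enc_edge as) (drop (base h) w)" by (simp add: ab(2) add.commute)
  then show ?C using drop_offset[of enc_edge as x bs r] unfolding r ab(1) enc_hypergraph_def by auto
qed

lemma edge_at_part: "edge_at h p x \<Longrightarrow> h = 0 \<or> h = 8" by (simp add: edge_at_def)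

lemma vertex_at_part: "vertex_at h p u v \<Longrightarrow> h = 0 \<or> h = 8"
  by (auto simp: vertex_at_def edge_at_def)

lemma vertex_at_label:
  assumes v: "vertex_at h p u v" and j: "j \<le> length (enc_vertex v)"
  shows "label w (u + j) = foldl parse_bit (h + 4) (take j (enc_vertex v))" (is ?A)
    and "u + length (enc_vertex v) < length w" (is ?B)
    and "p < u" and "\<exists>r. drop u w = enc_vertex v @ r" (is ?C)
proof -
  obtain x as bs where e: "edge_at h p x" and ab: "x = as @ v # bs" "u = p + offset enc_vertex as"
    using v unfolding vertex_at_def by blast
  have len: "offset enc_vertex as + length (enc_vertex v) < length (enc_edge x)"
    by (simp add: ab(1) enc_edge_def enc_list_split offset_def) (simp add: enc_list_def)
  then have le: "offset enc_vertex as + j \<le> length (enc_edge x)" using j by simp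
  show ?A
    using edge_at_label(1)[OF e le] parse_at_vertex[OF edge_at_part[OF e] ab(1) j]
    by (simp add: ab(2) add.assoc)
  show ?B using edge_at_label(2)[OF e le] len ab(2) by simp
  show "p < u" using ab(2) by (simp add: offset_def)
  obtain r where r: "drop p w = enc_edge x @ r" using edge_at_label(4)[OF e le] by blast
  have "drop u w = drop (offset enc_vertex as) (drop p w)" by (simp add: ab(2) add.commute)
  then show ?C using drop_offset[of enc_vertex as v bs r] unfolding r ab(1) enc_edge_def by auto
qed

lemma label_edge_start: "edge_at h p x \<Longrightarrow> label w p = h + 2"
  using edge_at_label(1)[of h p x 0] by simp

lemma label_edge_end: "edge_at h p x \<Longrightarrow> label w (p + length (enc_edge x)) = h + 1"
  using edge_at_label(1)[of h p x "length (enc_edge x)"] parse_edge edge_at_part by simp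

lemma label_vertex_start: "vertex_at h p u v \<Longrightarrow> label w u = h + 4"
  using vertex_at_label(1)[of h p u v 0] by simp

lemma label_vertex_end: "vertex_at h p u v \<Longrightarrow> label w (u + length (enc_vertex v)) = h + 3"
  using vertex_at_label(1)[of h p u v "length (enc_vertex v)"] parse_vertex vertex_at_part by simp

lemma label_in_vertex:
  "vertex_at h p u v \<Longrightarrow> u < i \<Longrightarrow> i < u + length (enc_vertex v) \<Longrightarrow> label w i \<in> {h + 5, h + 6, h + 7}"
  using vertex_at_label(1)[of h p u v "i - u"] parse_in_vertex[of h "i - u" v] vertex_at_part by simp

lemma edge_position:
  assumes e: "edge_at h p x" and i: "p < i" "i < p + length (enc_edge x)"
  shows "\<exists>u v. vertex_at h p u v \<and> u \<le> i \<and> i \<le> u + length (enc_vertex v)"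
proof -
  obtain as v bs j where a: "x = as @ v # bs" "i - p = offset enc_vertex as + j" "j \<le> length (enc_vertex v)"
  proof -
    have "0 < i - p" "i - p < length (enc_edge x)" using i by auto
    from that parse_in_edge[of h "i - p" x] edge_at_part[OF e] this show thesis by blast
  qed
  then have "vertex_at h p (p + offset enc_vertex as) v" using e unfolding vertex_at_def by blast
  then show ?thesis using a i by (intro exI[of _ "p + offset enc_vertex as"] exI[of _ v]) auto
qed

lemma label_in_edge:
  assumes "edge_at h p x" "p < i" "i < p + length (enc_edge x)"
  shows "label w i \<in> {h + 3, h + 4, h + 5, h + 6, h + 7} \<and> (label w i = h + 4 \<longrightarrow> (\<exists>v. vertex_at h p i v))"
proof -
  obtain u v where v: "vertex_at h p u v" "u \<le> i" "i \<le> u + length (enc_vertex v)"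
    using edge_position[OF assms] by blast
  then consider "i = u" | "i = u + length (enc_vertex v)" | "u < i" "i < u + length (enc_vertex v)" by linarith
  then show ?thesis
  proof cases
    case 3
    then show ?thesis using label_in_vertex[OF v(1) 3] by auto
  qed (use label_vertex_start[OF v(1)] label_vertex_end[OF v(1)] v(1) in auto)
qed

lemma position_cases:
  assumes "0 < i" "i \<le> length w"
  shows "i = length (enc_hypergraph gs) \<and> label w i = 8 \<or> i = length w \<and> label w i = 16 \<or>
    (\<exists>h p x. edge_at h p x \<and> p \<le> i \<and> i \<le> p + length (enc_edge x))"
proof -
  have sub: "i = length (enc_hypergraph gs) \<and> label w i = 8 \<or> i = length w \<and> label w i = 16 \<or>
    (\<exists>h p x. edge_at h p x \<and> p \<le> i \<and> i \<le> p + length (enc_edge x))"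
    if h: "h = 0 \<or> h = 8" and j: "0 < j" "j \<le> length (enc_hypergraph (part h))" "i = base h + j" for h j
  proof -
    consider "j = length (enc_hypergraph (part h))" |
        "\<exists>as x bs k. part h = as @ x # bs \<and> j = offset enc_edge as + k \<and> k \<le> length (enc_edge x)"
      using enc_list_position[of j enc_edge "part h"] j by (auto simp: enc_hypergraph_def)
    then show ?thesis
    proof cases
      case 1
      have "label w i = h + 8" using label_base[OF h j(2)] parse_hypergraph[OF h] j(3) 1 by simp
      then show ?thesis using h 1 j(3) by (auto simp: base_def part_def w enc_instance_def)
    next
      case 2
      then obtain as x bs k where a: "part h = as @ x # bs" "j = offset enc_edge as + k" "k \<le> length (enc_edge x)"
        by blast
      then have "edge_at h (base h + offset enc_edge as) x" using h unfolding edge_at_def by blast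
      then show ?thesis using a(2,3) j(3)
        by (intro disjI2 exI[of _ h] exI[of _ "base h + offset enc_edge as"] exI[of _ x]) simp
    qed
  qed
  show ?thesis
  proof (cases "i \<le> length (enc_hypergraph gs)")
    case True
    then show ?thesis using sub[of 0 i] assms by (simp add: base_def part_def)
  next
    case False
    then show ?thesis using sub[of 8 "i - length (enc_hypergraph gs)"] assms
      by (simp add: base_def part_def w enc_instance_def)
  qed
qed

text \<open>The classification covers all natural numbers, so a label determines what starts at a
  position. The nontrivial directions of \<open>label_edge_iff\<close>,
  \<open>label_vertex_iff\<close> and \<open>label_end_iff\<close> are read off from it.\<close>

lemma label_cases:
  "i = 0 \<and> label w i = 0 \<or> length w < i \<and> label w i = 17 \<or>
   i = length (enc_hypergraph gs) \<and> label w i = 8 \<or> i = length w \<and> label w i = 16 \<or>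
   (\<exists>h p x. edge_at h p x \<and> (i = p \<and> label w i = h + 2 \<or> i = p + length (enc_edge x) \<and> label w i = h + 1 \<or>
     p < i \<and> i < p + length (enc_edge x) \<and> label w i \<in> {h + 3, h + 4, h + 5, h + 6, h + 7} \<and>
     (label w i = h + 4 \<longrightarrow> (\<exists>v. vertex_at h p i v))))"
proof (cases "0 < i \<and> i \<le> length w")
  case True
  consider "i = length (enc_hypergraph gs) \<and> label w i = 8" | "i = length w \<and> label w i = 16" |
    "\<exists>h p x. edge_at h p x \<and> p \<le> i \<and> i \<le> p + length (enc_edge x)"
    using position_cases True by blast
  then show ?thesis
  proof cases
    case 3
    then obtain h p x where e: "edge_at h p x" "p \<le> i" "i \<le> p + length (enc_edge x)" by blast
    consider "i = p" | "i = p + length (enc_edge x)" | "p < i" "i < p + length (enc_edge x)" using e by linarith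
    then show ?thesis
      using e(1) label_edge_start[OF e(1)] label_edge_end[OF e(1)] label_in_edge[OF e(1)] by cases blast+
  qed blast+
qed (auto simp: label_beyond)

lemma label_edge_iff:
  assumes "h = 0 \<or> h = 8" shows "label w p = h + 2 \<longleftrightarrow> (\<exists>x. edge_at h p x)"
proof
  assume l: "label w p = h + 2"
  from label_cases[of p] show "\<exists>x. edge_at h p x"
  proof (elim disjE exE conjE)
    fix h' q x assume "edge_at h' q x" "p = q" "label w p = h' + 2"
    then show ?thesis using l by auto
  qed (use l assms in \<open>auto dest!: edge_at_part\<close>)
qed (use label_edge_start in auto)

lemma label_vertex_iff:
  assumes "h = 0 \<or> h = 8" shows "label w u = h + 4 \<longleftrightarrow> (\<exists>p v. vertex_at h p u v)"
proof
  assume l: "label w u = h + 4"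
  from label_cases[of u] show "\<exists>p v. vertex_at h p u v"
  proof (elim disjE exE conjE)
    fix h' p x assume e: "edge_at h' p x" and l': "label w u \<in> {h' + 3, h' + 4, h' + 5, h' + 6, h' + 7}"
      and v: "label w u = h' + 4 \<longrightarrow> (\<exists>v. vertex_at h' p u v)"
    have "h' = h" using l l' assms edge_at_part[OF e] by auto
    then show ?thesis using v l by blast
  qed (use l assms in \<open>auto dest!: edge_at_part\<close>)
qed (use label_vertex_start in auto)

lemma label_end_iff: "label w p = 16 \<longleftrightarrow> p = length w"
proof
  assume l: "label w p = 16"
  from label_cases[of p] show "p = length w"
    by (elim disjE exE conjE) (use l in \<open>auto dest!: edge_at_part\<close>)
next
  have "label w (base 8 + length (enc_hypergraph (part 8))) = 16"
    using label_base[of 8 "length (enc_hypergraph (part 8))"] parse_hypergraph[of 8] by simp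
  then show "label w p = 16" if "p = length w"
    using that by (simp add: base_def part_def w enc_instance_def)
qed

lemma label_less_16: "i < length w \<Longrightarrow> label w i < 16"
  using label_cases[of i] by (elim disjE exE conjE) (auto dest!: edge_at_part)

lemma true_label:
  assumes "i < length w" shows "label w (Suc i) \<in> true_labels \<longleftrightarrow> w ! i"
proof -
  have q: "label w i < 16" using label_less_16[OF assms] .
  have "label w (Suc i) = parse_bit (label w i) (w ! i)"
    using assms by (simp add: input_at_def parse_def)
  moreover have "parse_bit q b \<in> true_labels \<longleftrightarrow> b" if "q < 16" for q b
  proof -
    have "8 * (q div 8) = 0 \<or> 8 * (q div 8) = 8" using that by presburger
    then obtain h where h: "8 * (q div 8) = h" "h = 0 \<or> h = 8" by blast
    show ?thesis using that h(2) unfolding parse_bit_def Let_def h(1) by (auto simp: true_labels_def)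
  qed
  ultimately show ?thesis using q by simp
qed

lemma vertex_at_bits:
  assumes v: "vertex_at h p u v" and j: "j < length (enc_vertex v)"
  shows "label w (u + Suc j) \<in> true_labels \<longleftrightarrow> enc_vertex v ! j"
proof -
  obtain r where r: "drop u w = enc_vertex v @ r" using vertex_at_label(4)[OF v le0] by blast
  have "u + j < length w" using vertex_at_label(2)[OF v le0] j by simp
  moreover have "w ! (u + j) = enc_vertex v ! j"
    using arg_cong[OF r, of "\<lambda>l. l ! j"] j calculation by (simp add: nth_append)
  ultimately show ?thesis using true_label[of "u + j"] by simp
qed

text \<open>The input from \<open>u\<close> on begins with the code of the vertex, and these codes
  are prefix-free.\<close>

lemma vertex_at_unique: "vertex_at h p u v \<Longrightarrow> vertex_at h' p' u v' \<Longrightarrow> v = v'"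
proof -
  assume "vertex_at h p u v" "vertex_at h' p' u v'"
  then obtain r r' where "drop u w = enc_vertex v @ r" "drop u w = enc_vertex v' @ r'"
    using vertex_at_label(4)[OF _ le0] by meson
  then show "v = v'" using enc_vertex_prefix_free[of v r v' r'] by simp
qed

lemma edge_at_unique: "edge_at h p x \<Longrightarrow> edge_at h' p x' \<Longrightarrow> x = x'"
proof -
  assume "edge_at h p x" "edge_at h' p x'"
  then obtain r r' where "drop p w = enc_edge x @ r" "drop p w = enc_edge x' @ r'"
    using edge_at_label(4)[OF _ le0] by meson
  then show "x = x'" using enc_edge_prefix_free[of x r x' r'] by simp
qed

end

section \<open>Defining a new transversal\<close>

text \<open>
  \<open>N\<close> bounds all quantifiers and \<open>L\<close> labels the positions of the input.  A vertex is represented by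
  any position where it starts, and an edge by the position where it starts.
\<close>

definition occurs :: "nat \<Rightarrow> (nat \<Rightarrow> nat) \<Rightarrow> nat \<Rightarrow> nat \<Rightarrow> bool" where
  "occurs N L p u \<longleftrightarrow> p < u \<and> L u \<in> {4, 12} \<and> \<not> (\<exists>j<N. p < j \<and> j < u \<and> L j \<in> {1, 9})"

text \<open>\<open>k\<close> is the distance from \<open>u\<close> to some end of a vertex, and the
  bits behind \<open>u\<close> and \<open>v\<close> agree up to it; names are prefix-free, so this
  means equality. Differences are avoided because formulas only have sums, and
  \<open>\<not> k < j\<close> stands for the non-strict comparison they lack.\<close>

definition same_vertex :: "nat \<Rightarrow> (nat \<Rightarrow> nat) \<Rightarrow> nat \<Rightarrow> nat \<Rightarrow> bool" where
  "same_vertex N L u v \<longleftrightarrow> (\<exists>k<N. (\<exists>y<N. u + k = y \<and> L y \<in> {3, 11}) \<and>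
     \<not> (\<exists>j<N. \<not> k < j \<and> (\<exists>a<N. \<exists>b<N. u + j = a \<and> v + j = b \<and>
        (L a \<in> true_labels) \<noteq> (L b \<in> true_labels))))"

text \<open>The hypergraph in which a position lies tells its kind: label 12, in \<open>H\<close>,
  names a single vertex, and \<open>H\<close> covers \<open>V\<close>; label 4, in \<open>G\<close>,
  names the rest of the edge to which the occurrence belongs. All other numbers exclude
  nothing.\<close>

definition excluded :: "nat \<Rightarrow> (nat \<Rightarrow> nat) \<Rightarrow> nat \<Rightarrow> nat \<Rightarrow> nat \<Rightarrow> nat \<Rightarrow> bool" where
  "excluded N L \<sigma> M B p \<longleftrightarrow> (\<exists>x<N. x \<in> items N \<sigma> M B \<and>
     (L x = 12 \<and> same_vertex N L x p \<or>
      L x = 4 \<and> \<not> same_vertex N L x p \<and>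
        (\<exists>e<N. \<exists>u<N. L e = 2 \<and> occurs N L e x \<and> occurs N L e u \<and> same_vertex N L u p)))"

definition compatible_edge :: "nat \<Rightarrow> (nat \<Rightarrow> nat) \<Rightarrow> nat \<Rightarrow> nat \<Rightarrow> nat \<Rightarrow> nat \<Rightarrow> bool" where
  "compatible_edge N L \<sigma> M B e \<longleftrightarrow>
     L e = 10 \<and> \<not> (\<exists>u<N. occurs N L e u \<and> excluded N L \<sigma> M B u)"

definition in_edge :: "nat \<Rightarrow> (nat \<Rightarrow> nat) \<Rightarrow> nat \<Rightarrow> nat \<Rightarrow> bool" where
  "in_edge N L e p \<longleftrightarrow> (\<exists>u<N. occurs N L e u \<and> same_vertex N L u p)"

text \<open>\<open>mod N\<close> mirrors the semantics of \<open>Count\<close>. On encoded instances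
  the counts are below \<open>N\<close>, as different edges start at different positions.\<close>

definition in_transversal :: "nat \<Rightarrow> (nat \<Rightarrow> nat) \<Rightarrow> nat \<Rightarrow> nat \<Rightarrow> nat \<Rightarrow> nat \<Rightarrow> bool" where
  "in_transversal N L \<sigma> M B p \<longleftrightarrow> \<not> excluded N L \<sigma> M B p \<and>
     card {e. e < N \<and> compatible_edge N L \<sigma> M B e \<and> \<not> in_edge N L e p} mod N \<le>
     card {e. e < N \<and> compatible_edge N L \<sigma> M B e \<and> in_edge N L e p} mod N"

definition good :: "nat \<Rightarrow> (nat \<Rightarrow> nat) \<Rightarrow> nat \<Rightarrow> nat \<Rightarrow> nat \<Rightarrow> bool" where
  "good N L \<sigma> M B \<longleftrightarrow>
     \<not> (\<exists>e<N. L e = 2 \<and> \<not> (\<exists>u<N. occurs N L e u \<and> in_transversal N L \<sigma> M B u)) \<and>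
     \<not> (\<exists>e<N. L e = 10 \<and> \<not> (\<exists>u<N. occurs N L e u \<and> \<not> in_transversal N L \<sigma> M B u))"

definition lex_less :: "nat \<Rightarrow> nat \<Rightarrow> nat \<Rightarrow> nat \<Rightarrow> nat \<Rightarrow> nat \<Rightarrow> bool" where
  "lex_less a b c a' b' c' \<longleftrightarrow> a < a' \<or> \<not> a' < a \<and> (b < b' \<or> \<not> b' < b \<and> c < c')"

text \<open>The bits of the output are decided by separate evaluations, which all have to speak of
  the same transversal; the lexicographically least certificate is a canonical one.\<close>

definition chosen :: "nat \<Rightarrow> (nat \<Rightarrow> nat) \<Rightarrow> nat \<Rightarrow> nat \<Rightarrow> nat \<Rightarrow> bool" where
  "chosen N L \<sigma> M B \<longleftrightarrow> good N L \<sigma> M B \<and>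
     \<not> (\<exists>\<sigma>'<N. \<exists>M'<N. \<exists>B'<N. good N L \<sigma>' M' B' \<and> lex_less \<sigma>' M' B' \<sigma> M B)"

text \<open>A vertex is written at its first occurrence in \<open>H\<close> only, which makes the
  output free of repetitions.\<close>

definition selected :: "nat \<Rightarrow> (nat \<Rightarrow> nat) \<Rightarrow> nat \<Rightarrow> nat \<Rightarrow> nat \<Rightarrow> nat \<Rightarrow> bool" where
  "selected N L \<sigma> M B p \<longleftrightarrow> L p = 12 \<and> in_transversal N L \<sigma> M B p \<and>
     \<not> (\<exists>u<N. u < p \<and> L u = 12 \<and> same_vertex N L u p)"

text \<open>Both ends count. Position \<open>p\<close> itself has label 12, which is a true label,
  and so contributes the \<open>True\<close> that announces the vertex in the output.\<close>

definition in_vertex :: "nat \<Rightarrow> (nat \<Rightarrow> nat) \<Rightarrow> nat \<Rightarrow> nat \<Rightarrow> bool" where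
  "in_vertex N L p q \<longleftrightarrow> \<not> q < p \<and> \<not> (\<exists>j<N. \<not> j < p \<and> j < q \<and> L j \<in> {3, 11})"

definition write_pos :: "nat \<Rightarrow> (nat \<Rightarrow> nat) \<Rightarrow> nat \<Rightarrow> nat \<Rightarrow> bool" where
  "write_pos N L p q \<longleftrightarrow> (\<exists>\<sigma><N. \<exists>M<N. \<exists>B<N.
     chosen N L \<sigma> M B \<and> selected N L \<sigma> M B p \<and> in_vertex N L p q)"

subsection \<open>Formulas\<close>

text \<open>Counting is modulo \<open>2 ^ W\<close>; the second conjunct is for the case that all numbers satisfy \<open>\<phi>\<close>.\<close>

definition Exists :: "nat \<Rightarrow> form \<Rightarrow> form" where
  "Exists x \<phi> = Neg (Conj (Count x \<phi> (Less 0 0)) (Count x (Conj (Less 0 x) \<phi>) (Less 0 0)))"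

lemma eval_Exists [simp]:
  assumes "e 0 = 0" "x \<noteq> 0" "0 < W"
  shows "eval w W e (Exists x \<phi>) \<longleftrightarrow> (\<exists>a<2 ^ W. eval w W (e(x := a)) \<phi>)"
proof -
  let ?P = "\<lambda>a. eval w W (e(x := a)) \<phi>"
  have N: "1 < (2 :: nat) ^ W" using assms(3) by (intro one_less_power) auto
  have le: "card {a. a < 2 ^ W \<and> ?P a} \<le> 2 ^ W"
    using card_mono[of "{..<2 ^ W}" "{a. a < 2 ^ W \<and> ?P a}"] by auto
  have e: "eval w W e (Exists x \<phi>) \<longleftrightarrow> \<not> (card {a. a < 2 ^ W \<and> ?P a} mod 2 ^ W = 0 \<and>
      card {a. a < 2 ^ W \<and> 0 < a \<and> ?P a} mod 2 ^ W = 0)"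
    using assms by (simp add: Exists_def)
  show ?thesis
  proof (cases "card {a. a < 2 ^ W \<and> ?P a} = 2 ^ W")
    case True
    then have "{a. a < 2 ^ W \<and> ?P a} = {..<2 ^ W}"
      by (intro card_subset_eq) auto
    then have all: "?P a" if "a < 2 ^ W" for a using that by blast
    have "{a. a < 2 ^ W \<and> 0 < a \<and> ?P a} = {0<..<2 ^ W}" using all by auto
    then have "card {a. a < 2 ^ W \<and> 0 < a \<and> ?P a} mod 2 ^ W \<noteq> 0" using N by simp
    then show ?thesis using e all[of 0] N by (metis less_trans zero_less_one)
  next
    case False
    then have lt: "card {a. a < 2 ^ W \<and> ?P a} mod 2 ^ W = card {a. a < 2 ^ W \<and> ?P a}" using le by simp
    show ?thesis
    proof (cases "\<exists>a<2 ^ W. ?P a")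
      case True
      then have "card {a. a < 2 ^ W \<and> ?P a} \<noteq> 0" by auto
      then show ?thesis using e lt True by simp
    next
      case False
      then have "{a. a < 2 ^ W \<and> ?P a} = {}" "{a. a < 2 ^ W \<and> 0 < a \<and> ?P a} = {}" by blast+
      then show ?thesis using False unfolding e by (simp only: card.empty mod_0) blast
    qed
  qed
qed

lemma wff_Exists [simp]: "0 \<in> S \<Longrightarrow> wff b S (Exists x \<phi>) \<longleftrightarrow> x \<notin> S \<and> x < b \<and> wff b (insert x S) \<phi>"
  by (auto simp: Exists_def)

definition Disj :: "form \<Rightarrow> form \<Rightarrow> form" where
  "Disj \<phi> \<psi> = Neg (Conj (Neg \<phi>) (Neg \<psi>))"

lemma eval_Disj [simp]: "eval w W e (Disj \<phi> \<psi>) \<longleftrightarrow> eval w W e \<phi> \<or> eval w W e \<psi>"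
  by (simp add: Disj_def)

lemma wff_Disj [simp]: "wff b S (Disj \<phi> \<psi>) \<longleftrightarrow> wff b S \<phi> \<and> wff b S \<psi>"
  by (simp add: Disj_def)

abbreviation Lab :: "nat set \<Rightarrow> nat \<Rightarrow> form" where "Lab \<equiv> Dfa parse"

text \<open>Bound variables are numbered globally, from 4 to 31, and a formula binds none of the
  variables bound inside its parts while they are in scope. The disjointness hypotheses below record
  these ranges. Variables 0 and 1 hold the constants, so \<open>MulAdd 13 1 1 b\<close> says
  \<open>c + 1 = B\<close> and \<open>MulAdd 10 11 0 m\<close> says
  \<open>P * P' = M\<close>.\<close>

definition Items :: "nat \<Rightarrow> nat \<Rightarrow> nat \<Rightarrow> nat \<Rightarrow> form" where
  "Items s m b x = Conj (Less x b) (Exists 10 (Exists 11 (Exists 12 (Exists 13 (Exists 14 (Exists 15 (Exists 16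
     (Conj (MulAdd 10 11 0 m) (Conj (MulAdd 13 1 1 b) (Conj (MulAdd 12 13 1 10)
     (Conj (MulAdd 14 b x 15) (Conj (MulAdd 15 10 16 s) (Less 16 10)))))))))))))"

definition Occurs :: "nat \<Rightarrow> nat \<Rightarrow> form" where
  "Occurs p u = Conj (Less p u) (Conj (Lab {4, 12} u)
     (Neg (Exists 17 (Conj (Less p 17) (Conj (Less 17 u) (Lab {1, 9} 17))))))"

definition Same :: "nat \<Rightarrow> nat \<Rightarrow> form" where
  "Same u v = Exists 18 (Conj (Exists 19 (Conj (MulAdd 1 u 18 19) (Lab {3, 11} 19)))
     (Neg (Exists 20 (Conj (Neg (Less 18 20)) (Exists 21 (Exists 22 (Conj (MulAdd 1 u 20 21) (Conj (MulAdd 1 v 20 22)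
       (Disj (Conj (Lab true_labels 21) (Neg (Lab true_labels 22)))
             (Conj (Lab true_labels 22) (Neg (Lab true_labels 21))))))))))))"

definition Excluded :: "nat \<Rightarrow> nat \<Rightarrow> nat \<Rightarrow> nat \<Rightarrow> form" where
  "Excluded s m b p = Exists 23 (Conj (Items s m b 23)
     (Disj (Conj (Lab {12} 23) (Same 23 p))
       (Conj (Lab {4} 23) (Conj (Neg (Same 23 p)) (Exists 24 (Exists 25 (Conj (Lab {2} 24) (Conj (Occurs 24 23)
         (Conj (Occurs 24 25) (Same 25 p))))))))))"

definition Compatible :: "nat \<Rightarrow> nat \<Rightarrow> nat \<Rightarrow> nat \<Rightarrow> form" where
  "Compatible s m b e = Conj (Lab {10} e) (Neg (Exists 26 (Conj (Occurs e 26) (Excluded s m b 26))))"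

definition In_edge :: "nat \<Rightarrow> nat \<Rightarrow> form" where
  "In_edge e p = Exists 27 (Conj (Occurs e 27) (Same 27 p))"

definition In_transversal :: "nat \<Rightarrow> nat \<Rightarrow> nat \<Rightarrow> nat \<Rightarrow> form" where
  "In_transversal s m b p = Conj (Neg (Excluded s m b p))
     (Count 28 (Conj (Compatible s m b 28) (Neg (In_edge 28 p))) (Conj (Compatible s m b 28) (In_edge 28 p)))"

definition Good :: "nat \<Rightarrow> nat \<Rightarrow> nat \<Rightarrow> form" where
  "Good s m b = Conj
     (Neg (Exists 29 (Conj (Lab {2} 29) (Neg (Exists 30 (Conj (Occurs 29 30) (In_transversal s m b 30)))))))
     (Neg (Exists 29 (Conj (Lab {10} 29) (Neg (Exists 30 (Conj (Occurs 29 30) (Neg (In_transversal s m b 30))))))))"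

definition Chosen :: form where
  "Chosen = Conj (Good 4 5 6) (Neg (Exists 7 (Exists 8 (Exists 9 (Conj (Good 7 8 9)
     (Disj (Less 7 4) (Conj (Neg (Less 4 7)) (Disj (Less 8 5) (Conj (Neg (Less 5 8)) (Less 9 6)))))))))) "

definition Write :: form where
  "Write = Exists 4 (Exists 5 (Exists 6 (Conj Chosen (Conj
     (Conj (Lab {12} 2) (Conj (In_transversal 4 5 6 2) (Neg (Exists 31 (Conj (Less 31 2) (Conj (Lab {12} 31) (Same 31 2)))))))
     (Conj (Neg (Less 3 2)) (Neg (Exists 31 (Conj (Neg (Less 31 2)) (Conj (Less 31 3) (Lab {3, 11} 31))))))))))"

definition Write_True :: form where
  "Write_True = Conj Write (Lab true_labels 3)"

text \<open>The second disjunct closes the output list. It applies once, in the row of the end of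
  the input and thus behind all vertices, and only if a good certificate exists; otherwise the
  output stays empty, which is the null value.\<close>

definition Write_False :: form where
  "Write_False = Disj (Conj Write (Neg (Lab true_labels 3)))
     (Conj (Lab {16} 2) (Conj (Neg (Less 0 3)) (Exists 4 (Exists 5 (Exists 6 (Good 4 5 6))))))"

section \<open>Semantics and well-formedness of the formulas\<close>

lemma eval_Items [simp]:
  assumes "0 < W" "e 0 = 0" "e (Suc 0) = 1" "{s, m, b, x} \<inter> {0, 1, 10, 11, 12, 13, 14, 15, 16} = {}"
  shows "eval w W e (Items s m b x) \<longleftrightarrow> e x \<in> items (2 ^ W) (e s) (e m) (e b)"
  using assms by (simp add: Items_def items_def)

lemma wff_Items [simp]:
  assumes "{0, 1, s, m, b, x} \<subseteq> S" "S \<inter> {10, 11, 12, 13, 14, 15, 16} = {}"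
  shows "wff 32 S (Items s m b x)"
  using assms by (simp add: Items_def parse_less)

lemma eval_Occurs [simp]:
  assumes "0 < W" "e 0 = 0" "e (Suc 0) = 1" "{p, u} \<inter> {0, 1, 17} = {}"
  shows "eval w W e (Occurs p u) \<longleftrightarrow> occurs (2 ^ W) (label w) (e p) (e u)"
  using assms by (simp add: Occurs_def occurs_def)

lemma wff_Occurs [simp]:
  assumes "{0, 1, p, u} \<subseteq> S" "S \<inter> {17} = {}"
  shows "wff 32 S (Occurs p u)"
  using assms by (simp add: Occurs_def parse_less)

lemma eval_Same [simp]:
  assumes "0 < W" "e 0 = 0" "e (Suc 0) = 1" "{u, v} \<inter> {0, 1, 18, 19, 20, 21, 22} = {}"
  shows "eval w W e (Same u v) \<longleftrightarrow> same_vertex (2 ^ W) (label w) (e u) (e v)"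
  using assms by (simp add: Same_def same_vertex_def) blast

lemma wff_Same [simp]:
  assumes "{0, 1, u, v} \<subseteq> S" "S \<inter> {18, 19, 20, 21, 22} = {}"
  shows "wff 32 S (Same u v)"
  using assms by (simp add: Same_def parse_less)

lemma eval_Excluded [simp]:
  assumes "0 < W" "e 0 = 0" "e (Suc 0) = 1" "{s, m, b, p} \<inter> {0, 1, 10, 11, 12, 13, 14, 15, 16, 17, 18, 19, 20, 21, 22, 23, 24, 25} = {}"
  shows "eval w W e (Excluded s m b p) \<longleftrightarrow> excluded (2 ^ W) (label w) (e s) (e m) (e b) (e p)"
  using assms by (simp add: Excluded_def excluded_def)

lemma wff_Excluded [simp]:
  assumes "{0, 1, s, m, b, p} \<subseteq> S" "S \<inter> {10, 11, 12, 13, 14, 15, 16, 17, 18, 19, 20, 21, 22, 23, 24, 25} = {}"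
  shows "wff 32 S (Excluded s m b p)"
  using assms by (simp add: Excluded_def parse_less)

lemma eval_Compatible [simp]:
  assumes "0 < W" "e 0 = 0" "e (Suc 0) = 1" "{s, m, b, p} \<inter> {0, 1, 10, 11, 12, 13, 14, 15, 16, 17, 18, 19, 20, 21, 22, 23, 24, 25, 26} = {}"
  shows "eval w W e (Compatible s m b p) \<longleftrightarrow> compatible_edge (2 ^ W) (label w) (e s) (e m) (e b) (e p)"
  using assms by (simp add: Compatible_def compatible_edge_def)

lemma wff_Compatible [simp]:
  assumes "{0, 1, s, m, b, p} \<subseteq> S" "S \<inter> {10, 11, 12, 13, 14, 15, 16, 17, 18, 19, 20, 21, 22, 23, 24, 25, 26} = {}"
  shows "wff 32 S (Compatible s m b p)"
  using assms by (simp add: Compatible_def parse_less)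

lemma eval_In_edge [simp]:
  assumes "0 < W" "e 0 = 0" "e (Suc 0) = 1" "{p, u} \<inter> {0, 1, 17, 18, 19, 20, 21, 22, 23, 24, 25, 26, 27} = {}"
  shows "eval w W e (In_edge p u) \<longleftrightarrow> in_edge (2 ^ W) (label w) (e p) (e u)"
  using assms by (simp add: In_edge_def in_edge_def)

lemma wff_In_edge [simp]:
  assumes "{0, 1, p, u} \<subseteq> S" "S \<inter> {17, 18, 19, 20, 21, 22, 23, 24, 25, 26, 27} = {}"
  shows "wff 32 S (In_edge p u)"
  using assms by (simp add: In_edge_def parse_less)

lemma eval_In_transversal [simp]:
  assumes "0 < W" "e 0 = 0" "e (Suc 0) = 1" "{s, m, b, p} \<inter> {0, 1, 10, 11, 12, 13, 14, 15, 16, 17, 18, 19, 20, 21, 22, 23, 24, 25, 26, 27, 28} = {}"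
  shows "eval w W e (In_transversal s m b p) \<longleftrightarrow> in_transversal (2 ^ W) (label w) (e s) (e m) (e b) (e p)"
  using assms by (simp add: In_transversal_def in_transversal_def)

lemma wff_In_transversal [simp]:
  assumes "{0, 1, s, m, b, p} \<subseteq> S" "S \<inter> {10, 11, 12, 13, 14, 15, 16, 17, 18, 19, 20, 21, 22, 23, 24, 25, 26, 27, 28} = {}"
  shows "wff 32 S (In_transversal s m b p)"
  using assms by (simp add: In_transversal_def parse_less)

lemma eval_Good [simp]:
  assumes "0 < W" "e 0 = 0" "e (Suc 0) = 1" "{s, m, b} \<inter> {0, 1, 10, 11, 12, 13, 14, 15, 16, 17, 18, 19, 20, 21, 22, 23, 24, 25, 26, 27, 28, 29, 30} = {}"
  shows "eval w W e (Good s m b) \<longleftrightarrow> good (2 ^ W) (label w) (e s) (e m) (e b)"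
  using assms by (simp add: Good_def good_def)

lemma wff_Good [simp]:
  assumes "{0, 1, s, m, b} \<subseteq> S" "S \<inter> {10, 11, 12, 13, 14, 15, 16, 17, 18, 19, 20, 21, 22, 23, 24, 25, 26, 27, 28, 29, 30} = {}"
  shows "wff 32 S (Good s m b)"
  using assms by (simp add: Good_def parse_less)

lemma eval_Chosen [simp]:
  assumes "0 < W" "e 0 = 0" "e (Suc 0) = 1"
  shows "eval w W e Chosen \<longleftrightarrow> chosen (2 ^ W) (label w) (e 4) (e 5) (e 6)"
  using assms by (simp add: Chosen_def chosen_def lex_less_def)

lemma eval_Write [simp]:
  assumes "0 < W" "e 0 = 0" "e (Suc 0) = 1"
  shows "eval w W e Write \<longleftrightarrow> write_pos (2 ^ W) (label w) (e 2) (e 3)"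
  using assms by (simp add: Write_def write_pos_def selected_def in_vertex_def)

lemma eval_Write_True:
  assumes "0 < W" "e 0 = 0" "e (Suc 0) = 1"
  shows "eval w W e Write_True \<longleftrightarrow> write_pos (2 ^ W) (label w) (e 2) (e 3) \<and> label w (e 3) \<in> true_labels"
  using assms by (simp add: Write_True_def)

lemma eval_Write_False:
  assumes "0 < W" "e 0 = 0" "e (Suc 0) = 1"
  shows "eval w W e Write_False \<longleftrightarrow>
    write_pos (2 ^ W) (label w) (e 2) (e 3) \<and> label w (e 3) \<notin> true_labels \<or>
    label w (e 2) = 16 \<and> e 3 = 0 \<and> (\<exists>\<sigma><2 ^ W. \<exists>M<2 ^ W. \<exists>B<2 ^ W. good (2 ^ W) (label w) \<sigma> M B)"
  using assms by (simp add: Write_False_def)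

lemma wff_Write: "wff 32 {0, 1, 2, 3} Write"
  by (simp add: Write_def Chosen_def parse_less)

lemma wff_Write_True: "wff 32 {0, 1, 2, 3} Write_True"
  using wff_Write by (simp add: Write_True_def parse_less)

lemma wff_Write_False: "wff 32 {0, 1, 2, 3} Write_False"
  using wff_Write by (simp add: Write_False_def parse_less)

subsection \<open>Meaning of the formulas on encoded hypergraphs\<close>

locale hypergraph_instance = parsed_instance gs hs w for gs hs w +
  fixes V :: "nat set" and G H :: "nat set set" and N :: nat
  assumes G: "hypergraph V G" "adjacency_lists gs G" and H: "hypergraph V H" "adjacency_lists hs H"
    and ip: "intersection_property G H"
    and N: "N = 2 ^ width (length w)"
begin

definition edges :: "nat \<Rightarrow> nat set set" where "edges h = (if h = 0 then G else H)"

abbreviation L :: "nat \<Rightarrow> nat" where "L \<equiv> label w"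

lemma length_less: "length w + 1 < 2 ^ bitlen (length w)"
  by (rule less_bitlen)

lemma length_less_N: "length w < N"
proof -
  have "(2::nat) ^ bitlen (length w) \<le> N" unfolding N by (intro power_increasing) (auto simp: width_def)
  then show ?thesis using length_less by linarith
qed

lemma edge_at_N: "edge_at h p x \<Longrightarrow> p + length (enc_edge x) < N"
  using edge_at_label(2)[of h p x 0] length_less_N by simp

lemma vertex_at_w: "vertex_at h p u v \<Longrightarrow> u < length w"
  using vertex_at_label(2)[of h p u v 0] by simp

lemma vertex_at_N: "vertex_at h p u v \<Longrightarrow> u < N"
  using vertex_at_w length_less_N less_trans by blast

lemma vertex_at_edge: "vertex_at h p u v \<Longrightarrow> \<exists>x. edge_at h p x"
  by (auto simp: vertex_at_def)

lemma vertex_at_edge_length: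
  assumes "edge_at h p x" "vertex_at h p u v" shows "u < p + length (enc_edge x)"
proof -
  obtain x' as bs where e: "edge_at h p x'" "x' = as @ v # bs" "u = p + offset enc_vertex as"
    using assms(2) unfolding vertex_at_def by blast
  have "x' = x" using edge_at_unique assms(1) e(1) by blast
  moreover have "offset enc_vertex as < length (enc_edge (as @ v # bs))"
    by (simp add: enc_edge_def enc_list_split offset_def) (simp add: enc_list_def)
  ultimately show ?thesis using e by simp
qed

text \<open>The end of the edge carries label 1 or 9 and no position inside does, so the absence of
  these labels before \<open>u\<close> confines \<open>u\<close> to the edge.\<close>

lemma occurs_iff:
  assumes e: "edge_at h p x"
  shows "occurs N L p u \<longleftrightarrow> (\<exists>v. vertex_at h p u v)"
proof
  assume o: "occurs N L p u"
  have h: "h = 0 \<or> h = 8" using e by (rule edge_at_part)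
  let ?q = "p + length (enc_edge x)"
  have q: "?q < N" "L ?q \<in> {1, 9}" using edge_at_N[OF e] label_edge_end[OF e] h by auto
  have "0 < length (enc_edge x)" by (simp add: enc_edge_def enc_list_def)
  then have "\<not> ?q < u" using o q unfolding occurs_def by auto
  moreover have "u \<noteq> ?q" using o q by (auto simp: occurs_def)
  ultimately have "u < ?q" "p < u" using o by (auto simp: occurs_def)
  from label_in_edge[OF e this(2,1)] show "\<exists>v. vertex_at h p u v"
    using o h by (auto simp: occurs_def)
next
  assume "\<exists>v. vertex_at h p u v"
  then obtain v where v: "vertex_at h p u v" by blast
  have h: "h = 0 \<or> h = 8" using e by (rule edge_at_part)
  have "L j \<notin> {1, 9}" if "p < j" "j < u" for j
    using label_in_edge[OF e that(1)] that(2) vertex_at_edge_length[OF e v] h by auto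
  then show "occurs N L p u"
    using label_vertex_start[OF v] vertex_at_label(3)[OF v le0] h by (auto simp: occurs_def)
qed

lemma vertex_at_set:
  assumes "edge_at h p x"
  shows "(\<exists>u. vertex_at h p u v) \<longleftrightarrow> v \<in> set x"
proof
  assume "\<exists>u. vertex_at h p u v"
  then obtain x' as bs where "edge_at h p x'" "x' = as @ v # bs" unfolding vertex_at_def by blast
  then show "v \<in> set x" using edge_at_unique[OF assms] by auto
next
  assume "v \<in> set x"
  then obtain as bs where "x = as @ v # bs" by (auto dest: split_list)
  then show "\<exists>u. vertex_at h p u v" using assms unfolding vertex_at_def by blast
qed

lemma vertex_label_3: 
  assumes "vertex_at h p u v" "j < length (enc_vertex v)" shows "L (u + j) \<notin> {3, 11}"
proof (cases j)
  case 0
  then show ?thesis using label_vertex_start[OF assms(1)] vertex_at_part[OF assms(1)] by auto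
next
  case (Suc i)
  then show ?thesis using label_in_vertex[OF assms(1), of "u + j"] assms(2) vertex_at_part[OF assms(1)] by auto
qed

lemma same_vertex_iff:
  assumes v: "vertex_at h p u v" and v': "vertex_at h' p' u' v'"
  shows "same_vertex N L u u' \<longleftrightarrow> v = v'"
proof
  let ?m = "length (enc_vertex v)" and ?m' = "length (enc_vertex v')"
  assume s: "same_vertex N L u u'"
  then obtain k where k: "u + k < N" "L (u + k) \<in> {3, 11}"
    and bits: "\<And>j. j < N \<Longrightarrow> \<not> k < j \<Longrightarrow> u + j < N \<Longrightarrow> u' + j < N \<Longrightarrow>
      (L (u + j) \<in> true_labels) = (L (u' + j) \<in> true_labels)"
    unfolding same_vertex_def by blast
  \<comment> \<open>No position before the end of \<open>v\<close> looks like the end of a vertex,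
    so the agreement covers the whole code of \<open>v\<close>.\<close>
  have "?m \<le> k" using vertex_label_3[OF v, of k] k(2) by (meson not_le)
  have eq: "enc_vertex v ! j = enc_vertex v' ! j" if j: "j < ?m" "j < ?m'" for j
  proof -
    have "u + Suc j < N" "u' + Suc j < N"
      using vertex_at_label(2)[OF v le0] vertex_at_label(2)[OF v' le0] j length_less_N by auto
    then have "(L (u + Suc j) \<in> true_labels) = (L (u' + Suc j) \<in> true_labels)"
      using bits[of "Suc j"] j \<open>?m \<le> k\<close> by simp
    then show ?thesis using vertex_at_bits[OF v j(1)] vertex_at_bits[OF v' j(2)] by simp
  qed
  have pre: "enc_vertex a = enc_vertex b @ drop (length (enc_vertex b)) (enc_vertex a)"
    if "length (enc_vertex b) \<le> length (enc_vertex a)"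
      "\<And>j. j < length (enc_vertex b) \<Longrightarrow> enc_vertex a ! j = enc_vertex b ! j" for a b
  proof -
    have "take (length (enc_vertex b)) (enc_vertex a) = enc_vertex b"
      using that by (intro nth_equalityI) auto
    then show ?thesis by (metis append_take_drop_id)
  qed
  show "v = v'"
  proof (cases "?m \<le> ?m'")
    case True
    then have "enc_vertex v' @ [] = enc_vertex v @ drop ?m (enc_vertex v')" using pre[of v v'] eq by simp
    then show ?thesis using enc_vertex_prefix_free by blast
  next
    case False
    then have "enc_vertex v @ [] = enc_vertex v' @ drop ?m' (enc_vertex v)" using pre[of v' v] eq by simp
    then show ?thesis using enc_vertex_prefix_free by blast
  qed
next
  assume eq: "v = v'"
  let ?m = "length (enc_vertex v)"
  have m: "u + ?m < N" "?m < N" using vertex_at_label(2)[OF v le0] length_less_N by auto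
  have "(L (u + j) \<in> true_labels) = (L (u' + j) \<in> true_labels)" if "j \<le> ?m" for j
  proof (cases j)
    case 0
    then show ?thesis
      using label_vertex_start[OF v] label_vertex_start[OF v'] vertex_at_part[OF v] vertex_at_part[OF v']
      by (auto simp: true_labels_def)
  next
    case (Suc i)
    then have "i < length (enc_vertex v)" "i < length (enc_vertex v')" using that eq by auto
    then show ?thesis using vertex_at_bits[OF v] vertex_at_bits[OF v'] Suc eq by simp
  qed
  moreover have "L (u + ?m) \<in> {3, 11}" using label_vertex_end[OF v] vertex_at_part[OF v] by auto
  ultimately show "same_vertex N L u u'"
    using m unfolding same_vertex_def by (intro exI[of _ ?m]) (auto simp: not_less)
qed

lemma adjacency: "h = 0 \<or> h = 8 \<Longrightarrow> adjacency_lists (part h) (edges h)"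
  using G H by (auto simp: part_def edges_def)

lemma edge_at_edges: "edge_at h p x \<Longrightarrow> set x \<in> edges h"
proof -
  assume e: "edge_at h p x"
  then have "x \<in> set (part h)" by (auto simp: edge_at_def)
  then show "set x \<in> edges h" using adjacency[OF edge_at_part[OF e]] by (auto simp: adjacency_lists_def)
qed

lemma edges_edge_at:
  assumes "h = 0 \<or> h = 8" "E \<in> edges h"
  shows "\<exists>p x. edge_at h p x \<and> set x = E"
proof -
  have "E \<in> set ` set (part h)" using adjacency[OF assms(1)] assms(2) by (simp add: adjacency_lists_def)
  then obtain x where x: "x \<in> set (part h)" "set x = E" by blast
  then obtain as bs where "part h = as @ x # bs" by (auto dest: split_list)
  then show ?thesis using assms(1) x(2) unfolding edge_at_def by blast
qed

lemma edge_at_inj: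
  assumes "edge_at h p x" "edge_at h p' x'" "set x = set x'" shows "p = p'"
proof -
  obtain as bs where a: "part h = as @ x # bs" "p = base h + offset enc_edge as"
    using assms(1) unfolding edge_at_def by blast
  obtain as' bs' where a': "part h = as' @ x' # bs'" "p' = base h + offset enc_edge as'"
    using assms(2) unfolding edge_at_def by blast
  have d: "distinct (map set (part h))"
    using adjacency[OF edge_at_part[OF assms(1)]] by (simp add: adjacency_lists_def)
  have "map set (part h) ! length as = set x" unfolding a(1) by (simp add: nth_append)
  moreover have "map set (part h) ! length as' = set x'" unfolding a'(1) by (simp add: nth_append)
  moreover have "length as < length (part h)" "length as' < length (part h)"
    using arg_cong[OF a(1), of length] arg_cong[OF a'(1), of length] by simp_all
  ultimately have "length as = length as'"
    using d assms(3) by (metis length_map nth_eq_iff_index_eq)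
  then have "as = as'" using a(1) a'(1) by (metis append_eq_append_conv)
  then show ?thesis using a(2) a'(2) by simp
qed

lemma ex_edge_iff:
  assumes h: "h = 0 \<or> h = 8" "l = h + 2" and PQ: "\<And>e x. edge_at h e x \<Longrightarrow> P e \<longleftrightarrow> Q (set x)"
  shows "(\<exists>e<N. L e = l \<and> P e) \<longleftrightarrow> (\<exists>E\<in>edges h. Q E)"
  unfolding h(2)
proof
  assume "\<exists>e<N. L e = h + 2 \<and> P e"
  then obtain e x where "edge_at h e x" "P e" using label_edge_iff[OF h(1)] by blast
  then show "\<exists>E\<in>edges h. Q E" using PQ edge_at_edges by blast
next
  assume "\<exists>E\<in>edges h. Q E"
  then obtain e x where x: "edge_at h e x" "Q (set x)" using edges_edge_at[OF h(1)] by blast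
  then have "e < N" "L e = h + 2" using label_edge_start[OF x(1)] edge_at_N[OF x(1)] by simp_all
  then show "\<exists>e<N. L e = h + 2 \<and> P e" using PQ x by blast
qed

text \<open>The label of the start of an edge does not occur inside an edge, so edges do not
  overlap. This is why an occurrence of a vertex in \<open>G\<close> can also name its edge.\<close>

lemma vertex_at_same_edge:
  assumes "vertex_at h p u v" "vertex_at h q u y" shows "p = q"
proof -
  have "\<not> p < q" if v: "vertex_at h p u v" "vertex_at h q u y" for p q v y
  proof
    assume "p < q"
    obtain x z where x: "edge_at h p x" and z: "edge_at h q z" using vertex_at_edge v by blast
    have "u < p + length (enc_edge x)" "q < u"
      using vertex_at_edge_length[OF x v(1)] vertex_at_label(3)[OF v(2) le0] .
    then have "L q \<in> {h + 3, h + 4, h + 5, h + 6, h + 7}" using label_in_edge[OF x \<open>p < q\<close>] by simp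
    then show False using label_edge_start[OF z] by simp
  qed
  then show ?thesis using assms by (meson linorder_neqE_nat)
qed

lemma edges_subset: "E \<in> edges h \<Longrightarrow> E \<subseteq> V"
  using G H by (auto simp: edges_def hypergraph_def split: if_splits)

lemma vertex_at_V: "vertex_at h p u v \<Longrightarrow> v \<in> V"
proof -
  assume v: "vertex_at h p u v"
  then obtain x where x: "edge_at h p x" using vertex_at_edge by blast
  then have "v \<in> set x" using vertex_at_set v by blast
  then show "v \<in> V" using edge_at_edges[OF x] edges_subset by blast
qed

lemma V_vertex_at:
  assumes "v \<in> V" shows "\<exists>p u. vertex_at 8 p u v"
proof -
  obtain E where "E \<in> edges 8" "v \<in> E" using H assms by (auto simp: edges_def hypergraph_def)
  then obtain p x where "edge_at 8 p x" "set x = E" using edges_edge_at by blast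
  then show ?thesis using vertex_at_set \<open>v \<in> E\<close> by blast
qed

text \<open>The item at a position of the second hypergraph excludes the vertex there, and one at a position
  of the first hypergraph excludes the other vertices of the edge.\<close>

definition item_set :: "nat \<Rightarrow> nat set" where
  "item_set x = {v. (\<exists>p. vertex_at 8 p x v) \<or>
     (\<exists>p y z. vertex_at 0 p x y \<and> edge_at 0 p z \<and> v \<in> set z \<and> v \<noteq> y)}"

lemma excluded_iff:
  assumes v: "vertex_at h p u v"
  shows "excluded N L \<sigma> M B u \<longleftrightarrow> v \<in> \<Union>(item_set ` items N \<sigma> M B)"
proof -
  have 1: "L x = 12 \<and> same_vertex N L x u \<longleftrightarrow> (\<exists>p. vertex_at 8 p x v)" for x
    using label_vertex_iff[of 8 x] same_vertex_iff[OF _ v] by auto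
  have e: "(\<exists>e<N. \<exists>u'<N. L e = 2 \<and> occurs N L e x \<and> occurs N L e u' \<and> same_vertex N L u' u) \<longleftrightarrow>
      (\<exists>p z. edge_at 0 p z \<and> (\<exists>y. vertex_at 0 p x y) \<and> v \<in> set z)" (is "?A \<longleftrightarrow> ?B") for x
  proof
    assume ?A
    then obtain e u' where a: "L e = 2" "occurs N L e x" "occurs N L e u'" "same_vertex N L u' u" by blast
    then obtain z where z: "edge_at 0 e z" using label_edge_iff[of 0 e] by auto
    obtain y where y: "vertex_at 0 e u' y" using a(3) occurs_iff[OF z] by blast
    then have "y = v" using a(4) same_vertex_iff[OF y v] by simp
    then have "v \<in> set z" using vertex_at_set[OF z] y by blast
    then show ?B using z a(2) occurs_iff[OF z] by blast
  next
    assume ?B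
    then obtain e z where z: "edge_at 0 e z" "\<exists>y. vertex_at 0 e x y" "v \<in> set z" by blast
    then obtain u' where u': "vertex_at 0 e u' v" using vertex_at_set by blast
    have "same_vertex N L u' u" using same_vertex_iff[OF u' v] by simp
    moreover have "e < N" "L e = 2" using edge_at_N[OF z(1)] label_edge_start[OF z(1)] by simp_all
    ultimately show ?A using z(2) u' occurs_iff[OF z(1)] vertex_at_N[OF u'] by blast
  qed
  have 2: "L x = 4 \<and> \<not> same_vertex N L x u \<and>
      (\<exists>e<N. \<exists>u'<N. L e = 2 \<and> occurs N L e x \<and> occurs N L e u' \<and> same_vertex N L u' u) \<longleftrightarrow>
      (\<exists>p y z. vertex_at 0 p x y \<and> edge_at 0 p z \<and> v \<in> set z \<and> v \<noteq> y)" (is "?A \<longleftrightarrow> ?B") for x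
  proof
    assume a: ?A
    then obtain p z y where "edge_at 0 p z" "vertex_at 0 p x y" "v \<in> set z" using e[of x] by blast
    moreover from this have "v \<noteq> y" using same_vertex_iff[OF _ v] a by blast
    ultimately show ?B by blast
  next
    assume ?B
    then obtain p y z where b: "vertex_at 0 p x y" "edge_at 0 p z" "v \<in> set z" "v \<noteq> y" by blast
    then have "L x = 4" using label_vertex_start by fastforce
    then show ?A using b e[of x] same_vertex_iff[OF b(1) v] by blast
  qed
  \<comment> \<open>Numbers that are not the position of a vertex exclude nothing, so the bounded
    quantifier misses no item.\<close>
  have bound: "x < N" if "v \<in> item_set x" for x
    using that vertex_at_N by (auto simp: item_set_def)
  have "excluded N L \<sigma> M B u \<longleftrightarrow> (\<exists>x<N. x \<in> items N \<sigma> M B \<and> v \<in> item_set x)"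
    unfolding excluded_def 1 2 item_set_def mem_Collect_eq by (rule refl)
  then show ?thesis using bound by blast
qed

context
  fixes \<sigma> M B :: nat and X
  assumes X: "X = \<Union>(item_set ` items N \<sigma> M B)"
begin

lemma compatible_edge_iff:
  "compatible_edge N L \<sigma> M B e \<longleftrightarrow> (\<exists>x. edge_at 8 e x \<and> set x \<inter> X = {})"
proof -
  have "(\<exists>u<N. occurs N L e u \<and> excluded N L \<sigma> M B u) \<longleftrightarrow> set x \<inter> X \<noteq> {}" if x: "edge_at 8 e x" for x
  proof
    assume "\<exists>u<N. occurs N L e u \<and> excluded N L \<sigma> M B u"
    then obtain u v where u: "vertex_at 8 e u v" "excluded N L \<sigma> M B u" using occurs_iff[OF x] by blast
    then have "v \<in> X" using excluded_iff[OF u(1)] X by simp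
    moreover have "v \<in> set x" using vertex_at_set[OF x] u(1) by blast
    ultimately show "set x \<inter> X \<noteq> {}" by blast
  next
    assume "set x \<inter> X \<noteq> {}"
    then obtain v where v: "v \<in> set x" "v \<in> X" by blast
    then obtain u where u: "vertex_at 8 e u v" using vertex_at_set[OF x] by blast
    then have "excluded N L \<sigma> M B u" using excluded_iff[OF u] v(2) X by simp
    then show "\<exists>u<N. occurs N L e u \<and> excluded N L \<sigma> M B u" using u occurs_iff[OF x] vertex_at_N[OF u] by blast
  qed
  moreover have "L e = 10 \<longleftrightarrow> (\<exists>x. edge_at 8 e x)" using label_edge_iff[of 8 e] by simp
  ultimately show ?thesis unfolding compatible_edge_def by blast
qed

lemma in_edge_iff:
  assumes v: "vertex_at h p u v" and x: "edge_at h' e x"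
  shows "in_edge N L e u \<longleftrightarrow> v \<in> set x"
proof
  assume "in_edge N L e u"
  then obtain u' where u': "occurs N L e u'" "same_vertex N L u' u" unfolding in_edge_def by blast
  then obtain v' where v': "vertex_at h' e u' v'" using occurs_iff[OF x] by blast
  then have "v' = v" using same_vertex_iff[OF v' v] u'(2) by simp
  then show "v \<in> set x" using v' vertex_at_set[OF x] by blast
next
  assume "v \<in> set x"
  then obtain u' where u': "vertex_at h' e u' v" using vertex_at_set[OF x] by blast
  then show "in_edge N L e u"
    unfolding in_edge_def using occurs_iff[OF x] same_vertex_iff[OF u' v] vertex_at_N[OF u'] by blast
qed

text \<open>Adjacency lists contain every edge once, so counting starting positions is counting
  edges. These positions lie within the input, which keeps the count below \<open>N\<close>.\<close>

lemma card_compatible: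
  assumes "\<And>e x. edge_at 8 e x \<Longrightarrow> P e \<longleftrightarrow> Q (set x)"
  shows "card {e. e < N \<and> compatible_edge N L \<sigma> M B e \<and> P e} mod N = card {E \<in> compatible H X. Q E}"
proof -
  let ?A = "{e. e < N \<and> compatible_edge N L \<sigma> M B e \<and> P e}"
  define f where "f e = set (SOME x. edge_at 8 e x)" for e
  have f: "f e = set x" if "edge_at 8 e x" for e x
    using that someI[of "edge_at 8 e" x] edge_at_unique unfolding f_def by metis
  have "bij_betw f ?A {E \<in> compatible H X. Q E}"
    unfolding bij_betw_def
  proof
    show "inj_on f ?A"
      by (rule inj_onI) (use f edge_at_inj in \<open>auto simp: compatible_edge_iff\<close>)
    show "f ` ?A = {E \<in> compatible H X. Q E}"
    proof (intro equalityI subsetI)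
      fix E assume "E \<in> f ` ?A"
      then obtain e x where e: "edge_at 8 e x" "set x \<inter> X = {}" "P e" "E = f e" by (auto simp: compatible_edge_iff)
      then show "E \<in> {E \<in> compatible H X. Q E}"
        using f[OF e(1)] edge_at_edges[OF e(1)] assms[OF e(1)] by (simp add: compatible_def edges_def)
    next
      fix E assume E: "E \<in> {E \<in> compatible H X. Q E}"
      then obtain e x where e: "edge_at 8 e x" "set x = E"
        using edges_edge_at[of 8 E] by (auto simp: compatible_def edges_def)
      have "e < N" using edge_at_N[OF e(1)] by simp
      then have "e \<in> ?A" using e E assms[OF e(1)] by (auto simp: compatible_edge_iff compatible_def)
      then show "E \<in> f ` ?A" using f[OF e(1)] e(2) by blast
    qed
  qed
  then have "card ?A = card {E \<in> compatible H X. Q E}" by (rule bij_betw_same_card)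
  moreover have "card ?A < N"
  proof -
    have "?A \<subseteq> {..<length w}"
      using edge_at_label(2)[OF _ le0] by (fastforce simp: compatible_edge_iff)
    then have "card ?A \<le> length w" using card_mono[of "{..<length w}" ?A] by simp
    then show ?thesis using length_less_N by simp
  qed
  ultimately show ?thesis by simp
qed

lemma in_transversal_iff:
  assumes v: "vertex_at h p u v"
  shows "in_transversal N L \<sigma> M B u \<longleftrightarrow> v \<in> frequent V H X"
proof -
  have "card {e. e < N \<and> compatible_edge N L \<sigma> M B e \<and> \<not> in_edge N L e u} mod N = card {E \<in> compatible H X. v \<notin> E}"
    by (rule card_compatible) (simp add: in_edge_iff[OF v])
  moreover have "card {e. e < N \<and> compatible_edge N L \<sigma> M B e \<and> in_edge N L e u} mod N = card {E \<in> compatible H X. v \<in> E}"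
    by (rule card_compatible) (simp add: in_edge_iff[OF v])
  ultimately show ?thesis
    unfolding in_transversal_def frequent_def using excluded_iff[OF v] vertex_at_V[OF v] X by auto
qed

lemma good_iff: "good N L \<sigma> M B \<longleftrightarrow> new_transversal V G H (frequent V H X)"
proof -
  let ?F = "frequent V H X"
  have ex: "(\<exists>u<N. occurs N L e u \<and> in_transversal N L \<sigma> M B u) \<longleftrightarrow> ?F \<inter> set x \<noteq> {}"
    and nex: "(\<exists>u<N. occurs N L e u \<and> \<not> in_transversal N L \<sigma> M B u) \<longleftrightarrow> \<not> set x \<subseteq> ?F"
    if x: "edge_at h e x" for h e x
  proof -
    have "occurs N L e u \<Longrightarrow> \<exists>v. vertex_at h e u v \<and> v \<in> set x" for u
      using occurs_iff[OF x] vertex_at_set[OF x] by blast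
    moreover have "v \<in> set x \<Longrightarrow> \<exists>u<N. vertex_at h e u v \<and> occurs N L e u" for v
      using occurs_iff[OF x] vertex_at_set[OF x] vertex_at_N by blast
    ultimately show "(\<exists>u<N. occurs N L e u \<and> in_transversal N L \<sigma> M B u) \<longleftrightarrow> ?F \<inter> set x \<noteq> {}"
      and "(\<exists>u<N. occurs N L e u \<and> \<not> in_transversal N L \<sigma> M B u) \<longleftrightarrow> \<not> set x \<subseteq> ?F"
      using in_transversal_iff[of h e] by (meson IntI disjoint_iff subset_iff)+
  qed
  have G: "(\<exists>e<N. L e = 2 \<and> \<not> (\<exists>u<N. occurs N L e u \<and> in_transversal N L \<sigma> M B u)) \<longleftrightarrow>
      (\<exists>E\<in>edges 0. ?F \<inter> E = {})"
    by (rule ex_edge_iff) (use ex in auto)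
  have H: "(\<exists>e<N. L e = 10 \<and> \<not> (\<exists>u<N. occurs N L e u \<and> \<not> in_transversal N L \<sigma> M B u)) \<longleftrightarrow>
      (\<exists>E\<in>edges 8. E \<subseteq> ?F)"
    by (rule ex_edge_iff) (use nex in auto)
  have "?F \<subseteq> V" by (auto simp: frequent_def)
  then show ?thesis
    unfolding good_def G H new_transversal_def transversal_def independent_set_def edges_def by auto
qed

end

text \<open>The bound is \<open>2 ^ bitlen (length w)\<close> rather than \<open>N\<close> because
  the position has to serve as a single digit of the certificate.\<close>

lemma exclusion_item:
  assumes "D \<in> exclusions V G" shows "\<exists>x<2 ^ bitlen (length w). item_set x = D"
proof -
  have bound: "u < 2 ^ bitlen (length w)" if "vertex_at h p u v" for h p u v
    using vertex_at_w[OF that] length_less by linarith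
  consider v where "v \<in> V" "D = {v}" | E v where "E \<in> G" "v \<in> E" "D = E - {v}"
    using assms by (auto simp: exclusions_def)
  then show ?thesis
  proof cases
    case 1
    then obtain p u where u: "vertex_at 8 p u v" using V_vertex_at by blast
    \<comment> \<open>The label 12 at \<open>u\<close> rules out a vertex of \<open>G\<close> there,
      so the other clause of \<open>item_set\<close> contributes nothing.\<close>
    have "\<not> vertex_at 0 q u y" for q y
      using label_vertex_start[OF u] label_vertex_start[of 0 q u y] by auto
    then have "item_set u = D"
      unfolding item_set_def 1(2) using u vertex_at_unique[OF u] by blast
    then show ?thesis using bound[OF u] by blast
  next
    case 2
    then obtain p x where x: "edge_at 0 p x" "set x = E" using edges_edge_at[of 0 E] by (auto simp: edges_def)
    then obtain u where u: "vertex_at 0 p u v" using vertex_at_set 2(2) by blast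
    have "\<not> vertex_at 8 q u y" for q y
      using label_vertex_start[OF u] label_vertex_start[of 8 q u y] by auto
    then have "item_set u = set x - {v}"
      unfolding item_set_def using u vertex_at_same_edge[OF u] vertex_at_unique[OF u] edge_at_unique[OF x(1)] x(1) by blast
    then have "item_set u = D" using x(2) 2(3) by simp
    then show ?thesis using bound[OF u] by blast
  qed
qed

text \<open>No vertex starts at position 0, so the digit 0 can pad a certificate that needs fewer
  items.\<close>

lemma item_set_0: "item_set 0 = {}"
  using vertex_at_label(3)[OF _ le0] by (fastforce simp: item_set_def)

text \<open>Each edge takes at least one bit of the input; hence \<open>bitlen (length w)\<close>
  halvings suffice, one for each available digit.\<close>

lemma card_H: "card H < 2 ^ bitlen (length w)"
proof -
  have "card H \<le> length hs" using H(2) card_image_le[of "set hs" set] card_length[of hs]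
    by (auto simp: adjacency_lists_def)
  also have "length hs \<le> length (enc_list enc_edge hs)"
    unfolding length_enc_list by (induction hs) auto
  also have "\<dots> \<le> length w" by (simp add: w enc_instance_def enc_hypergraph_def)
  finally show ?thesis using length_less by linarith
qed

lemma good_exists:
  assumes "new_transversal V G H T"
  shows "\<exists>\<sigma><N. \<exists>M<N. \<exists>B<N. good N L \<sigma> M B"
proof -
  let ?K = "bitlen (length w)"
  obtain ms where ms: "length ms \<le> ?K" "set ms \<subseteq> exclusions V G"
      "new_transversal V G H (frequent V H (\<Union>(set ms)))"
    using short_certificate[OF G(1) H(1) ip assms card_H] by blast
  obtain g where g: "\<And>D. D \<in> exclusions V G \<Longrightarrow> g D < 2 ^ ?K \<and> item_set (g D) = D"
    using exclusion_item by metis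
  then have gi: "g (ms ! i) < 2 ^ ?K \<and> item_set (g (ms ! i)) = ms ! i" if "i < length ms" for i
    using ms(2) that nth_mem by blast
  define x where "x i = (if i < length ms then g (ms ! i) else 0)" for i
  have x: "x i < 2 ^ ?K" for i using gi[of i] by (auto simp: x_def)
  obtain \<sigma> M B where s: "\<sigma> < N" "M < N" "B < N" "items N \<sigma> M B = x ` {..<?K}"
    using items_digits[of ?K x N] x bitlen_pos by (auto simp: N width_def)
  have "\<Union>(item_set ` items N \<sigma> M B) = \<Union>(set ms)"
  proof (intro equalityI subsetI)
    fix v assume "v \<in> \<Union>(item_set ` items N \<sigma> M B)"
    then obtain i where i: "v \<in> item_set (x i)" unfolding s(4) by blast
    then have "i < length ms" using item_set_0 by (auto simp: x_def split: if_splits)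
    then show "v \<in> \<Union>(set ms)" using i gi[of i] nth_mem[of i ms] by (auto simp: x_def)
  next
    fix v assume "v \<in> \<Union>(set ms)"
    then obtain i where i: "i < length ms" "v \<in> ms ! i" by (auto simp: in_set_conv_nth)
    then have "item_set (x i) = ms ! i" using gi[of i] by (auto simp: x_def)
    then show "v \<in> \<Union>(item_set ` items N \<sigma> M B)" using i ms(1) unfolding s(4) by force
  qed
  then have "good N L \<sigma> M B" using good_iff[OF refl] ms(3) by simp
  then show ?thesis using s by blast
qed

subsection \<open>The output\<close>

lemma chosen_unique:
  assumes "chosen N L \<sigma> M B" "chosen N L \<sigma>' M' B'" "\<sigma> < N" "M < N" "B < N" "\<sigma>' < N" "M' < N" "B' < N"
  shows "\<sigma> = \<sigma>' \<and> M = M' \<and> B = B'"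
proof -
  have "\<not> lex_less \<sigma> M B \<sigma>' M' B'" "\<not> lex_less \<sigma>' M' B' \<sigma> M B"
    using assms unfolding chosen_def by blast+
  then show ?thesis unfolding lex_less_def by (meson linorder_neqE_nat)
qed

lemma chosen_exists:
  assumes "\<sigma> < N" "M < N" "B < N" "good N L \<sigma> M B"
  shows "\<exists>\<sigma><N. \<exists>M<N. \<exists>B<N. chosen N L \<sigma> M B"
proof -
  let ?R = "less_than <*lex*> less_than <*lex*> less_than"
  let ?Q = "{(\<sigma>, M, B). \<sigma> < N \<and> M < N \<and> B < N \<and> good N L \<sigma> M B}"
  have "wf ?R" by auto
  moreover have "(\<sigma>, M, B) \<in> ?Q" using assms by simp
  ultimately obtain z where z: "z \<in> ?Q" "\<And>y. (y, z) \<in> ?R \<Longrightarrow> y \<notin> ?Q" by (rule wfE_min) blast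
  obtain a b c where abc: "z = (a, b, c)" by (cases z)
  have "chosen N L a b c"
    unfolding chosen_def
  proof
    show "good N L a b c" using z(1) abc by simp
    show "\<not> (\<exists>a'<N. \<exists>b'<N. \<exists>c'<N. good N L a' b' c' \<and> lex_less a' b' c' a b c)"
    proof (rule notI, elim exE conjE)
    fix a' b' c' assume l: "a' < N" "b' < N" "c' < N" "good N L a' b' c'" "lex_less a' b' c' a b c"
    then have "((a', b', c'), z) \<in> ?R" unfolding abc by (auto simp: lex_less_def)
    then show False using z(2) l by blast
    qed
  qed
  then show ?thesis using z(1) abc by auto
qed

text \<open>At a position to be copied the label decides which of the two formulas holds. The last
  conjunct only prevents the closing \<open>False\<close> from being counted twice where both
  disjuncts of \<open>Write_False\<close> apply.\<close>

lemma emitted_Write: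
  "emitted Write_True Write_False w p q =
    (if write_pos N L p q then [L q \<in> true_labels]
     else []) @ (if p = length w \<and> q = 0 \<and> (\<exists>\<sigma><N. \<exists>M<N. \<exists>B<N. good N L \<sigma> M B) \<and> \<not> (write_pos N L p q \<and> L q \<notin> true_labels)
       then [False] else [])"
proof -
  have W: "0 < width (length w)" by (simp add: width_def bitlen_def)
  note e = eval_Write_True[OF W, of "env4 p q" w] eval_Write_False[OF W, of "env4 p q" w]
  show ?thesis
    using e by (auto simp: emitted_def env4_def N label_end_iff)
qed

context
  fixes \<sigma> M B :: nat
  assumes chosen: "chosen N L \<sigma> M B" and less: "\<sigma> < N" "M < N" "B < N"
begin

abbreviation "sel \<equiv> selected N L \<sigma> M B"

definition vertex :: "nat \<Rightarrow> nat" where "vertex u = (SOME v. \<exists>p. vertex_at 8 p u v)"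

lemma vertex_eq: "vertex_at 8 p u v \<Longrightarrow> vertex u = v"
  unfolding vertex_def using vertex_at_unique by (metis (mono_tags, lifting) someI)

lemma sel_vertex_at: "sel p \<Longrightarrow> \<exists>e. vertex_at 8 e p (vertex p)"
  using label_vertex_iff[of 8 p] vertex_eq unfolding selected_def by fastforce

lemma write_pos_iff: "write_pos N L p q \<longleftrightarrow> sel p \<and> in_vertex N L p q"
  using chosen less chosen_unique unfolding write_pos_def by blast

lemma in_vertex_iff:
  assumes v: "vertex_at h e p v"
  shows "in_vertex N L p q \<longleftrightarrow> p \<le> q \<and> q \<le> p + length (enc_vertex v)"
proof -
  let ?m = "length (enc_vertex v)"
  have "p + ?m < N" "L (p + ?m) \<in> {3, 11}"
    using vertex_at_label(2)[OF v le0] length_less_N label_vertex_end[OF v] vertex_at_part[OF v] by auto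
  moreover have "L j \<notin> {3, 11}" if "p \<le> j" "j < p + ?m" for j
    using vertex_label_3[OF v, of "j - p"] that by simp
  ultimately show ?thesis unfolding in_vertex_def by (metis le_add1 not_le order.strict_trans1 order.trans)
qed

definition row :: "nat \<Rightarrow> bool list" where
  "row p = concat (map (emitted Write_True Write_False w p) [0..<N])"

lemma good_chosen: "good N L \<sigma> M B" using chosen by (simp add: chosen_def)

lemma sel_less: "sel p \<Longrightarrow> p < length w"
  using sel_vertex_at vertex_at_w by blast

lemma row_sel:
  assumes "sel p" shows "row p = True # enc_vertex (vertex p)"
proof -
  obtain e where v: "vertex_at 8 e p (vertex p)" using sel_vertex_at[OF assms] by blast
  let ?m = "length (enc_vertex (vertex p))"
  let ?q = "Suc (p + ?m)"
  have m: "?q \<le> N" using vertex_at_label(2)[OF v le0] length_less_N by simp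
  have em: "emitted Write_True Write_False w p q = (if p \<le> q \<and> q < ?q then [L q \<in> true_labels] else [])" for q
    using assms sel_less[OF assms] by (simp add: emitted_Write write_pos_iff in_vertex_iff[OF v] less_Suc_eq_le)
  \<comment> \<open>Only the columns from the start to the end of the vertex write a bit; the blocks
    on both sides are silent.\<close>
  have "[0..<N] = [0..<p] @ [p..<?q] @ [?q..<N]"
  proof -
    have "[0..<N] = [0..<p] @ [p..<N]" using upt_add_eq_append[of 0 p "N - p"] m by simp
    moreover have "[p..<N] = [p..<?q] @ [?q..<N]" using upt_add_eq_append[of p ?q "N - ?q"] m by simp
    ultimately show ?thesis by simp
  qed
  then have "row p = concat (map (\<lambda>q. [L q \<in> true_labels]) [p..<?q])"
  proof -
    let ?E = "emitted Write_True Write_False w p"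
    assume u: "[0..<N] = [0..<p] @ [p..<?q] @ [?q..<N]"
    have "concat (map ?E [0..<p]) = []" "concat (map ?E [?q..<N]) = []" by (auto simp: em)
    moreover have "map ?E [p..<?q] = map (\<lambda>q. [L q \<in> true_labels]) [p..<?q]"
      by (rule map_cong) (auto simp: em)
    ultimately show ?thesis unfolding row_def u by (simp only: map_append concat_append append_Nil append_Nil2)
  qed
  also have "\<dots> = map (\<lambda>q. L q \<in> true_labels) [p..<?q]" by (simp add: concat_map_singleton del: upt_Suc)
  also have "\<dots> = True # enc_vertex (vertex p)"
  proof (rule nth_equalityI)
    fix i assume i: "i < length (map (\<lambda>q. L q \<in> true_labels) [p..<?q])"
    show "map (\<lambda>q. L q \<in> true_labels) [p..<?q] ! i = (True # enc_vertex (vertex p)) ! i"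
    proof (cases i)
      case 0
      then show ?thesis using label_vertex_start[OF v] by (simp add: true_labels_def del: upt_Suc)
    next
      case (Suc j)
      then show ?thesis using vertex_at_bits[OF v, of j] i by (simp del: upt_Suc)
    qed
  qed simp
  finally show ?thesis .
qed

lemma row_not_sel:
  assumes "\<not> sel p" shows "row p = (if p = length w then [False] else [])"
proof -
  have em: "emitted Write_True Write_False w p q = (if p = length w \<and> q = 0 then [False] else [])" for q
    using assms less good_chosen by (auto simp: emitted_Write write_pos_iff)
  have "[0..<N] = 0 # [1..<N]" using length_less_N by (simp add: upt_conv_Cons)
  then show ?thesis unfolding row_def by (simp add: em)
qed

lemma concat_if: "concat (map (\<lambda>x. if P x then f x else []) xs) = concat (map f (filter P xs))"
  by (induction xs) auto

definition vertices :: "nat list" where "vertices = map vertex (filter sel [0..<length w])"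

text \<open>Selected rows all lie before \<open>length w\<close> and write an announced vertex each,
  row \<open>length w\<close> writes the closing \<open>False\<close>, and the later rows are
  silent: together this is a list code.\<close>

lemma output_chosen: "form_output Write_True Write_False w = enc_edge vertices"
proof -
  have "form_output Write_True Write_False w = concat (map row [0..<N])"
    unfolding form_output_def row_def[abs_def] N[symmetric] ..
  also have "[0..<N] = [0..<length w] @ length w # [Suc (length w)..<N]"
    using length_less_N by (metis le_eq_less_or_eq upt_add_eq_append upt_conv_Cons zero_le le_add_diff_inverse)
  also have "concat (map row \<dots>) = concat (map row [0..<length w]) @ [False]"
  proof -
    have "row x = (if x = length w then [False] else [])" if "length w \<le> x" for x
    proof -
      have "\<not> sel x" using sel_less[of x] that by auto
      then show ?thesis by (rule row_not_sel)
    qed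
    then have "row (length w) = [False]" "concat (map row [Suc (length w)..<N]) = []" by auto
    then show ?thesis by simp
  qed
  also have "map row [0..<length w] = map (\<lambda>p. if sel p then True # enc_vertex (vertex p) else []) [0..<length w]"
    using row_sel row_not_sel by auto
  finally show ?thesis
    unfolding enc_edge_def enc_list_def vertices_def concat_if by (simp add: comp_def)
qed

lemma lists_set_vertices:
  "lists_set vertices (frequent V H (\<Union>(item_set ` items N \<sigma> M B)))" (is "lists_set _ ?F")
  unfolding lists_set_def
proof
  have "p = p'" if s: "sel p" "sel p'" "vertex p = vertex p'" for p p'
  proof (rule ccontr)
    have same: "same_vertex N L q q'" if "sel q" "sel q'" "vertex q = vertex q'" for q q'
      using sel_vertex_at[OF that(1)] sel_vertex_at[OF that(2)] same_vertex_iff that(3) by metis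
    have "\<not> q < q'" if "sel q" "sel q'" "vertex q = vertex q'" for q q'
      using same[OF that] that sel_less[OF that(1)] length_less_N unfolding selected_def by (meson less_trans)
    moreover assume "p \<noteq> p'"
    ultimately show False using s by (metis nat_neq_iff)
  qed
  then show "distinct vertices" by (auto simp: vertices_def distinct_map inj_on_def)
  show "set vertices = ?F"
  proof (intro equalityI subsetI)
    fix v assume "v \<in> set vertices"
    then obtain p where p: "sel p" "v = vertex p" by (auto simp: vertices_def)
    then obtain e where "vertex_at 8 e p v" using sel_vertex_at by blast
    then show "v \<in> ?F" using in_transversal_iff[OF refl] p(1) by (auto simp: selected_def)
  next
    fix v assume v: "v \<in> ?F"
    then have "v \<in> V" by (simp add: frequent_def)
    \<comment> \<open>The first occurrence of \<open>v\<close> in \<open>H\<close> is the one at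
      which \<open>v\<close> is written.\<close>
    define u where "u = (LEAST u. \<exists>e. vertex_at 8 e u v)"
    have "\<exists>u e. vertex_at 8 e u v" using V_vertex_at[OF \<open>v \<in> V\<close>] by blast
    then have "\<exists>e. vertex_at 8 e u v" unfolding u_def by (rule LeastI_ex)
    then obtain e where e: "vertex_at 8 e u v" by blast
    have "\<not> (\<exists>u'<N. u' < u \<and> L u' = 12 \<and> same_vertex N L u' u)"
    proof (intro notI, elim exE conjE)
      fix u' assume u': "u' < u" "L u' = 12" "same_vertex N L u' u"
      then obtain e' v' where "vertex_at 8 e' u' v'" using label_vertex_iff[of 8 u'] by auto
      moreover from this have "v' = v" using same_vertex_iff[OF _ e] u'(3) by blast
      ultimately show False using u'(1) not_less_Least unfolding u_def by blast
    qed
    then have "sel u"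
      using in_transversal_iff[OF refl e] v label_vertex_start[OF e] by (simp add: selected_def)
    then show "v \<in> set vertices" using vertex_eq[OF e] sel_less by (force simp: vertices_def)
  qed
qed

end

lemma output_correct:
  "if \<exists>T. new_transversal V G H T
   then \<exists>T ts. new_transversal V G H T \<and> lists_set ts T \<and> form_output Write_True Write_False w = enc_edge ts
   else form_output Write_True Write_False w = null_output"
proof (cases "\<exists>T. new_transversal V G H T")
  case True
  then obtain \<sigma> M B where c: "chosen N L \<sigma> M B" "\<sigma> < N" "M < N" "B < N"
    using good_exists chosen_exists by meson
  let ?F = "frequent V H (\<Union>(item_set ` items N \<sigma> M B))"
  have "new_transversal V G H ?F" using good_iff[OF refl] c(1) by (simp add: chosen_def)
  then show ?thesis using True output_chosen[OF c] lists_set_vertices[OF c] by auto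
next
  case False
  then have "\<not> good N L \<sigma> M B" for \<sigma> M B using good_iff[OF refl] by blast
  then have "emitted Write_True Write_False w p q = []" for p q
    by (simp add: emitted_Write write_pos_def chosen_def)
  then show ?thesis using False by (simp add: form_output_def null_output_def)
qed

end

theorem theorem3:
  shows "\<exists>f \<in> FDSPACE (\<lambda>n. (log 2 (real n))\<^sup>2).
    \<forall>(V :: nat set) G H gs hs.
      hypergraph V G \<longrightarrow> hypergraph V H \<longrightarrow> intersection_property G H \<longrightarrow>
      adjacency_lists gs G \<longrightarrow> adjacency_lists hs H \<longrightarrow>
      (if \<exists>T. new_transversal V G H T
       then \<exists>T ts. new_transversal V G H T \<and> lists_set ts T \<and> f (enc_instance gs hs) = enc_edge ts
       else f (enc_instance gs hs) = null_output)"
proof (intro bexI[of _ "form_output Write_True Write_False"] allI impI)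
  show "form_output Write_True Write_False \<in> FDSPACE (\<lambda>n. (log 2 (real n))\<^sup>2)"
    by (rule form_output_FDSPACE[OF _ wff_Write_True wff_Write_False]) simp
next
  fix V :: "nat set" and G H gs hs
  assume "hypergraph V G" "hypergraph V H" "intersection_property G H" "adjacency_lists gs G" "adjacency_lists hs H"
  then interpret hypergraph_instance gs hs "enc_instance gs hs" V G H "2 ^ width (length (enc_instance gs hs))"
    by unfold_locales auto
  show "if \<exists>T. new_transversal V G H T
       then \<exists>T ts. new_transversal V G H T \<and> lists_set ts T \<and>
         form_output Write_True Write_False (enc_instance gs hs) = enc_edge ts
       else form_output Write_True Write_False (enc_instance gs hs) = null_output"
    by (rule output_correct)
qed

end
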